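(* Let $(\mathcal A,k_\alpha)$ be a configuration in the Euclidean space $V=\mathbb R^n$ and let $$L_{\mathcal A}=\Delta_n-\sum_{\alpha\in\mathcal A_+}\frac{k_\alpha(k_\alpha+1)(\alpha,\alpha)}{(\alpha,x)^2}.$$ Assume that $L_{\mathcal A}$ is a completely integrable quantum Hamiltonian whose quantum integrals $L_1,\dots,L_n$ have algebraically independent constant principal symbols $p_1,\dots,p_n\in\mathbb R[V^*]$. Assume that $k_\alpha\notin\mathbb Z$ for all $\alpha\in\mathcal A$. Then the polynomials $p_i$ are invariant under a finite Coxeter group $W\subset \mathrm{GL}(V)$, and $\mathcal A$ is a subset of the root system $R$ of $W$.
   Context: $V=\mathbb R^n$ carries the standard inner product $(\cdot,\cdot)$, and $\Delta_n$ is the Laplacian. A configuration $(\mathcal A,k_\alpha)$ consists of a finite collection $\mathcal A_+$ of pairwise nonparallel nonzero vectors of $V$ with prescribed multiplicities $k_\alpha\in\mathbb R$; one sets $\mathcal A=\mathcal A_+\cup(-\mathcal A_+)$ and $k_{-\alpha}=k_\alpha$. The operator $L_{\mathcal A}$ is completely integrable if there are $n$ algebraically independent linear partial differential operators $L_1,\dots,L_n$ (with coefficients regular off the hyperplanes $(\alpha,x)=0$, $\alpha\in\mathcal A$), including $L_{\mathcal A}$, with $[L_i,L_j]=0$ for all $i,j$; these are called its quantum integrals. A principal symbol is constant if it does not depend on $x$, i.e. it is a polynomial in the dual (momentum) variable. The root system $R$ of a finite Coxeter group $W$ (generated by orthogonal reflections of $V$) is the set $R=R_+\cup(-R_+)$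 of normals to the reflection hyperplanes of $W$; only the directions of the normals are important (lengths are a matter of choice). *)

theory Defs
  imports "HOL-Algebra.Bij" "HOL-Algebra.Generated_Groups"
    "HOL-Analysis.Analysis" "HOL-Library.Poly_Mapping"
begin

section \<open>Configurations\<close>

definition configuration :: "(real^'n) set \<Rightarrow> (real^'n \<Rightarrow> real) \<Rightarrow> bool" where
  "configuration Ap k \<longleftrightarrow>
     finite Ap \<and> 0 \<notin> Ap \<and> pairwise (\<lambda>\<alpha> \<beta>. \<not> collinear {0, \<alpha>, \<beta>}) Ap \<and>
     (\<forall>\<alpha>\<in>Ap. k (- \<alpha>) = k \<alpha>)"

definition all_vectors :: "(real^'n) set \<Rightarrow> (real^'n) set" where
  "all_vectors Ap = Ap \<union> uminus ` Ap"

definition regular_set :: "(real^'n) set \<Rightarrow> (real^'n) set" where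
  "regular_set Ap = {x. \<forall>\<alpha>\<in>all_vectors Ap. \<alpha> \<bullet> x \<noteq> 0}"


section \<open>Partial derivatives and smooth functions\<close>

definition partial :: "'n::finite \<Rightarrow> (real^'n \<Rightarrow> real) \<Rightarrow> real^'n \<Rightarrow> real" where
  "partial i f x = frechet_derivative f (at x) (axis i 1)"

text \<open>Meant for open \<open>U\<close>: all iterated partial derivatives exist on \<open>U\<close> and are
  (Frechet) differentiable there, that is, \<open>f\<close> is of class \<open>C\<^sup>\<infinity>\<close> on \<open>U\<close>.\<close>

definition smooth_on :: "(real^'n::finite) set \<Rightarrow> (real^'n \<Rightarrow> real) \<Rightarrow> bool" where
  "smooth_on U f \<longleftrightarrow> (\<forall>is. \<forall>x\<in>U. foldr partial is f differentiable (at x))"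

text \<open>The index type carries no order, so one enumeration of it is fixed in order to
  write products of pairwise commuting operators. Which one is immaterial: partial
  derivatives of smooth functions commute, and \<^verbatim>\<open>op_monomial\<close> below is only used for
  commuting operators.\<close>

definition index_list :: "'n::finite list" where
  "index_list = (SOME xs. distinct xs \<and> set xs = UNIV)"

definition multi_partial ::
  "('n::finite \<Rightarrow>\<^sub>0 nat) \<Rightarrow> (real^'n \<Rightarrow> real) \<Rightarrow> real^'n \<Rightarrow> real" where
  "multi_partial \<nu> f = foldr (\<lambda>i g. (partial i ^^ Poly_Mapping.lookup \<nu> i) g) index_list f"

definition multi_degree :: "('n::finite \<Rightarrow>\<^sub>0 nat) \<Rightarrow> nat" where
  "multi_degree \<nu> = (\<Sum>i\<in>UNIV. Poly_Mapping.lookup \<nu> i)"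


section \<open>Linear partial differential operators\<close>

text \<open>The operator \<open>\<Sum>\<^sub>\<nu> a\<^sub>\<nu>(x) \<partial>\<^sup>\<nu>\<close> on the open set \<open>U\<close> is given by its coefficients
  \<open>a\<close>; their values outside \<open>U\<close> are irrelevant.\<close>

type_synonym 'n coeffs = "('n \<Rightarrow>\<^sub>0 nat) \<Rightarrow> real^'n \<Rightarrow> real"

definition op_support :: "(real^'n::finite) set \<Rightarrow> 'n coeffs \<Rightarrow> ('n \<Rightarrow>\<^sub>0 nat) set" where
  "op_support U a = {\<nu>. \<exists>x\<in>U. a \<nu> x \<noteq> 0}"

definition diff_op :: "(real^'n::finite) set \<Rightarrow> 'n coeffs \<Rightarrow> bool" where
  "diff_op U a \<longleftrightarrow> finite (op_support U a) \<and> (\<forall>\<nu>. smooth_on U (a \<nu>))"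

definition op_apply ::
  "(real^'n::finite) set \<Rightarrow> 'n coeffs \<Rightarrow> (real^'n \<Rightarrow> real) \<Rightarrow> real^'n \<Rightarrow> real" where
  "op_apply U a f x = (\<Sum>\<nu>\<in>op_support U a. a \<nu> x * multi_partial \<nu> f x)"

definition op_commute :: "(real^'n::finite) set \<Rightarrow> 'n coeffs \<Rightarrow> 'n coeffs \<Rightarrow> bool" where
  "op_commute U a b \<longleftrightarrow>
     (\<forall>f. smooth_on U f \<longrightarrow>
       (\<forall>x\<in>U. op_apply U a (op_apply U b f) x = op_apply U b (op_apply U a f) x))"

definition op_order :: "(real^'n::finite) set \<Rightarrow> 'n coeffs \<Rightarrow> nat" where
  "op_order U a = Max (multi_degree ` op_support U a)"

definition principal_symbol ::
  "(real^'n::finite) set \<Rightarrow> 'n coeffs \<Rightarrow> real^'n \<Rightarrow> real^'n \<Rightarrow> real" where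
  "principal_symbol U a x \<xi> =
     (\<Sum>\<nu> | \<nu> \<in> op_support U a \<and> multi_degree \<nu> = op_order U a.
        a \<nu> x * (\<Prod>i\<in>UNIV. (\<xi> $ i) ^ Poly_Mapping.lookup \<nu> i))"

text \<open>Such a \<open>p\<close> is automatically a polynomial function, and the elements of
  \<open>\<real>[V\<^sup>*]\<close> are represented by the functions they define on momentum space.\<close>

definition has_constant_symbol ::
  "(real^'n::finite) set \<Rightarrow> 'n coeffs \<Rightarrow> (real^'n \<Rightarrow> real) \<Rightarrow> bool" where
  "has_constant_symbol U a p \<longleftrightarrow> (\<forall>x\<in>U. \<forall>\<xi>. principal_symbol U a x \<xi> = p \<xi>)"


section \<open>Algebraic independence\<close>

text \<open>Polynomials in variables indexed by \<open>'n\<close> are elements of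
  \<open>('n \<Rightarrow>\<^sub>0 nat) \<Rightarrow>\<^sub>0 real\<close>.\<close>

definition alg_independent :: "('n::finite \<Rightarrow> real^'n \<Rightarrow> real) \<Rightarrow> bool" where
  "alg_independent p \<longleftrightarrow>
     (\<forall>Q :: ('n \<Rightarrow>\<^sub>0 nat) \<Rightarrow>\<^sub>0 real.
        (\<forall>\<xi>. (\<Sum>m\<in>Poly_Mapping.keys Q. Poly_Mapping.lookup Q m *
           (\<Prod>i\<in>UNIV. p i \<xi> ^ Poly_Mapping.lookup m i)) = 0) \<longrightarrow> Q = 0)"

definition op_monomial ::
  "(real^'n::finite) set \<Rightarrow> ('n \<Rightarrow> 'n coeffs) \<Rightarrow> ('n \<Rightarrow>\<^sub>0 nat) \<Rightarrow>
     (real^'n \<Rightarrow> real) \<Rightarrow> real^'n \<Rightarrow> real" where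
  "op_monomial U L m f =
     foldr (\<lambda>i g. (op_apply U (L i) ^^ Poly_Mapping.lookup m i) g) index_list f"

definition op_alg_independent ::
  "(real^'n::finite) set \<Rightarrow> ('n \<Rightarrow> 'n coeffs) \<Rightarrow> bool" where
  "op_alg_independent U L \<longleftrightarrow>
     (\<forall>Q :: ('n \<Rightarrow>\<^sub>0 nat) \<Rightarrow>\<^sub>0 real.
        (\<forall>f. smooth_on U f \<longrightarrow>
          (\<forall>x\<in>U. (\<Sum>m\<in>Poly_Mapping.keys Q. Poly_Mapping.lookup Q m *
             op_monomial U L m f x) = 0)) \<longrightarrow> Q = 0)"


section \<open>The Hamiltonian and its quantum integrals\<close>

definition laplacian :: "(real^'n::finite \<Rightarrow> real) \<Rightarrow> real^'n \<Rightarrow> real" where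
  "laplacian f x = (\<Sum>i\<in>UNIV. partial i (partial i f) x)"

definition hamiltonian ::
  "(real^'n::finite) set \<Rightarrow> (real^'n \<Rightarrow> real) \<Rightarrow> (real^'n \<Rightarrow> real) \<Rightarrow> real^'n \<Rightarrow> real" where
  "hamiltonian Ap k f x =
     laplacian f x - (\<Sum>\<alpha>\<in>Ap. k \<alpha> * (k \<alpha> + 1) * (\<alpha> \<bullet> \<alpha>) / (\<alpha> \<bullet> x)\<^sup>2) * f x"

text \<open>The family \<open>L\<close> is indexed by \<open>'n\<close>, so it consists of \<open>n = dim V\<close> operators.\<close>

definition quantum_integrals ::
  "(real^'n::finite) set \<Rightarrow> (real^'n \<Rightarrow> real) \<Rightarrow> ('n \<Rightarrow> 'n coeffs) \<Rightarrow> bool" where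
  "quantum_integrals Ap k L \<longleftrightarrow>
     (let U = regular_set Ap in
       (\<forall>i. diff_op U (L i)) \<and>
       (\<exists>i. \<forall>f. smooth_on U f \<longrightarrow> (\<forall>x\<in>U. op_apply U (L i) f x = hamiltonian Ap k f x)) \<and>
       (\<forall>i j. op_commute U (L i) (L j)) \<and>
       op_alg_independent U L)"


section \<open>Finite Coxeter groups and their root systems\<close>

definition reflection :: "real^'n \<Rightarrow> real^'n \<Rightarrow> real^'n" where
  "reflection \<alpha> x = x - (2 * (\<alpha> \<bullet> x) / (\<alpha> \<bullet> \<alpha>)) *\<^sub>R \<alpha>"

text \<open>Being generated by linear maps, such a group of bijections lies in \<open>GL(V)\<close>.\<close>

definition finite_coxeter_group :: "(real^'n \<Rightarrow> real^'n) set \<Rightarrow> bool" where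
  "finite_coxeter_group W \<longleftrightarrow>
     finite W \<and> (\<exists>S. 0 \<notin> S \<and> W = generate (BijGroup UNIV) (reflection ` S))"

definition mirror :: "real^'n \<Rightarrow> (real^'n) set" where
  "mirror \<alpha> = {x. \<alpha> \<bullet> x = 0}"

definition mirrors :: "(real^'n \<Rightarrow> real^'n) set \<Rightarrow> (real^'n) set set" where
  "mirrors W = {mirror \<alpha> |\<alpha>. \<alpha> \<noteq> 0 \<and> reflection \<alpha> \<in> W}"

text \<open>One normal, of arbitrary length, is chosen for each reflection hyperplane; in
  particular \<open>R\<close> need not be stable under \<open>W\<close>.\<close>

definition root_system_of :: "(real^'n \<Rightarrow> real^'n) set \<Rightarrow> (real^'n) set \<Rightarrow> bool" where
  "root_system_of W R \<longleftrightarrow>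
     (\<exists>Rp. 0 \<notin> Rp \<and> bij_betw mirror Rp (mirrors W) \<and> R = Rp \<union> uminus ` Rp)"

end

theory Submission
  imports Defs "HOL-Library.Landau_Symbols" "HOL-Computational_Algebra.Polynomial"
begin

text \<open>Let \<open>t\<close> be the distance to the mirror of \<open>\<alpha>\<close>, \<open>\<kappa> = k \<alpha>\<close>, and let \<open>L\<close> be an integral of order \<open>m\<close>
  with symbol \<open>p\<close>. Near a generic point of the mirror the potential is \<open>\<kappa> (\<kappa> + 1) / t\<^sup>2\<close> plus a
  smooth function. Commutation with the Hamiltonian expresses the derivative along \<open>\<xi>\<close> of the
  part of degree \<open>N\<close> of the full symbol, evaluated at \<open>\<xi>\<close>, by the parts of higher degree;
  integrating this downwards from \<open>N = m\<close>, the coefficient of \<open>\<partial>\<^sup>\<nu>\<close> turns out to be of order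
  \<open>t^-(m - |\<nu>|)\<close> and homogeneous to leading order. Applying the commutation relation to
  \<open>t^s exp (\<lambda> \<eta> \<bullet> x)\<close> with \<open>\<eta>\<close> tangent to the mirror, the leading term of the coefficient of
  \<open>\<lambda>^(m - r)\<close> gives \<open>f(s) g(s - r) - g(s) f(s - 2) \<rightarrow> 0\<close> on approach to the mirror, where
  \<open>g(s) = s (s - 1) - \<kappa> (\<kappa> + 1)\<close> and \<open>f\<close> is a polynomial in \<open>s\<close> of degree \<open>r\<close> whose leading
  coefficient is that of \<open>\<tau>^r\<close> in \<open>p (\<tau> \<alpha> / |\<alpha>| + \<eta>)\<close>. Since \<open>g(\<kappa> + 1) = 0\<close>, for odd \<open>r\<close> and
  \<open>\<kappa> \<notin> \<int>\<close> the polynomial \<open>f\<close> tends to \<open>0\<close> at all points \<open>\<kappa> + 1 + 2 i\<close>, so \<open>p\<close> is even in \<open>\<tau>\<close>.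

  Hence the \<open>p\<^sub>i\<close> are invariant under the group generated by the reflections in \<open>\<A>\<close>. This group is
  finite: the coordinates are algebraic over the algebraically independent \<open>p\<^sub>i\<close>, so generic orbits
  are finite.\<close>

section \<open>Calculus of smooth functions\<close>

text \<open>The coefficients of the integrals are merely smooth off the mirrors, so no Laurent
  expansion is at hand; growth is measured by classes of functions that are stable under derivatives
  and under integration along transversal lines. Integration improves t^-(q+1) to t^-q only for q >
  0, which suits a descent from the constant symbol, where q = m - N is at least 1. Bounds alone
  would leave derivatives of an unknown leading term; approximate homogeneity turns the Laplacian on
  it into a scalar, and commutation into a recursion in s with step 2.

  Going from s - 2 to s divides by g(s - r), and g(\<kappa> + 1 + d) = d (2 \<kappa> + 1 + d) with d
  = 2 i - r. For odd r the first factor is nonzero by parity, and a zero of the second would make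
  \<kappa> an integer. For even r the factor d vanishes at i = r / 2, which is where the even
  coefficients of p escape.\<close>

definition dd :: "real^'n::finite \<Rightarrow> (real^'n \<Rightarrow> real) \<Rightarrow> real^'n \<Rightarrow> real" where
  "dd v f x = frechet_derivative f (at x) v"

lemma partial_eq_dd: "partial i = dd (axis i 1)"
  by (simp add: fun_eq_iff partial_def dd_def)

lemma dd_eqI: "(f has_derivative f') (at x) \<Longrightarrow> dd v f x = f' v"
  unfolding dd_def using frechet_derivative_at by metis

lemma has_derivative_dd: "f differentiable (at x) \<Longrightarrow> (f has_derivative (\<lambda>v. dd v f x)) (at x)"
  unfolding dd_def using frechet_derivative_works by blast

lemma linear_dd: "f differentiable (at x) \<Longrightarrow> linear (\<lambda>v. dd v f x)"
  using has_derivative_dd has_derivative_linear by blast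

text \<open>No differentiability is assumed: whether a linear map is a derivative depends only on
  the germ, so both sides choose from the same set.\<close>

lemma dd_cong:
  assumes "open U" "x \<in> U" "\<And>y. y \<in> U \<Longrightarrow> f y = g y"
  shows "dd v f x = dd v g x"
proof -
  have "(f has_derivative f') (at x) \<longleftrightarrow> (g has_derivative f') (at x)" for f'
  proof
    show "(f has_derivative f') (at x) \<Longrightarrow> (g has_derivative f') (at x)"
      by (erule has_derivative_transform_within_open[OF _ assms(1,2)]) (rule assms(3))
    show "(g has_derivative f') (at x) \<Longrightarrow> (f has_derivative f') (at x)"
      by (erule has_derivative_transform_within_open[OF _ assms(1,2)]) (simp add: assms(3))
  qed
  then show ?thesis unfolding dd_def frechet_derivative_def by simp
qed

lemma differentiable_cong_open:
  assumes "open U" "x \<in> U" "\<And>y. y \<in> U \<Longrightarrow> f y = g y" "f differentiable (at x)"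
  shows "g differentiable (at x)"
proof -
  obtain f' where "(f has_derivative f') (at x)" using assms(4) unfolding differentiable_def by blast
  from has_derivative_transform_within_open[OF this assms(1,2,3)] show ?thesis
    by (rule differentiableI)
qed

lemma dd_const [simp]: "dd v (\<lambda>x. c) x = 0"
  by (simp add: dd_def)

lemma dd_inner [simp]: "dd v (\<lambda>x. a \<bullet> x) x = a \<bullet> v"
  by (rule dd_eqI) (auto intro!: derivative_eq_intros)

lemma dd_add:
  "f differentiable (at x) \<Longrightarrow> g differentiable (at x) \<Longrightarrow> dd v (\<lambda>x. f x + g x) x = dd v f x + dd v g x"
  by (intro dd_eqI has_derivative_add has_derivative_dd)

lemma dd_mult:
  "f differentiable (at x) \<Longrightarrow> g differentiable (at x) \<Longrightarrow>
    dd v (\<lambda>x. f x * g x) x = f x * dd v g x + dd v f x * g x"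
  by (intro dd_eqI has_derivative_mult has_derivative_dd)

lemma dd_cmult: "f differentiable (at x) \<Longrightarrow> dd v (\<lambda>x. c * f x) x = c * dd v f x"
  by (subst dd_mult) auto

lemma dd_sum:
  assumes "\<And>i. i \<in> I \<Longrightarrow> f i differentiable (at x)"
  shows "dd v (\<lambda>x. \<Sum>i\<in>I. f i x) x = (\<Sum>i\<in>I. dd v (f i) x)"
  using assms by (intro dd_eqI has_derivative_sum has_derivative_dd) auto

lemma dd_expand:
  assumes "f differentiable (at x)"
  shows "dd v f x = (\<Sum>i\<in>UNIV. v $ i * partial i f x)"
proof -
  have "dd v f x = dd (\<Sum>i\<in>UNIV. v $ i *\<^sub>R axis i 1) f x"
    by (simp add: basis_expansion[of v, unfolded scalar_mult_eq_scaleR])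
  also have "\<dots> = (\<Sum>i\<in>UNIV. v $ i * dd (axis i 1) f x)"
    using linear_sum[OF linear_dd[OF assms], of "\<lambda>i. v $ i *\<^sub>R axis i 1" UNIV]
      linear_cmul[OF linear_dd[OF assms]] by simp
  finally show ?thesis by (simp add: partial_eq_dd)
qed

lemma dd_line:
  assumes "f differentiable (at (x + s *\<^sub>R v))"
  shows "((\<lambda>s. f (x + s *\<^sub>R v)) has_real_derivative dd v f (x + s *\<^sub>R v)) (at s)"
proof -
  have "((\<lambda>s. x + s *\<^sub>R v) has_derivative (\<lambda>h. h *\<^sub>R v)) (at s)"
    by (auto intro!: derivative_eq_intros)
  from has_derivative_compose[OF this has_derivative_dd[OF assms]]
  show ?thesis
    using linear_cmul[OF linear_dd[OF assms]]
    by (simp add: has_field_derivative_def mult_commute_abs)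
qed

lemma foldr_partial_cong:
  assumes "open U" "\<And>y. y \<in> U \<Longrightarrow> f y = g y"
  shows "x \<in> U \<Longrightarrow> foldr partial is f x = foldr partial is g x"
proof (induction "is" arbitrary: x)
  case (Cons i "is")
  show ?case
    using dd_cong[OF assms(1) Cons.prems Cons.IH] by (simp add: partial_eq_dd)
qed (simp add: assms)

lemma smooth_on_differentiable: "smooth_on U f \<Longrightarrow> x \<in> U \<Longrightarrow> f differentiable (at x)"
  unfolding smooth_on_def by (metis foldr_Nil id_apply)

lemma smooth_on_partial: "smooth_on U f \<Longrightarrow> smooth_on U (partial i f)"
proof -
  assume f: "smooth_on U f"
  have "foldr partial is (partial i f) = foldr partial (is @ [i]) f" for "is"
    by simp
  then show ?thesis using f unfolding smooth_on_def by metis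
qed

lemma smooth_on_subset: "smooth_on U f \<Longrightarrow> V \<subseteq> U \<Longrightarrow> smooth_on V f"
  unfolding smooth_on_def by blast

text \<open>Closure under derivatives is asked only up to equality on \<open>U\<close>, since
  formulas for derivatives may fail outside it. The induction peels entries off the right end of the
  list, where \<open>foldr\<close> starts to differentiate.\<close>

lemma smooth_on_coinduct:
  assumes U: "open U" and P: "P f"
    and diff: "\<And>f x. P f \<Longrightarrow> x \<in> U \<Longrightarrow> f differentiable (at x)"
    and step: "\<And>f i. P f \<Longrightarrow> \<exists>g. P g \<and> (\<forall>x\<in>U. partial i f x = g x)"
  shows "smooth_on U f"
proof -
  have "P f \<Longrightarrow> \<forall>x\<in>U. foldr partial is f differentiable (at x)" for "is" f
  proof (induction "is" arbitrary: f rule: rev_induct)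
    case Nil
    then show ?case using diff by simp
  next
    case (snoc i "is")
    obtain g where g: "P g" "\<forall>x\<in>U. partial i f x = g x" using step[OF snoc.prems] by blast
    have eq: "foldr partial is g y = foldr partial (is @ [i]) f y" if "y \<in> U" for y
      using foldr_partial_cong[OF U _ that, of g "partial i f"] g(2) by simp
    show ?case
    proof
      fix x assume x: "x \<in> U"
      show "foldr partial (is @ [i]) f differentiable (at x)"
        by (rule differentiable_cong_open[OF U x eq]) (use snoc.IH[OF g(1)] x in auto)
    qed
  qed
  then show ?thesis using P unfolding smooth_on_def by blast
qed

lemma smooth_on_cong:
  assumes "open U" "smooth_on U f" "\<And>x. x \<in> U \<Longrightarrow> f x = g x"
  shows "smooth_on U g"
proof (rule smooth_on_coinduct[OF assms(1), where P = "\<lambda>g. \<exists>f. smooth_on U f \<and> (\<forall>x\<in>U. f x = g x)"])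
  show "\<exists>f. smooth_on U f \<and> (\<forall>x\<in>U. f x = g x)" using assms by blast
next
  fix f x assume "\<exists>f'. smooth_on U f' \<and> (\<forall>x\<in>U. f' x = f x)" and x: "x \<in> U"
  then obtain f' where f': "smooth_on U f'" "\<forall>x\<in>U. f' x = f x" by blast
  show "f differentiable (at x)"
    by (rule differentiable_cong_open[OF assms(1) x, of f'])
      (use f' x in \<open>auto intro: smooth_on_differentiable\<close>)
next
  fix f i assume "\<exists>f'. smooth_on U f' \<and> (\<forall>x\<in>U. f' x = f x)"
  then obtain f' where "smooth_on U f'" "\<forall>x\<in>U. f' x = f x" by blast
  have "\<forall>x\<in>U. partial i f' x = partial i f x"
    unfolding partial_eq_dd using \<open>\<forall>x\<in>U. f' x = f x\<close> by (blast intro: dd_cong[OF assms(1)])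
  then show "\<exists>g. (\<exists>f. smooth_on U f \<and> (\<forall>x\<in>U. f x = g x)) \<and> (\<forall>x\<in>U. partial i f x = g x)"
    using \<open>smooth_on U f'\<close> smooth_on_partial by fastforce
qed

section \<open>Closure properties of smooth functions\<close>

lemma smooth_on_const: "open (U :: (real^'n::finite) set) \<Longrightarrow> smooth_on U (\<lambda>x. c)"
proof (rule smooth_on_coinduct[where P = "\<lambda>f. \<exists>c. f = (\<lambda>x. c)"])
  fix f :: "real^'n \<Rightarrow> real" and i assume "\<exists>c. f = (\<lambda>x. c)"
  then have "\<forall>x\<in>U. partial i f x = 0" by (auto simp: partial_eq_dd)
  then show "\<exists>g. (\<exists>c. g = (\<lambda>x. c)) \<and> (\<forall>x\<in>U. partial i f x = g x)"
    by (intro exI[of _ "\<lambda>x. 0"]) auto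
qed auto

text \<open>The Leibniz rule turns one product into a sum of two, so products alone are not closed
  under derivatives. The algebra generated by the smooth functions is, and serves as the class in
  \<open>smooth_on_coinduct\<close>.\<close>

inductive smooth_alg :: "(real^'n::finite) set \<Rightarrow> (real^'n \<Rightarrow> real) \<Rightarrow> bool" for U where
  base: "smooth_on U f \<Longrightarrow> smooth_alg U f"
| add: "smooth_alg U f \<Longrightarrow> smooth_alg U g \<Longrightarrow> smooth_alg U (\<lambda>x. f x + g x)"
| mult: "smooth_alg U f \<Longrightarrow> smooth_alg U g \<Longrightarrow> smooth_alg U (\<lambda>x. f x * g x)"

lemma smooth_alg_differentiable:
  "smooth_alg U f \<Longrightarrow> x \<in> U \<Longrightarrow> f differentiable (at x)"
  by (induction rule: smooth_alg.induct)
    (auto intro: smooth_on_differentiable differentiable_add differentiable_mult)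

lemma smooth_alg_partial:
  "smooth_alg U f \<Longrightarrow> \<exists>g. smooth_alg U g \<and> (\<forall>x\<in>U. partial i f x = g x)"
proof (induction rule: smooth_alg.induct)
  case (base f)
  then show ?case using smooth_on_partial smooth_alg.base by blast
next
  case (add f g)
  then obtain f' g' where *: "smooth_alg U f'" "\<forall>x\<in>U. partial i f x = f' x"
    "smooth_alg U g'" "\<forall>x\<in>U. partial i g x = g' x" by blast
  have "\<forall>x\<in>U. partial i (\<lambda>x. f x + g x) x = f' x + g' x"
    using * by (simp add: partial_eq_dd dd_add add.hyps[THEN smooth_alg_differentiable])
  then show ?case using smooth_alg.add[OF *(1,3)] by blast
next
  case (mult f g)
  then obtain f' g' where *: "smooth_alg U f'" "\<forall>x\<in>U. partial i f x = f' x"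
    "smooth_alg U g'" "\<forall>x\<in>U. partial i g x = g' x" by blast
  have "\<forall>x\<in>U. partial i (\<lambda>x. f x * g x) x = f x * g' x + f' x * g x"
    using * by (simp add: partial_eq_dd dd_mult mult.hyps[THEN smooth_alg_differentiable])
  then show ?case
    using smooth_alg.add[OF smooth_alg.mult[OF mult.hyps(1) *(3)] smooth_alg.mult[OF *(1) mult.hyps(2)]]
    by blast
qed

lemma smooth_alg_smooth_on: "open U \<Longrightarrow> smooth_alg U f \<Longrightarrow> smooth_on U f"
  by (rule smooth_on_coinduct[where P = "smooth_alg U"])
    (auto intro: smooth_alg_differentiable smooth_alg_partial)

lemma smooth_on_add:
  "open U \<Longrightarrow> smooth_on U f \<Longrightarrow> smooth_on U g \<Longrightarrow> smooth_on U (\<lambda>x. f x + g x)"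
  by (simp add: smooth_alg_smooth_on smooth_alg.intros)

lemma smooth_on_mult:
  "open U \<Longrightarrow> smooth_on U f \<Longrightarrow> smooth_on U g \<Longrightarrow> smooth_on U (\<lambda>x. f x * g x)"
  by (simp add: smooth_alg_smooth_on smooth_alg.intros)

lemma smooth_on_cmult: "open U \<Longrightarrow> smooth_on U f \<Longrightarrow> smooth_on U (\<lambda>x. c * f x)"
  by (simp add: smooth_on_const smooth_on_mult)

lemma smooth_on_diff:
  "open U \<Longrightarrow> smooth_on U f \<Longrightarrow> smooth_on U g \<Longrightarrow> smooth_on U (\<lambda>x. f x - g x)"
  using smooth_on_add[of U f "\<lambda>x. -1 * g x"] smooth_on_cmult[of U g "-1"] by simp

lemma smooth_on_sum:
  assumes "open U" "\<And>i. i \<in> I \<Longrightarrow> smooth_on U (f i)"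
  shows "smooth_on U (\<lambda>x. \<Sum>i\<in>I. f i x)"
  using assms(2) by (induction I rule: infinite_finite_induct)
    (auto intro: smooth_on_add smooth_on_const assms(1))

lemma smooth_on_inner: "open (U :: (real^'n::finite) set) \<Longrightarrow> smooth_on U (\<lambda>x. a \<bullet> x)"
proof (rule smooth_on_coinduct[where P = "\<lambda>f. (\<exists>c. f = (\<lambda>x. c)) \<or> f = (\<lambda>x. a \<bullet> x)"])
  fix f :: "real^'n \<Rightarrow> real" and i assume "(\<exists>c. f = (\<lambda>x. c)) \<or> f = (\<lambda>x. a \<bullet> x)"
  then have "\<exists>c. \<forall>x\<in>U. partial i f x = c"
  proof
    assume "f = (\<lambda>x. a \<bullet> x)"
    then show ?thesis by (intro exI[of _ "a \<bullet> axis i 1"]) (simp add: partial_eq_dd)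
  qed (auto simp: partial_eq_dd)
  then obtain c where "\<forall>x\<in>U. partial i f x = c" by blast
  then show "\<exists>g. ((\<exists>c. g = (\<lambda>x. c)) \<or> g = (\<lambda>x. a \<bullet> x)) \<and> (\<forall>x\<in>U. partial i f x = g x)"
    by (intro exI[of _ "\<lambda>x. c"]) auto
qed auto

lemma smooth_on_dd:
  assumes "open U" "smooth_on U f"
  shows "smooth_on U (dd v f)"
proof (rule smooth_on_cong[OF assms(1)])
  show "smooth_on U (\<lambda>x. \<Sum>i\<in>UNIV. v $ i * partial i f x)"
    by (intro smooth_on_sum smooth_on_cmult smooth_on_partial assms)
qed (simp add: dd_expand smooth_on_differentiable[OF assms(2)])

lemma smooth_on_continuous: "smooth_on U f \<Longrightarrow> x \<in> U \<Longrightarrow> isCont f x"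
  using smooth_on_differentiable differentiable_imp_continuous_within by blast

lemma smooth_on_exp: "open (U :: (real^'n::finite) set) \<Longrightarrow> smooth_on U (\<lambda>x. exp (a \<bullet> x))"
proof (rule smooth_on_coinduct[where P = "\<lambda>f. \<exists>c. f = (\<lambda>x. c * exp (a \<bullet> x))"])
  show "\<exists>c. (\<lambda>x. exp (a \<bullet> x)) = (\<lambda>x. c * exp (a \<bullet> x))"
    by (intro exI[of _ 1]) simp
next
  fix f x assume "\<exists>c. f = (\<lambda>x. c * exp (a \<bullet> x))"
  then show "f differentiable (at x)"
    by (elim exE) (simp only:, rule differentiableI, (rule derivative_eq_intros refl)+)
next
  fix f :: "real^'n \<Rightarrow> real" and i assume "\<exists>c. f = (\<lambda>x. c * exp (a \<bullet> x))"
  then obtain c where "f = (\<lambda>x. c * exp (a \<bullet> x))" by blast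
  moreover have "dd (axis i 1) (\<lambda>x. c * exp (a \<bullet> x)) x = (c * (a \<bullet> axis i 1)) * exp (a \<bullet> x)" for x
    by (rule dd_eqI) (auto intro!: derivative_eq_intros)
  ultimately show "\<exists>g. (\<exists>c. g = (\<lambda>x. c * exp (a \<bullet> x))) \<and> (\<forall>x\<in>U. partial i f x = g x)"
    by (intro exI[of _ "\<lambda>x. (c * (a \<bullet> axis i 1)) * exp (a \<bullet> x)"]) (auto simp: partial_eq_dd)
qed

lemma dd_exp: "dd v (\<lambda>x. exp (a \<bullet> x)) x = (a \<bullet> v) * exp (a \<bullet> x)"
  by (rule dd_eqI) (auto intro!: derivative_eq_intros)

subsection \<open>Commuting derivatives\<close>

text \<open>The mean value theorem is applied twice, first in direction \<open>v\<close> and then in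
  direction \<open>w\<close>. The second difference itself is symmetric in the two directions, which
  \<open>dd_commute\<close> exploits.\<close>

lemma second_difference_mvt:
  fixes f :: "real^'n::finite \<Rightarrow> real"
  assumes sm: "smooth_on U f" "open U" and h: "0 < h"
    and box: "\<And>s t. 0 \<le> s \<Longrightarrow> s \<le> h \<Longrightarrow> 0 \<le> t \<Longrightarrow> t \<le> h \<Longrightarrow> x + s *\<^sub>R v + t *\<^sub>R w \<in> U"
  shows "\<exists>s t. 0 < s \<and> s < h \<and> 0 < t \<and> t < h \<and>
     f (x + h *\<^sub>R v + h *\<^sub>R w) - f (x + h *\<^sub>R v) - f (x + h *\<^sub>R w) + f x
       = h * h * dd w (dd v f) (x + s *\<^sub>R v + t *\<^sub>R w)"
proof -
  define g where "g s = f ((x + h *\<^sub>R w) + s *\<^sub>R v) - f (x + s *\<^sub>R v)" for s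
  define g' where "g' s = dd v f ((x + h *\<^sub>R w) + s *\<^sub>R v) - dd v f (x + s *\<^sub>R v)" for s
  have "DERIV g s :> g' s" if "0 \<le> s" "s \<le> h" for s
    unfolding g_def g'_def
    using box[OF that, of h] box[OF that, of 0] h
    by (intro DERIV_diff dd_line smooth_on_differentiable[OF sm(1)]) (simp_all add: add_ac)
  from MVT2[OF h this] obtain s where s: "0 < s" "s < h" "g h - g 0 = (h - 0) * g' s" by auto
  define k where "k t = dd v f ((x + s *\<^sub>R v) + t *\<^sub>R w)" for t
  have "DERIV k t :> dd w (dd v f) ((x + s *\<^sub>R v) + t *\<^sub>R w)" if "0 \<le> t" "t \<le> h" for t
    unfolding k_def using box[of s t] s that
    by (intro dd_line smooth_on_differentiable[OF smooth_on_dd[OF sm(2,1)]]) simp_all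
  from MVT2[OF h this] obtain t where t: "0 < t" "t < h"
    "k h - k 0 = (h - 0) * dd w (dd v f) ((x + s *\<^sub>R v) + t *\<^sub>R w)" by auto
  have "g' s = k h - k 0"
    by (simp add: g'_def k_def add_ac)
  moreover have "f (x + h *\<^sub>R v + h *\<^sub>R w) - f (x + h *\<^sub>R v) - f (x + h *\<^sub>R w) + f x = g h - g 0"
    by (simp add: g_def add_ac)
  ultimately show ?thesis
    using s t by (intro exI[of _ s] exI[of _ t]) simp
qed

text \<open>Clairaut's theorem: by symmetry of the second difference the two mixed derivatives agree
  at points arbitrarily close to \<open>x\<close>, and both are continuous at
  \<open>x\<close>.\<close>

lemma dd_commute:
  fixes f :: "real^'n::finite \<Rightarrow> real"
  assumes U: "open U" and sm: "smooth_on U f" and x: "x \<in> U"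
  shows "dd v (dd w f) x = dd w (dd v f) x"
proof (rule ccontr)
  assume "dd v (dd w f) x \<noteq> dd w (dd v f) x"
  define e where "e = \<bar>dd v (dd w f) x - dd w (dd v f) x\<bar> / 2"
  have e: "e > 0" using \<open>_ \<noteq> _\<close> by (simp add: e_def)
  obtain r where r: "r > 0" "ball x r \<subseteq> U" using U x open_contains_ball by blast
  have c1: "isCont (dd v (dd w f)) x" and c2: "isCont (dd w (dd v f)) x"
    using smooth_on_continuous[OF _ x] smooth_on_dd[OF U] sm by blast+
  obtain d1 where d1: "d1 > 0" "\<And>y. dist y x < d1 \<Longrightarrow> \<bar>dd v (dd w f) y - dd v (dd w f) x\<bar> < e"
    using c1 e unfolding continuous_at_eps_delta dist_real_def by blast
  obtain d2 where d2: "d2 > 0" "\<And>y. dist y x < d2 \<Longrightarrow> \<bar>dd w (dd v f) y - dd w (dd v f) x\<bar> < e"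
    using c2 e unfolding continuous_at_eps_delta dist_real_def by blast
  define m where "m = min r (min d1 d2)"
  \<comment> \<open>The parallelogram spanned by \<open>h v\<close> and \<open>h w\<close> stays
    within distance \<open>m\<close> of \<open>x\<close>; the summand 1 keeps the denominator
    positive when both directions vanish.\<close>
  define h where "h = m / (2 * (norm v + norm w + 1))"
  have m: "m > 0" using r d1 d2 by (simp add: m_def)
  have nvw: "norm v + norm w + 1 > 0" using norm_ge_zero[of v] norm_ge_zero[of w] by linarith
  have h: "h > 0" using m nvw by (simp add: h_def)
  have hm: "h * (norm v + norm w) < m"
  proof -
    have "h * (norm v + norm w + 1) = m / 2" using nvw by (simp add: h_def field_simps)
    then show ?thesis using m h by (simp add: algebra_simps)
  qed
  have near: "dist (x + s *\<^sub>R v + t *\<^sub>R w) x < m" if "0 \<le> s" "s \<le> h" "0 \<le> t" "t \<le> h" for s t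
  proof -
    have "dist (x + s *\<^sub>R v + t *\<^sub>R w) x = norm (s *\<^sub>R v + t *\<^sub>R w)" by (simp add: dist_norm add.assoc)
    also have "\<dots> \<le> norm (s *\<^sub>R v) + norm (t *\<^sub>R w)" by (rule norm_triangle_ineq)
    also have "\<dots> \<le> h * norm v + h * norm w"
      using that by (intro add_mono) (simp_all add: mult_right_mono)
    finally show ?thesis using hm by (simp add: algebra_simps)
  qed
  have inU: "x + s *\<^sub>R v + t *\<^sub>R w \<in> U" if "0 \<le> s" "s \<le> h" "0 \<le> t" "t \<le> h" for s t
    using near[OF that] r by (auto simp: m_def dist_commute)
  have inU': "x + s *\<^sub>R w + t *\<^sub>R v \<in> U" if "0 \<le> s" "s \<le> h" "0 \<le> t" "t \<le> h" for s t
    using inU[of t s] that by (simp add: add_ac)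
  obtain s t where st: "0 < s" "s < h" "0 < t" "t < h"
     "f (x + h *\<^sub>R v + h *\<^sub>R w) - f (x + h *\<^sub>R v) - f (x + h *\<^sub>R w) + f x
       = h * h * dd w (dd v f) (x + s *\<^sub>R v + t *\<^sub>R w)"
    using second_difference_mvt[OF sm U h inU] by blast
  obtain s' t' where st': "0 < s'" "s' < h" "0 < t'" "t' < h"
     "f (x + h *\<^sub>R w + h *\<^sub>R v) - f (x + h *\<^sub>R w) - f (x + h *\<^sub>R v) + f x
       = h * h * dd v (dd w f) (x + s' *\<^sub>R w + t' *\<^sub>R v)"
    using second_difference_mvt[OF sm U h inU'] by blast
  have "f (x + h *\<^sub>R v + h *\<^sub>R w) = f (x + h *\<^sub>R w + h *\<^sub>R v)"
    by (simp add: add_ac)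
  then have "h * h * dd w (dd v f) (x + s *\<^sub>R v + t *\<^sub>R w) = h * h * dd v (dd w f) (x + s' *\<^sub>R w + t' *\<^sub>R v)"
    using st(5) st'(5) by linarith
  then have "dd w (dd v f) (x + s *\<^sub>R v + t *\<^sub>R w) = dd v (dd w f) (x + t' *\<^sub>R v + s' *\<^sub>R w)"
    using h by (simp add: add_ac)
  moreover have "\<bar>dd w (dd v f) (x + s *\<^sub>R v + t *\<^sub>R w) - dd w (dd v f) x\<bar> < e"
    using near[of s t] st by (intro d2(2)) (simp add: m_def)
  moreover have "\<bar>dd v (dd w f) (x + t' *\<^sub>R v + s' *\<^sub>R w) - dd v (dd w f) x\<bar> < e"
    using near[of t' s'] st' by (intro d1(2)) (simp add: m_def)
  ultimately have "\<bar>dd v (dd w f) x - dd w (dd v f) x\<bar> < e + e" by linarith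
  then show False unfolding e_def by simp
qed

section \<open>Orders of growth at a mirror\<close>

lemma foldr_dd_cong:
  assumes "open U" "\<And>y. y \<in> U \<Longrightarrow> f y = g y"
  shows "x \<in> U \<Longrightarrow> foldr dd vs f x = foldr dd vs g x"
proof (induction vs arbitrary: x)
  case (Cons v vs)
  show ?case using dd_cong[OF assms(1) Cons.prems Cons.IH] by simp
qed (simp add: assms)

lemma smooth_on_foldr_dd: "open U \<Longrightarrow> smooth_on U f \<Longrightarrow> smooth_on U (foldr dd vs f)"
  by (induction vs) (auto intro: smooth_on_dd)

lemma dd_foldr_dd_commute:
  assumes "open U" "smooth_on U f"
  shows "x \<in> U \<Longrightarrow> dd w (foldr dd vs f) x = foldr dd vs (dd w f) x"
proof (induction vs arbitrary: x)
  case (Cons v vs)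
  have "dd w (dd v (foldr dd vs f)) x = dd v (dd w (foldr dd vs f)) x"
    by (rule dd_commute[OF assms(1) smooth_on_foldr_dd[OF assms] Cons.prems])
  also have "\<dots> = dd v (foldr dd vs (dd w f)) x"
    by (rule dd_cong[OF assms(1) Cons.prems Cons.IH])
  finally show ?case by simp
qed simp

text \<open>\<open>ah\<close> is the unit normal of a mirror and \<open>x0\<close> a point on it, so
  \<open>ah \<bullet> x\<close> is the signed distance t. All estimates are made on one side of the
  mirror, because real powers of t need a positive base.\<close>

locale mirror_point =
  fixes ah x0 :: "real^'n::finite" and \<rho> :: real
  assumes unit: "ah \<bullet> ah = 1" and x0: "ah \<bullet> x0 = 0" and rho: "0 < \<rho>"
begin

definition Om where "Om = {x \<in> ball x0 \<rho>. 0 < ah \<bullet> x}"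
definition F where "F = at x0 within {x. 0 < ah \<bullet> x}"
definition T where "T s x = (ah \<bullet> x) powr s"
definition cn :: "real^'n \<Rightarrow> real" where "cn v = (if ah \<bullet> v = 0 then 0 else 1)"
definition cnt where "cnt vs = sum_list (map cn vs)"

text \<open>Only derivatives transversal to the mirror are allowed to increase the order of growth.\<close>

definition S :: "real \<Rightarrow> (real^'n \<Rightarrow> real) \<Rightarrow> bool" where
  "S s f \<longleftrightarrow> smooth_on Om f \<and> (\<forall>vs. foldr dd vs f \<in> O[F](T (- (s + cnt vs))))"

lemma cn_bounds: "0 \<le> cn v" "cn v \<le> 1"
  by (simp_all add: cn_def)

lemma cnt_nonneg: "0 \<le> cnt vs"
  unfolding cnt_def by (induction vs) (auto simp: cn_def)

lemma open_Om: "open Om"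
proof -
  have "Om = ball x0 \<rho> \<inter> {x. 0 < ah \<bullet> x}" by (auto simp: Om_def)
  then show ?thesis by (simp add: open_Int open_halfspace_gt)
qed

lemma eventually_Om: "eventually (\<lambda>x. x \<in> Om) F"
  unfolding F_def eventually_at Om_def using rho by (auto simp: dist_commute intro!: exI[of _ \<rho>])

lemma eventually_F_small: "0 < d \<Longrightarrow> eventually (\<lambda>x. 0 < ah \<bullet> x \<and> ah \<bullet> x < d) F"
  unfolding F_def eventually_at
proof (intro exI[of _ d] conjI ballI impI)
  fix x assume x: "x \<in> {x. 0 < ah \<bullet> x}" "x \<noteq> x0 \<and> dist x x0 < d"
  have "ah \<bullet> x = ah \<bullet> (x - x0)" by (simp add: inner_diff_right x0)
  also have "\<dots> \<le> norm ah * norm (x - x0)" by (rule norm_cauchy_schwarz)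
  also have "norm ah = 1" using unit by (simp add: norm_eq_sqrt_inner)
  finally show "ah \<bullet> x < d" using x by (simp add: dist_norm)
qed auto

lemma tendsto_F: "((\<lambda>x. ah \<bullet> x) \<longlongrightarrow> 0) F"
proof -
  have "((\<lambda>x. ah \<bullet> x) \<longlongrightarrow> ah \<bullet> x0) F"
    unfolding F_def by (intro tendsto_intros)
  then show ?thesis by (simp add: x0)
qed

lemma F_nontrivial: "F \<noteq> bot"
proof -
  have "x0 islimpt {x. 0 < ah \<bullet> x}"
    unfolding islimpt_approachable
  proof (intro allI impI)
    fix e :: real assume e: "0 < e"
    have "norm ah = 1" using unit by (simp add: norm_eq_sqrt_inner)
    moreover have "ah \<noteq> 0" using unit by auto
    ultimately show "\<exists>x'\<in>{x. 0 < ah \<bullet> x}. x' \<noteq> x0 \<and> dist x' x0 < e"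
      using e by (intro bexI[of _ "x0 + (e/2) *\<^sub>R ah"]) (auto simp: inner_add_right x0 unit dist_norm)
  qed
  then show ?thesis unfolding F_def using trivial_limit_within by blast
qed

lemma T_add: "T (s + s') x = T s x * T s' x"
  by (simp add: T_def powr_add)

lemma T_mono_bigo: "s \<le> s' \<Longrightarrow> T (- s) \<in> O[F](T (- s'))"
  by (rule bigoI[where c = 1], rule eventually_mono[OF eventually_F_small[of 1]])
    (auto simp: T_def intro: powr_mono')

lemma bigo_cong_Om:
  assumes "f \<in> O[F](h)" "\<And>x. x \<in> Om \<Longrightarrow> g x = f x"
  shows "g \<in> O[F](h)"
proof -
  have "eventually (\<lambda>x. g x = f x) F"
    by (rule eventually_mono[OF eventually_Om]) (rule assms(2))
  from landau_o.big.in_cong[OF this] show ?thesis using assms(1) by blast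
qed

lemma S_smooth: "S s f \<Longrightarrow> smooth_on Om f"
  by (simp add: S_def)

lemma S_bigo: "S s f \<Longrightarrow> f \<in> O[F](T (- s))"
  unfolding S_def cnt_def by (force dest: spec[of _ "[]"])

lemma S_cong:
  assumes "S s f" "\<And>x. x \<in> Om \<Longrightarrow> f x = g x"
  shows "S s g"
  unfolding S_def
proof (intro conjI allI)
  show "smooth_on Om g" using smooth_on_cong[OF open_Om S_smooth[OF assms(1)] assms(2)] by blast
  show "foldr dd vs g \<in> O[F](T (- (s + cnt vs)))" for vs
    by (rule bigo_cong_Om[where f = "foldr dd vs f"])
      (use assms in \<open>auto simp: S_def intro: foldr_dd_cong[OF open_Om, symmetric]\<close>)
qed

text \<open>Counterpart of \<open>smooth_on_coinduct\<close> with the order as a parameter of the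
  class: it may rise by 1 under a transversal derivative and must not rise under a tangential
  one.\<close>

lemma S_coinduct:
  assumes P: "P s f"
    and here: "\<And>s f. P s f \<Longrightarrow> smooth_on Om f" "\<And>s f. P s f \<Longrightarrow> f \<in> O[F](T (- s))"
    and step: "\<And>s f v. P s f \<Longrightarrow> \<exists>g. P (s + cn v) g \<and> (\<forall>x\<in>Om. dd v f x = g x)"
  shows "S s f"
proof -
  have "P s f \<Longrightarrow> foldr dd vs f \<in> O[F](T (- (s + cnt vs)))" for vs s f
  proof (induction vs arbitrary: s f rule: rev_induct)
    case Nil
    then show ?case using here(2) by (simp add: cnt_def)
  next
    case (snoc v vs)
    obtain g where g: "P (s + cn v) g" "\<forall>x\<in>Om. dd v f x = g x" using step[OF snoc.prems] by blast
    have "foldr dd (vs @ [v]) f x = foldr dd vs g x" if "x \<in> Om" for x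
      using foldr_dd_cong[OF open_Om _ that, of "dd v f" g] g(2) by simp
    from bigo_cong_Om[OF snoc.IH[OF g(1)] this]
    have "foldr dd (vs @ [v]) f \<in> O[F](T (- (s + cn v + cnt vs)))" by blast
    then show ?case by (simp add: cnt_def add_ac)
  qed
  then show ?thesis unfolding S_def using P here(1) by blast
qed

lemma S_mono: "S s f \<Longrightarrow> s \<le> s' \<Longrightarrow> S s' f"
  unfolding S_def
proof (intro conjI allI; elim conjE)
  fix vs assume "\<forall>vs. foldr dd vs f \<in> O[F](T (- (s + cnt vs)))" and s: "s \<le> s'"
  then show "foldr dd vs f \<in> O[F](T (- (s' + cnt vs)))"
    using landau_o.big_trans[OF _ T_mono_bigo[of "s + cnt vs" "s' + cnt vs"]] by simp
qed

lemma S_dd: "S s f \<Longrightarrow> S (s + cn v) (dd v f)"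
  unfolding S_def
proof (intro conjI allI; elim conjE)
  fix vs assume "\<forall>vs. foldr dd vs f \<in> O[F](T (- (s + cnt vs)))"
  from this[rule_format, of "vs @ [v]"]
  show "foldr dd vs (dd v f) \<in> O[F](T (- (s + cn v + cnt vs)))"
    by (simp add: cnt_def add_ac)
qed (simp add: smooth_on_dd open_Om)

lemma S_dd1: "S s f \<Longrightarrow> S (s + 1) (dd v f)"
  using S_mono[OF S_dd] cn_bounds(2) by simp

lemma S_dd0: "S s f \<Longrightarrow> ah \<bullet> v = 0 \<Longrightarrow> S s (dd v f)"
  using S_dd[of s f v] by (simp add: cn_def)

inductive S_alg where
  base: "S s f \<Longrightarrow> S_alg s f"
| add: "S_alg s f \<Longrightarrow> S_alg s g \<Longrightarrow> S_alg s (\<lambda>x. f x + g x)"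
| mult: "S_alg s f \<Longrightarrow> S_alg s' g \<Longrightarrow> S_alg (s + s') (\<lambda>x. f x * g x)"

lemma S_alg_smooth: "S_alg s f \<Longrightarrow> smooth_on Om f"
  by (induction rule: S_alg.induct) (auto intro: S_smooth smooth_on_add smooth_on_mult open_Om)

lemma S_alg_bigo: "S_alg s f \<Longrightarrow> f \<in> O[F](T (- s))"
proof (induction rule: S_alg.induct)
  case (mult s f s' g)
  have "(\<lambda>x. f x * g x) \<in> O[F](\<lambda>x. T (- s) x * T (- s') x)"
    using mult.IH by (rule landau_o.big_mult)
  moreover have "(\<lambda>x. T (- s) x * T (- s') x) = T (- (s + s'))"
    by (simp add: fun_eq_iff T_add[symmetric] add_ac)
  ultimately show ?case by simp
qed (auto intro: S_bigo sum_in_bigo)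

lemma S_alg_step: "S_alg s f \<Longrightarrow> \<exists>g. S_alg (s + cn v) g \<and> (\<forall>x\<in>Om. dd v f x = g x)"
proof (induction rule: S_alg.induct)
  case (base s f)
  then show ?case using S_dd S_alg.base by blast
next
  case (add s f g)
  then obtain f' g' where *: "S_alg (s + cn v) f'" "\<forall>x\<in>Om. dd v f x = f' x"
    "S_alg (s + cn v) g'" "\<forall>x\<in>Om. dd v g x = g' x" by blast
  have "\<forall>x\<in>Om. dd v (\<lambda>x. f x + g x) x = f' x + g' x"
    using * by (simp add: dd_add add.hyps[THEN S_alg_smooth, THEN smooth_on_differentiable])
  then show ?case using S_alg.add[OF *(1,3)] by blast
next
  case (mult s f s' g)
  then obtain f' g' where *: "S_alg (s + cn v) f'" "\<forall>x\<in>Om. dd v f x = f' x"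
    "S_alg (s' + cn v) g'" "\<forall>x\<in>Om. dd v g x = g' x" by blast
  have "S_alg (s + s' + cn v) (\<lambda>x. f x * g' x)" "S_alg (s + s' + cn v) (\<lambda>x. f' x * g x)"
    using S_alg.mult[OF mult.hyps(1) *(3)] S_alg.mult[OF *(1) mult.hyps(2)] by (simp_all add: add_ac)
  from S_alg.add[OF this] show ?case
    using * by (intro exI[of _ "\<lambda>x. f x * g' x + f' x * g x"])
      (simp add: dd_mult mult.hyps[THEN S_alg_smooth, THEN smooth_on_differentiable])
qed

lemma S_alg_S: "S_alg s f \<Longrightarrow> S s f"
  by (rule S_coinduct[where P = S_alg]) (assumption | rule S_alg_smooth S_alg_bigo S_alg_step)+

lemma S_add: "S s f \<Longrightarrow> S s g \<Longrightarrow> S s (\<lambda>x. f x + g x)"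
  by (rule S_alg_S[OF S_alg.add[OF S_alg.base S_alg.base]])

lemma S_mult: "S s f \<Longrightarrow> S s' g \<Longrightarrow> S (s + s') (\<lambda>x. f x * g x)"
  by (rule S_alg_S[OF S_alg.mult[OF S_alg.base S_alg.base]])

lemma S_const: "S 0 (\<lambda>x. c)"
proof (rule S_coinduct[where P = "\<lambda>s f. 0 \<le> s \<and> (\<exists>c. f = (\<lambda>x. c))"])
  fix s :: real and f :: "real^'n \<Rightarrow> real" assume "0 \<le> s \<and> (\<exists>c. f = (\<lambda>x. c))"
  then obtain c where s: "0 \<le> s" "f = (\<lambda>x. c)" by blast
  show "smooth_on Om f" by (simp add: s open_Om smooth_on_const)
  have "(\<lambda>x. c) \<in> O[F](T (- 0))"
    by (rule bigoI[where c = "\<bar>c\<bar>"], rule eventually_mono[OF eventually_F_small[of 1]])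
      (auto simp: T_def)
  then show "f \<in> O[F](T (- s))"
    using landau_o.big_trans[OF _ T_mono_bigo[OF s(1)]] s(2) by blast
next
  fix s :: real and f :: "real^'n \<Rightarrow> real" and v assume "0 \<le> s \<and> (\<exists>c. f = (\<lambda>x. c))"
  then show "\<exists>g. (0 \<le> s + cn v \<and> (\<exists>c. g = (\<lambda>x. c))) \<and> (\<forall>x\<in>Om. dd v f x = g x)"
    using cn_bounds(1)[of v] by (intro exI[of _ "\<lambda>x. 0"]) auto
qed auto

lemma S_cmult: "S s f \<Longrightarrow> S s (\<lambda>x. c * f x)"
  using S_mult[OF S_const, of s f c] by simp

lemma S_diff: "S s f \<Longrightarrow> S s g \<Longrightarrow> S s (\<lambda>x. f x - g x)"
  using S_add[of s f "\<lambda>x. - 1 * g x"] S_cmult[of s g "- 1"] by simp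

lemma S_zero: "S s (\<lambda>x. 0)"
proof (rule S_coinduct[where P = "\<lambda>s f. f = (\<lambda>x. 0)"])
  fix s :: real and f :: "real^'n \<Rightarrow> real" and v assume "f = (\<lambda>x. 0)"
  then show "\<exists>g. g = (\<lambda>x. 0) \<and> (\<forall>x\<in>Om. dd v f x = g x)" by simp
qed (auto intro: smooth_on_const open_Om)

lemma S_sum: "(\<And>i. i \<in> I \<Longrightarrow> S s (f i)) \<Longrightarrow> S s (\<lambda>x. \<Sum>i\<in>I. f i x)"
  by (induction I rule: infinite_finite_induct) (auto intro: S_zero S_add)

lemma dd_T: "x \<in> Om \<Longrightarrow> dd v (T s) x = s * (ah \<bullet> v) * T (s - 1) x"
  unfolding T_def
  by (rule dd_eqI) (auto simp: Om_def powr_diff intro!: derivative_eq_intros ext)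

lemma smooth_T: "smooth_on Om (T s)"
proof (rule smooth_on_coinduct[where P = "\<lambda>f. \<exists>c s. f = (\<lambda>x. c * T s x)", OF open_Om])
  show "\<exists>c s'. T s = (\<lambda>x. c * T s' x)" by (intro exI[of _ 1] exI[of _ s]) simp
  have diff: "T s differentiable (at x)" if "x \<in> Om" for s x
    unfolding T_def using that
    by (intro differentiableI) (auto simp: Om_def intro!: derivative_eq_intros)
  show "f differentiable (at x)" if "\<exists>c s. f = (\<lambda>x. c * T s x)" "x \<in> Om" for f x
    using diff that by auto
  fix f i assume "\<exists>c s. f = (\<lambda>x. c * T s x)"
  then obtain c s where f: "f = (\<lambda>x. c * T s x)" by blast
  show "\<exists>g. (\<exists>c s. g = (\<lambda>x. c * T s x)) \<and> (\<forall>x\<in>Om. partial i f x = g x)"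
    by (intro exI[of _ "\<lambda>x. (c * (s * (ah \<bullet> axis i 1))) * T (s - 1) x"] conjI exI[of _ "s - 1"]
        exI[of _ "c * (s * (ah \<bullet> axis i 1))"] refl)
      (simp add: f partial_eq_dd dd_cmult[OF diff] dd_T)
qed

lemma S_T: "S (- s) (T s)"
\<comment> \<open>A tangential derivative gives the zero function, whose order is not tied to the
  exponent; hence \<sigma> is bound only when the factor is nonzero.\<close>
proof (rule S_coinduct[where P = "\<lambda>\<sigma> f. \<exists>c s. f = (\<lambda>x. c * T s x) \<and> (c \<noteq> 0 \<longrightarrow> \<sigma> = - s)"])
  show "\<exists>c s'. T s = (\<lambda>x. c * T s' x) \<and> (c \<noteq> 0 \<longrightarrow> - s = - s')"
    by (intro exI[of _ 1] exI[of _ s]) simp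
next
  fix \<sigma> f assume "\<exists>c s. f = (\<lambda>x. c * T s x) \<and> (c \<noteq> 0 \<longrightarrow> \<sigma> = - s)"
  then obtain c s where f: "f = (\<lambda>x. c * T s x)" "c \<noteq> 0 \<longrightarrow> \<sigma> = - s" by blast
  show "smooth_on Om f" by (simp add: f smooth_on_cmult smooth_T open_Om)
  show "f \<in> O[F](T (- \<sigma>))" using f by (cases "c = 0") auto
next
  fix \<sigma> f v assume "\<exists>c s. f = (\<lambda>x. c * T s x) \<and> (c \<noteq> 0 \<longrightarrow> \<sigma> = - s)"
  then obtain c s where f: "f = (\<lambda>x. c * T s x)" "c \<noteq> 0 \<longrightarrow> \<sigma> = - s" by blast
  show "\<exists>g. (\<exists>c s. g = (\<lambda>x. c * T s x) \<and> (c \<noteq> 0 \<longrightarrow> \<sigma> + cn v = - s)) \<and> (\<forall>x\<in>Om. dd v f x = g x)"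
    by (intro exI[of _ "\<lambda>x. (c * (s * (ah \<bullet> v))) * T (s - 1) x"] conjI exI[of _ "s - 1"]
        exI[of _ "c * (s * (ah \<bullet> v))"] refl)
      (use f in \<open>auto simp: cn_def dd_cmult dd_T smooth_on_differentiable[OF smooth_T]\<close>)
qed

lemma S_regular: "smooth_on (ball x0 \<rho>) f \<Longrightarrow> S 0 f"
proof (rule S_coinduct[where P = "\<lambda>s f. 0 \<le> s \<and> smooth_on (ball x0 \<rho>) f"])
  fix s :: real and f :: "real^'n \<Rightarrow> real" assume *: "0 \<le> s \<and> smooth_on (ball x0 \<rho>) f"
  then show "smooth_on Om f" by (auto simp: Om_def intro: smooth_on_subset)
  have "isCont f x0" using * smooth_on_continuous rho by (metis centre_in_ball)
  then have "(f \<longlongrightarrow> f x0) F"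
    unfolding F_def isCont_def by (rule tendsto_within_subset) simp
  then have "eventually (\<lambda>x. \<bar>f x - f x0\<bar> < 1) F"
    by (auto simp: tendsto_iff dist_real_def)
  then have "eventually (\<lambda>x. norm (f x) \<le> (\<bar>f x0\<bar> + 1) * norm (T (- 0) x)) F"
    by (rule eventually_mono[OF eventually_conj[OF _ eventually_F_small[of 1]]]) (auto simp: T_def)
  then have "f \<in> O[F](T (- 0))" by (rule bigoI)
  then show "f \<in> O[F](T (- s))"
    using landau_o.big_trans[OF _ T_mono_bigo] * by blast
next
  fix s :: real and f :: "real^'n \<Rightarrow> real" and v assume *: "0 \<le> s \<and> smooth_on (ball x0 \<rho>) f"
  then show "\<exists>g. (0 \<le> s + cn v \<and> smooth_on (ball x0 \<rho>) g) \<and> (\<forall>x\<in>Om. dd v f x = g x)"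
    using cn_bounds(1)[of v] by (intro exI[of _ "dd v f"]) (auto intro: smooth_on_dd)
qed auto

subsection \<open>Integration\<close>

text \<open>Along \<xi> the distance grows at unit speed. A path from a point near \<open>x0\<close>
  up to the level \<open>d\<close> ends in the compact set \<open>K\<close>, where \<open>f\<close>
  is bounded by \<open>M\<close>; on the way the derivative contributes at most (C / q) t^-q. As q >
  0, a multiple of t^-q also absorbs \<open>M\<close>.\<close>

lemma integrate_bigo:
  assumes sm: "smooth_on Om f" and G: "dd \<xi> f \<in> O[F](T (- (q + 1)))" and q: "0 < q" and xi: "ah \<bullet> \<xi> = 1"
  shows "f \<in> O[F](T (- q))"
proof -
  obtain C where C: "C > 0" "eventually (\<lambda>x. norm (dd \<xi> f x) \<le> C * norm (T (- (q + 1)) x)) F"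
    using landau_o.bigE[OF G] by metis
  from eventually_conj[OF this(2) eventually_Om] obtain d1 where d1: "d1 > 0"
    "\<And>x. 0 < ah \<bullet> x \<Longrightarrow> x \<noteq> x0 \<Longrightarrow> dist x x0 < d1 \<Longrightarrow>
       norm (dd \<xi> f x) \<le> C * norm (T (- (q + 1)) x) \<and> x \<in> Om"
    unfolding F_def eventually_at by auto
  have bnd: "\<bar>dd \<xi> f x\<bar> \<le> C * (ah \<bullet> x) powr (- q - 1)" "x \<in> Om"
    if "0 < ah \<bullet> x" "dist x x0 < d1" for x
  proof -
    have "x \<noteq> x0" using that x0 by auto
    from d1(2)[OF that(1) this that(2)] show "\<bar>dd \<xi> f x\<bar> \<le> C * (ah \<bullet> x) powr (- q - 1)" "x \<in> Om"
      by (auto simp: T_def)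
  qed
  \<comment> \<open>The path takes time at most \<open>d\<close> and so has length at most
    \<open>d * norm \<xi>\<close>; with a starting point within \<open>d\<close> of
    \<open>x0\<close> it stays within \<open>d1 / 2\<close>. The bound by 1 makes t^-q at least
    1.\<close>
  define d where "d = min 1 (d1 / (2 * (1 + norm \<xi>)))"
  have n1: "0 < 1 + norm \<xi>" using norm_ge_zero[of \<xi>] by linarith
  have d: "0 < d" "d \<le> 1" using d1 n1 by (auto simp: d_def)
  have dd1: "d * (1 + norm \<xi>) \<le> d1 / 2"
  proof -
    have "d \<le> d1 / (2 * (1 + norm \<xi>))" by (simp add: d_def)
    then show ?thesis using n1 by (simp add: field_simps)
  qed
  define K where "K = cball x0 (d1 / 2) \<inter> {x. ah \<bullet> x = d}"
  have "compact K" unfolding K_def by (intro compact_Int_closed compact_cball closed_hyperplane)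
  moreover have "continuous_on K f"
  proof (rule continuous_at_imp_continuous_on, rule ballI)
    fix x assume "x \<in> K"
    then have "x \<in> Om" using bnd(2)[of x] d d1 by (simp add: K_def dist_commute)
    then show "isCont f x" using smooth_on_continuous sm by blast
  qed
  ultimately have "bounded (f ` K)" by (intro compact_imp_bounded compact_continuous_image)
  then obtain M where M: "M > 0" "\<And>x. x \<in> K \<Longrightarrow> \<bar>f x\<bar> \<le> M"
    unfolding bounded_pos by auto
  have main: "\<bar>f x\<bar> \<le> (M + C / q) * (ah \<bullet> x) powr (- q)"
    if x: "0 < ah \<bullet> x" "ah \<bullet> x < d" "dist x x0 < d" for x
  proof -
    let ?t = "ah \<bullet> x"
    have tip: "ah \<bullet> (x + s *\<^sub>R \<xi>) = ?t + s" for s by (simp add: inner_add_right xi)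
    have near: "dist (x + s *\<^sub>R \<xi>) x0 \<le> d1 / 2" if s: "0 \<le> s" "s \<le> d - ?t" for s
    proof -
      have "dist (x + s *\<^sub>R \<xi>) x0 \<le> dist (x + s *\<^sub>R \<xi>) x + dist x x0" by (rule dist_triangle)
      also have "dist (x + s *\<^sub>R \<xi>) x = s * norm \<xi>" using s by (simp add: dist_norm)
      also have "s * norm \<xi> \<le> d * norm \<xi>" using s x by (intro mult_right_mono) auto
      finally show ?thesis using x dd1 by (simp add: algebra_simps)
    qed
    have b: "\<bar>dd \<xi> f (x + s *\<^sub>R \<xi>)\<bar> \<le> C * (?t + s) powr (- q - 1)" "x + s *\<^sub>R \<xi> \<in> Om"
      if s: "0 \<le> s" "s \<le> d - ?t" for s
      using bnd[of "x + s *\<^sub>R \<xi>"] near[OF s] s x d1 by (auto simp: tip)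
    have der: "((\<lambda>s. f (x + s *\<^sub>R \<xi>)) has_real_derivative dd \<xi> f (x + s *\<^sub>R \<xi>)) (at s)"
      if s: "0 \<le> s" "s \<le> d - ?t" for s
      using dd_line smooth_on_differentiable[OF sm b(2)[OF s]] by blast
    have der': "((\<lambda>s. C / q * (?t + s) powr (- q)) has_real_derivative - (C * (?t + s) powr (- q - 1))) (at s)"
      if s: "0 \<le> s" for s
      using s x q by (auto intro!: derivative_eq_intros)
    \<comment> \<open>Comparison with a function whose derivative is minus the bound replaces an
      integral: subtracting it makes \<open>f\<close> nondecreasing along the path, adding it makes
      \<open>f\<close> nonincreasing.\<close>
    have up: "f (x + 0 *\<^sub>R \<xi>) - C / q * (?t + 0) powr (- q)
        \<le> f (x + (d - ?t) *\<^sub>R \<xi>) - C / q * (?t + (d - ?t)) powr (- q)"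
    proof (rule DERIV_nonneg_imp_nondecreasing[of 0 "d - ?t" "\<lambda>s. f (x + s *\<^sub>R \<xi>) - C / q * (?t + s) powr (- q)"])
      show "\<exists>y. ((\<lambda>s. f (x + s *\<^sub>R \<xi>) - C / q * (?t + s) powr (- q)) has_real_derivative y) (at s) \<and> 0 \<le> y"
        if "0 \<le> s" "s \<le> d - ?t" for s
        using DERIV_diff[OF der[OF that] der'] that b(1)[OF that] by (intro exI conjI) (assumption | simp)+
    qed (use x in simp)
    have lo: "f (x + (d - ?t) *\<^sub>R \<xi>) + C / q * (?t + (d - ?t)) powr (- q)
        \<le> f (x + 0 *\<^sub>R \<xi>) + C / q * (?t + 0) powr (- q)"
    proof (rule DERIV_nonpos_imp_nonincreasing[of 0 "d - ?t" "\<lambda>s. f (x + s *\<^sub>R \<xi>) + C / q * (?t + s) powr (- q)"])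
      show "\<exists>y. ((\<lambda>s. f (x + s *\<^sub>R \<xi>) + C / q * (?t + s) powr (- q)) has_real_derivative y) (at s) \<and> y \<le> 0"
        if "0 \<le> s" "s \<le> d - ?t" for s
        using DERIV_add[OF der[OF that] der'] that b(1)[OF that] by (intro exI conjI) (assumption | simp)+
    qed (use x in simp)
    have "x + (d - ?t) *\<^sub>R \<xi> \<in> K"
      using near[of "d - ?t"] x by (simp add: K_def tip dist_commute)
    then have fM: "\<bar>f (x + (d - ?t) *\<^sub>R \<xi>)\<bar> \<le> M" by (rule M(2))
    have pos: "0 \<le> C / q * d powr (- q)" using C q by simp
    have "\<bar>f x\<bar> \<le> M + C / q * ?t powr (- q)"
      using up lo fM pos by simp
    also have "M \<le> M * ?t powr (- q)"
      using M(1) x d q powr_mono'[of "- q" 0 ?t] by simp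
    finally show ?thesis by (simp add: algebra_simps)
  qed
  have "eventually (\<lambda>x. dist x x0 < d) F"
    unfolding F_def eventually_at using d by blast
  then have "eventually (\<lambda>x. norm (f x) \<le> (M + C / q) * norm (T (- q) x)) F"
    by (rule eventually_mono[OF eventually_conj[OF _ eventually_F_small[OF d(1)]]])
      (use main in \<open>auto simp: T_def\<close>)
  then show ?thesis by (rule bigoI)
qed

text \<open>\<open>integrate_bigo\<close> is applied to every iterated derivative of
  \<open>f\<close>, past which the derivative along \<xi> commutes. Further derivatives never lower
  the exponent, so \<open>0 < s\<close> secures positivity for all of them.\<close>

lemma S_integrate:
  assumes sm: "smooth_on Om f" and G: "S (s + 1) (dd \<xi> f)" and s: "0 < s" and xi: "ah \<bullet> \<xi> \<noteq> 0"
  shows "S s f"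
  unfolding S_def
proof (intro conjI allI sm)
  fix vs
  define g where "g = foldr dd vs f"
  define \<zeta> where "\<zeta> = (1 / (ah \<bullet> \<xi>)) *\<^sub>R \<xi>"
  have g: "smooth_on Om g" unfolding g_def by (rule smooth_on_foldr_dd[OF open_Om sm])
  have "dd \<xi> g \<in> O[F](T (- (s + cnt vs + 1)))"
    by (rule bigo_cong_Om[where f = "foldr dd vs (dd \<xi> f)"])
      (use G dd_foldr_dd_commute[OF open_Om sm, of _ \<xi> vs] in \<open>auto simp: S_def g_def add_ac\<close>)
  then have "(\<lambda>x. 1 / (ah \<bullet> \<xi>) * dd \<xi> g x) \<in> O[F](T (- (s + cnt vs + 1)))"
    by (simp only: landau_o.big.cmult_in_iff xi divide_eq_0_iff not_False_eq_True zero_neq_one[symmetric] simp_thms)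
  moreover have "dd \<zeta> g x = 1 / (ah \<bullet> \<xi>) * dd \<xi> g x" if "x \<in> Om" for x
    using linear_cmul[OF linear_dd[OF smooth_on_differentiable[OF g that]]] by (simp add: \<zeta>_def)
  ultimately have "dd \<zeta> g \<in> O[F](T (- (s + cnt vs + 1)))"
    by (rule bigo_cong_Om)
  then show "foldr dd vs f \<in> O[F](T (- (s + cnt vs)))"
    using integrate_bigo[OF g, of \<zeta> "s + cnt vs"] s xi cnt_nonneg[of vs]
    unfolding g_def[symmetric] by (simp add: \<zeta>_def add_pos_nonneg)
qed

text \<open>\<open>Lead s f\<close> says that, to leading order, \<open>f\<close> is homogeneous of degree \<open>- s\<close> in the distance
  to the mirror; the gap \<open>1/2\<close> leaves room for logarithms.\<close>

definition Lead :: "real \<Rightarrow> (real^'n \<Rightarrow> real) \<Rightarrow> bool" where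
  "Lead s f \<longleftrightarrow> S s f \<and> S (s - 1/2) (\<lambda>x. (ah \<bullet> x) * dd ah f x + s * f x)"

section \<open>Calculus of functions homogeneous to leading order\<close>

lemma Lead_S: "Lead s f \<Longrightarrow> S s f"
  by (simp add: Lead_def)

lemma S_differentiable: "S s f \<Longrightarrow> x \<in> Om \<Longrightarrow> f differentiable (at x)"
  using S_smooth smooth_on_differentiable by blast

lemmas Lead_differentiable = S_differentiable[OF Lead_S]

lemma Lead_cong:
  assumes "Lead s f" "\<And>x. x \<in> Om \<Longrightarrow> f x = g x"
  shows "Lead s g"
proof -
  have "S (s - 1/2) (\<lambda>x. (ah \<bullet> x) * dd ah f x + s * f x)"
    using assms(1) by (simp add: Lead_def)
  then have "S (s - 1/2) (\<lambda>x. (ah \<bullet> x) * dd ah g x + s * g x)"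
    by (rule S_cong) (simp only: dd_cong[OF open_Om _ assms(2)] assms(2))
  moreover have "S s g" by (rule S_cong[OF Lead_S[OF assms(1)] assms(2)])
  ultimately show ?thesis by (simp add: Lead_def)
qed

lemma Lead_add:
  assumes "Lead s f" "Lead s g"
  shows "Lead s (\<lambda>x. f x + g x)"
proof -
  have "S (s - 1/2) (\<lambda>x. ((ah \<bullet> x) * dd ah f x + s * f x) + ((ah \<bullet> x) * dd ah g x + s * g x))"
    using assms by (simp add: Lead_def S_add)
  then have "S (s - 1/2) (\<lambda>x. (ah \<bullet> x) * dd ah (\<lambda>x. f x + g x) x + s * (f x + g x))"
    by (rule S_cong) (simp add: dd_add assms[THEN Lead_differentiable] algebra_simps)
  then show ?thesis using assms by (simp add: Lead_def S_add)
qed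

lemma S_ah: "S (- 1) (\<lambda>x. ah \<bullet> x)"
  by (rule S_cong[OF S_T]) (simp add: T_def Om_def)

lemma Lead_mult:
  assumes "Lead s f" "Lead s' g"
  shows "Lead (s + s') (\<lambda>x. f x * g x)"
proof -
  have "S ((s - 1/2) + s') (\<lambda>x. ((ah \<bullet> x) * dd ah f x + s * f x) * g x)"
    "S (s + (s' - 1/2)) (\<lambda>x. f x * ((ah \<bullet> x) * dd ah g x + s' * g x))"
    using assms by (simp_all only: Lead_def S_mult)
  then have "S (s + s' - 1/2) (\<lambda>x. ((ah \<bullet> x) * dd ah f x + s * f x) * g x +
     f x * ((ah \<bullet> x) * dd ah g x + s' * g x))"
    by (intro S_add) (simp_all add: algebra_simps)
  then have "S (s + s' - 1/2) (\<lambda>x. (ah \<bullet> x) * dd ah (\<lambda>x. f x * g x) x + (s + s') * (f x * g x))"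
    by (rule S_cong) (simp add: dd_mult assms[THEN Lead_differentiable] algebra_simps)
  then show ?thesis using assms by (simp add: Lead_def S_mult)
qed

lemma Lead_const: "Lead 0 (\<lambda>x. c)"
  by (simp add: Lead_def S_const S_zero)

lemma Lead_zero: "Lead s (\<lambda>x. 0)"
  by (simp add: Lead_def S_zero)

lemma Lead_cmult: "Lead s f \<Longrightarrow> Lead s (\<lambda>x. c * f x)"
  using Lead_mult[OF Lead_const, of s f c] by simp

lemma Lead_sum: "(\<And>i. i \<in> I \<Longrightarrow> Lead s (f i)) \<Longrightarrow> Lead s (\<lambda>x. \<Sum>i\<in>I. f i x)"
  by (induction I rule: infinite_finite_induct) (auto intro: Lead_zero Lead_add)

lemma Lead_diff: "Lead s f \<Longrightarrow> Lead s g \<Longrightarrow> Lead s (\<lambda>x. f x - g x)"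
  using Lead_add[of s f "\<lambda>x. - 1 * g x"] Lead_cmult[of s g "- 1"] by simp

lemma Lead_T: "Lead (- s) (T s)"
proof -
  have "S (- s - 1/2) (\<lambda>x. (ah \<bullet> x) * dd ah (T s) x + (- s) * T s x)"
    by (rule S_cong[OF S_zero]) (simp add: dd_T unit, simp add: T_def Om_def powr_diff)
  then show ?thesis by (simp add: Lead_def S_T)
qed

lemma S_imp_Lead: "S s f \<Longrightarrow> s + 1/2 \<le> s' \<Longrightarrow> Lead s' f"
proof -
  assume f: "S s f" and s: "s + 1/2 \<le> s'"
  have "S (- 1 + (s + 1)) (\<lambda>x. (ah \<bullet> x) * dd ah f x)"
    by (rule S_mult[OF S_ah S_dd1[OF f]])
  then have "S s (\<lambda>x. (ah \<bullet> x) * dd ah f x + s' * f x)"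
    using S_add S_cmult[OF f] by simp
  then show ?thesis
    using f s unfolding Lead_def by (auto elim: S_mono)
qed

lemma dd_sub_component:
  assumes "S s f" "x \<in> Om"
  shows "dd (v - (ah \<bullet> v) *\<^sub>R ah) f x = dd v f x - (ah \<bullet> v) * dd ah f x"
  using linear_diff[OF linear_dd[OF S_differentiable[OF assms]], of v "(ah \<bullet> v) *\<^sub>R ah"]
    linear_cmul[OF linear_dd[OF S_differentiable[OF assms]]] by simp

lemma inner_sub_component: "ah \<bullet> (v - (ah \<bullet> v) *\<^sub>R ah) = 0"
  by (simp add: inner_diff_right unit)

lemma dd_Euler:
  assumes "S s f" "x \<in> Om"
  shows "dd v (\<lambda>x. (ah \<bullet> x) * dd ah f x + c * f x) x
    = (ah \<bullet> v) * dd ah f x + (ah \<bullet> x) * dd ah (dd v f) x + c * dd v f x"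
proof -
  have d: "dd ah f differentiable (at x)" using S_differentiable[OF S_dd[OF assms(1)] assms(2)] .
  have "(\<lambda>x. ah \<bullet> x) differentiable (at x)"
    using S_differentiable[OF S_ah assms(2)] .
  then show ?thesis
    using d S_differentiable[OF assms] dd_commute[OF open_Om S_smooth[OF assms(1)] assms(2)]
    by (simp add: dd_add dd_mult dd_cmult)
qed

text \<open>Differentiating the Euler expression along \<open>v\<close> gives the one for
  \<open>dd v f\<close> with \<open>s + 1\<close>, except for the derivative of \<open>f\<close>
  along the tangential part of \<open>v\<close>. The latter has order only \<open>s\<close>, which
  fits into the gap.\<close>

lemma Lead_dd:
  assumes f: "Lead s f"
  shows "Lead (s + 1) (dd v f)"
proof -
  note S = Lead_S[OF f]
  let ?w = "v - (ah \<bullet> v) *\<^sub>R ah"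
  have "S (s - 1/2 + 1) (dd v (\<lambda>x. (ah \<bullet> x) * dd ah f x + s * f x))"
    using f by (intro S_dd1) (simp add: Lead_def)
  moreover have "S (s - 1/2 + 1) (dd ?w f)"
    by (rule S_mono[OF S_dd0[OF S inner_sub_component]]) simp
  ultimately have "S (s - 1/2 + 1) (\<lambda>x. dd v (\<lambda>x. (ah \<bullet> x) * dd ah f x + s * f x) x + dd ?w f x)"
    by (rule S_add)
  then have "S (s - 1/2 + 1) (\<lambda>x. (ah \<bullet> x) * dd ah (dd v f) x + (s + 1) * dd v f x)"
    by (rule S_cong) (simp only: dd_Euler[OF S] dd_sub_component[OF S], simp add: algebra_simps)
  then have "S (s + 1 - 1/2) (\<lambda>x. (ah \<bullet> x) * dd ah (dd v f) x + (s + 1) * dd v f x)"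
    by (rule S_mono) simp
  then show ?thesis using S_dd1[OF S] by (simp add: Lead_def)
qed

text \<open>The computation of \<open>Lead_dd\<close> read backwards: the derivative along \<xi> of
  the Euler expression has order \<open>s + 1/2\<close> and is integrated by
  \<open>S_integrate\<close>. That needs \<open>s - 1/2 > 0\<close>, which \<open>1 \<le> s\<close>
  provides.\<close>

lemma Lead_integrate:
  assumes sm: "smooth_on Om f" and G: "Lead (s + 1) (dd \<xi> f)" and s: "1 \<le> s" and xi: "ah \<bullet> \<xi> \<noteq> 0"
  shows "Lead s f"
proof -
  have S: "S s f" using S_integrate[OF sm Lead_S[OF G] _ xi] s by simp
  let ?w = "\<xi> - (ah \<bullet> \<xi>) *\<^sub>R ah"
  let ?E = "\<lambda>x. (ah \<bullet> x) * dd ah f x + s * f x"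
  have "S (s + 1 - 1/2) (\<lambda>x. (ah \<bullet> x) * dd ah (dd \<xi> f) x + (s + 1) * dd \<xi> f x)"
    using G by (simp add: Lead_def)
  moreover have "S (s + 1 - 1/2) (dd ?w f)"
    by (rule S_mono[OF S_dd0[OF S inner_sub_component]]) simp
  ultimately have "S (s + 1 - 1/2)
      (\<lambda>x. ((ah \<bullet> x) * dd ah (dd \<xi> f) x + (s + 1) * dd \<xi> f x) - dd ?w f x)"
    by (rule S_diff)
  then have "S (s + 1 - 1/2) (dd \<xi> ?E)"
    by (rule S_cong) (simp only: dd_Euler[OF S] dd_sub_component[OF S], simp add: algebra_simps)
  then have G': "S (s - 1/2 + 1) (dd \<xi> ?E)"
    by (rule S_mono) simp
  have "smooth_on Om ?E"
    by (intro smooth_on_add smooth_on_mult smooth_on_cmult smooth_on_inner smooth_on_dd open_Om sm)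
  then have "S (s - 1/2) ?E"
    by (rule S_integrate[OF _ G' _ xi]) (use s in simp)
  then show ?thesis using S by (simp add: Lead_def)
qed

text \<open>Modulo lower order terms the Laplacian is the second normal derivative, which acts on a
  leading term of degree \<open>- s\<close> as multiplication by \<open>s (s + 1) / t\<^sup>2\<close>.\<close>

lemma Lead_laplacian:
  assumes f: "Lead s f"
  shows "S (s + 2 - 1/2) (\<lambda>x. laplacian f x - s * (s + 1) * (T (- 2) x * f x))"
proof -
  note S = Lead_S[OF f]
  let ?w = "\<lambda>i. axis i 1 - (ah $ i) *\<^sub>R ah"
  let ?E = "\<lambda>x. (ah \<bullet> x) * dd ah f x + s * f x"
  have ai: "ah \<bullet> axis i 1 = ah $ i" for i by (simp add: inner_axis)
  have w0: "ah \<bullet> ?w i = 0" for i using inner_sub_component[of "axis i 1"] by (simp add: ai)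
  have ddi: "dd (axis i 1) g x = (ah $ i) * dd ah g x + dd (?w i) g x" if "S s' g" "x \<in> Om" for g x s' i
    using dd_sub_component[OF that, of "axis i 1"] by (simp add: ai)
  have sq: "(\<Sum>i\<in>UNIV. (ah $ i)\<^sup>2) = 1"
    using unit by (simp add: inner_vec_def power2_eq_square)
  have lap: "laplacian f x = dd ah (dd ah f) x +
      (\<Sum>i\<in>UNIV. 2 * (ah $ i * dd ah (dd (?w i) f) x) + dd (?w i) (dd (?w i) f) x)"
    if x: "x \<in> Om" for x
  proof -
    have "partial i (partial i f) x = (ah $ i)\<^sup>2 * dd ah (dd ah f) x +
       (2 * (ah $ i * dd ah (dd (?w i) f) x) + dd (?w i) (dd (?w i) f) x)" for i
    proof -
      have a: "dd ah f differentiable (at x)" "dd (?w i) f differentiable (at x)"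
        using S_differentiable[OF S_dd[OF S] x] by blast+
      have com: "dd (?w i) (dd ah f) x = dd ah (dd (?w i) f) x"
        by (rule dd_commute[OF open_Om S_smooth[OF S] x])
      have "partial i (partial i f) x = dd (axis i 1) (\<lambda>x. (ah $ i) * dd ah f x + dd (?w i) f x) x"
        unfolding partial_eq_dd by (rule dd_cong[OF open_Om x ddi[OF S]])
      also have "\<dots> = (ah $ i) * dd (axis i 1) (dd ah f) x + dd (axis i 1) (dd (?w i) f) x"
        using a by (simp add: dd_add dd_cmult)
      also have "\<dots> = (ah $ i)\<^sup>2 * dd ah (dd ah f) x +
         (2 * (ah $ i * dd ah (dd (?w i) f) x) + dd (?w i) (dd (?w i) f) x)"
        by (simp add: ddi[OF S_dd[OF S] x] com power2_eq_square algebra_simps)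
      finally show ?thesis .
    qed
    then show ?thesis
      unfolding laplacian_def by (simp add: sum.distrib sum_distrib_right[symmetric] sq)
  qed
  \<comment> \<open>In each of these terms at least one derivative is tangential, so the order rises
    by at most 1.\<close>
  have "S (s + 1) (\<lambda>x. \<Sum>i\<in>UNIV. 2 * (ah $ i * dd ah (dd (?w i) f) x) + dd (?w i) (dd (?w i) f) x)"
    by (intro S_sum S_add S_cmult S_dd1 S_dd0[OF S w0]
        S_mono[OF S_dd0[OF S_dd0[OF S w0] w0], where s' = "s + 1"]) simp
  then have 1: "S (s + 2 - 1/2) (\<lambda>x. \<Sum>i\<in>UNIV. 2 * (ah $ i * dd ah (dd (?w i) f) x) + dd (?w i) (dd (?w i) f) x)"
    by (rule S_mono) simp
  have E: "S (s - 1/2) ?E" using f by (simp add: Lead_def)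
  \<comment> \<open>With E = t f' + s f, primes denoting normal derivatives, E' / t - (s + 1) E /
    t^2 equals f'' - s (s + 1) f / t^2: the first derivatives cancel, and both terms have the order
    of E raised by 2.\<close>
  have "S (1 + (s - 1/2 + 1)) (\<lambda>x. T (- 1) x * dd ah ?E x)"
    using S_mult[OF S_T[of "- 1"] S_dd1[OF E]] by simp
  moreover have "S (2 + (s - 1/2)) (\<lambda>x. T (- 2) x * ?E x)"
    using S_mult[OF S_T[of "- 2"] E] by simp
  ultimately have 2: "S (s + 2 - 1/2) (\<lambda>x. T (- 1) x * dd ah ?E x - (s + 1) * (T (- 2) x * ?E x))"
    by (intro S_diff S_cmult) (simp_all add: algebra_simps)
  show ?thesis
  proof (rule S_cong[OF S_add[OF 1 2]])
    fix x assume x: "x \<in> Om"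
    then have t: "0 < ah \<bullet> x" by (simp add: Om_def)
    have T1: "T (- 1) x = 1 / (ah \<bullet> x)" and T2: "T (- 2) x = 1 / (ah \<bullet> x)\<^sup>2"
      using t by (simp_all add: T_def powr_minus_divide)
    have "T (- 1) x * dd ah ?E x - (s + 1) * (T (- 2) x * ?E x)
       = dd ah (dd ah f) x - s * (s + 1) * (T (- 2) x * f x)"
      unfolding dd_Euler[OF S x] T1 T2 using t
      by (simp add: unit field_simps power2_eq_square)
    then show "(\<Sum>i\<in>UNIV. 2 * (ah $ i * dd ah (dd (?w i) f) x) + dd (?w i) (dd (?w i) f) x) +
       (T (- 1) x * dd ah ?E x - (s + 1) * (T (- 2) x * ?E x))
      = laplacian f x - s * (s + 1) * (T (- 2) x * f x)"
      using lap[OF x] by simp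
  qed
qed

end

section \<open>Symbols of commuting operators\<close>

text \<open>\<open>conj_coeff \<xi> w N h\<close> is the coefficient of \<open>\<lambda>\<^sup>N\<close> in
  \<open>exp (- \<lambda> \<xi> \<bullet> x) \<partial>\<^sub>w (h exp (\<lambda> \<xi> \<bullet> x))\<close>.\<close>

primrec conj_coeff :: "real^'n::finite \<Rightarrow> 'n list \<Rightarrow> nat \<Rightarrow> (real^'n \<Rightarrow> real) \<Rightarrow> real^'n \<Rightarrow> real" where
  "conj_coeff \<xi> [] = (\<lambda>N h x. if N = 0 then h x else 0)"
| "conj_coeff \<xi> (i # w) = (\<lambda>N h x. partial i (conj_coeff \<xi> w N h) x +
     (case N of 0 \<Rightarrow> 0 | Suc M \<Rightarrow> \<xi> $ i * conj_coeff \<xi> w M h x))"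

lemma conj_coeff_vanish: "length w < N \<Longrightarrow> conj_coeff \<xi> w N h = (\<lambda>x. 0)"
proof (induction w arbitrary: N)
  case (Cons i w)
  then obtain M where "N = Suc M" "length w < M" by (cases N) auto
  then show ?case using Cons.IH[of M] Cons.IH[of N] by (simp add: partial_eq_dd)
qed (simp add: fun_eq_iff)

lemma conj_coeff_smooth:
  assumes "open U" "smooth_on U h"
  shows "smooth_on U (conj_coeff \<xi> w N h)"
proof (induction w arbitrary: N)
  case Nil
  then show ?case using assms by (cases "N = 0") (simp_all add: smooth_on_const)
next
  case (Cons i w)
  have "smooth_on U (\<lambda>x. case N of 0 \<Rightarrow> 0 | Suc M \<Rightarrow> \<xi> $ i * conj_coeff \<xi> w M h x)"
    using assms Cons.IH by (cases N) (simp_all add: smooth_on_const smooth_on_cmult)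
  then show ?case using assms(1) Cons.IH by (simp add: smooth_on_add smooth_on_partial)
qed

lemma conj_coeff_lin:
  assumes U: "open U" and sm: "smooth_on U h" "smooth_on U g"
  shows "x \<in> U \<Longrightarrow> conj_coeff \<xi> w N (\<lambda>x. h x + c * g x) x
     = conj_coeff \<xi> w N h x + c * conj_coeff \<xi> w N g x"
proof (induction w arbitrary: N x)
  case (Cons i w)
  note d = conj_coeff_smooth[OF U sm(1), THEN smooth_on_differentiable, OF Cons.prems]
    conj_coeff_smooth[OF U sm(2), THEN smooth_on_differentiable, OF Cons.prems]
  have "partial i (conj_coeff \<xi> w N (\<lambda>x. h x + c * g x)) x
     = partial i (\<lambda>x. conj_coeff \<xi> w N h x + c * conj_coeff \<xi> w N g x) x"
    unfolding partial_eq_dd by (rule dd_cong[OF U Cons.prems Cons.IH])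
  also have "\<dots> = partial i (conj_coeff \<xi> w N h) x + c * partial i (conj_coeff \<xi> w N g) x"
    using d by (simp add: partial_eq_dd dd_add dd_cmult)
  finally show ?case using Cons.IH[OF Cons.prems] by (cases N) (simp_all add: algebra_simps)
qed simp

lemma partial_mult_exp:
  assumes "h differentiable (at x)"
  shows "partial i (\<lambda>x. h x * exp (a \<bullet> x)) x = (partial i h x + a $ i * h x) * exp (a \<bullet> x)"
proof -
  have "(\<lambda>x. exp (a \<bullet> x)) differentiable (at x)"
    using smooth_on_differentiable[OF smooth_on_exp[OF open_UNIV]] by simp
  then show ?thesis
    using assms by (simp add: partial_eq_dd dd_mult dd_exp inner_axis algebra_simps)
qed

lemma sum_power_shift:
  fixes X Y :: "nat \<Rightarrow> real"
  assumes "Y M = 0"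
  shows "(\<Sum>N\<le>M. l ^ N * (X N + l * Y N)) = (\<Sum>N\<le>M. l ^ N * (X N + (case N of 0 \<Rightarrow> 0 | Suc n \<Rightarrow> Y n)))"
proof -
  have "(\<Sum>N\<le>M. l ^ N * (l * Y N)) = (\<Sum>N\<le>M. l ^ N * (case N of 0 \<Rightarrow> 0 | Suc n \<Rightarrow> Y n))"
    using assms
  proof (cases M)
    case (Suc m)
    have "(\<Sum>N\<le>Suc m. l ^ N * (l * Y N)) = (\<Sum>N\<le>m. l ^ N * (l * Y N))"
      using assms Suc by simp
    also have "\<dots> = (\<Sum>N\<le>Suc m. l ^ N * (case N of 0 \<Rightarrow> 0 | Suc n \<Rightarrow> Y n))"
      unfolding sum.atMost_Suc_shift by (simp add: mult_ac)
    finally show ?thesis using Suc by simp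
  qed simp
  then show ?thesis by (simp add: distrib_left sum.distrib)
qed

lemma foldr_partial_mult_exp:
  assumes U: "open U" and sm: "smooth_on U h"
  shows "length w \<le> M \<Longrightarrow> x \<in> U \<Longrightarrow> foldr partial w (\<lambda>x. h x * exp ((l *\<^sub>R \<xi>) \<bullet> x)) x
     = (\<Sum>N\<le>M. l ^ N * conj_coeff \<xi> w N h x) * exp ((l *\<^sub>R \<xi>) \<bullet> x)"
proof (induction w arbitrary: x)
  case Nil
  have "(\<Sum>N\<le>M. l ^ N * conj_coeff \<xi> [] N h x) = (\<Sum>N\<in>{0}. l ^ N * conj_coeff \<xi> [] N h x)"
    by (rule sum.mono_neutral_right) auto
  then show ?case by simp
next
  case (Cons i w)
  let ?G = "\<lambda>x. \<Sum>N\<le>M. l ^ N * conj_coeff \<xi> w N h x"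
  have K: "conj_coeff \<xi> w N h differentiable (at x)" for N
    using conj_coeff_smooth[OF U sm] Cons.prems smooth_on_differentiable by blast
  have "foldr partial (i # w) (\<lambda>x. h x * exp ((l *\<^sub>R \<xi>) \<bullet> x)) x
    = partial i (\<lambda>x. ?G x * exp ((l *\<^sub>R \<xi>) \<bullet> x)) x"
    unfolding partial_eq_dd foldr_Cons o_apply
    by (rule dd_cong[OF U Cons.prems(2)]) (use Cons in \<open>simp add: partial_eq_dd\<close>)
  also have "\<dots> = (partial i ?G x + l * \<xi> $ i * ?G x) * exp ((l *\<^sub>R \<xi>) \<bullet> x)"
    by (subst partial_mult_exp) (use K in \<open>auto intro!: differentiable_sum\<close>)
  also have "partial i ?G x = (\<Sum>N\<le>M. l ^ N * partial i (conj_coeff \<xi> w N h) x)"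
    using K unfolding partial_eq_dd by (subst dd_sum) (auto simp: dd_cmult)
  also have "(\<Sum>N\<le>M. l ^ N * partial i (conj_coeff \<xi> w N h) x) + l * \<xi> $ i * ?G x
     = (\<Sum>N\<le>M. l ^ N * (partial i (conj_coeff \<xi> w N h) x + l * (\<xi> $ i * conj_coeff \<xi> w N h x)))"
    by (simp add: sum.distrib distrib_left sum_distrib_left mult_ac)
  also have "\<dots> = (\<Sum>N\<le>M. l ^ N * conj_coeff \<xi> (i # w) N h x)"
    using conj_coeff_vanish[of w M \<xi> h] Cons.prems
    by (subst sum_power_shift) (auto intro!: sum.cong split: nat.splits)
  finally show ?case .
qed

text \<open>A multi-index spelled out as a list of coordinate directions, so that the action of
  \<partial>^\<nu> is a \<open>foldr\<close> and can be studied by list induction.\<close>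

definition word :: "('n::finite \<Rightarrow>\<^sub>0 nat) \<Rightarrow> 'n list" where
  "word \<nu> = concat (map (\<lambda>i. replicate (Poly_Mapping.lookup \<nu> i) i) index_list)"

lemma index_list: "distinct (index_list :: 'n::finite list)" "set (index_list :: 'n list) = UNIV"
proof -
  have "\<exists>xs :: 'n list. distinct xs \<and> set xs = UNIV"
    using finite_distinct_list[of "UNIV :: 'n set"] by auto
  from someI_ex[OF this] show "distinct (index_list :: 'n list)" "set (index_list :: 'n list) = UNIV"
    unfolding index_list_def by blast+
qed

lemma foldr_partial_replicate: "foldr partial (replicate n i) f = (partial i ^^ n) f"
  by (induction n) auto

lemma multi_partial_word: "multi_partial \<nu> f = foldr partial (word \<nu>) f"
proof -
  have "foldr (\<lambda>i g. (partial i ^^ Poly_Mapping.lookup \<nu> i) g) xs f =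
     foldr partial (concat (map (\<lambda>i. replicate (Poly_Mapping.lookup \<nu> i) i) xs)) f" for xs
    by (induction xs) (auto simp: foldr_partial_replicate)
  then show ?thesis by (simp add: multi_partial_def word_def)
qed

lemma prod_list_word: "prod_list (map c (word \<nu>)) = (\<Prod>i\<in>UNIV. c i ^ Poly_Mapping.lookup \<nu> i)"
  for c :: "'n::finite \<Rightarrow> 'a::comm_monoid_mult"
proof -
  have "prod_list (map c (concat (map (\<lambda>i. replicate (Poly_Mapping.lookup \<nu> i) i) xs)))
     = prod_list (map (\<lambda>i. c i ^ Poly_Mapping.lookup \<nu> i) xs)" for xs
    by (induction xs) (auto simp: map_replicate_const)
  then show ?thesis
    using prod.distinct_set_conv_list[OF index_list(1), of "\<lambda>i. c i ^ Poly_Mapping.lookup \<nu> i"]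
    by (simp add: word_def index_list(2))
qed

lemma length_word: "length (word \<nu>) = multi_degree \<nu>"
proof -
  have "length (concat (map (\<lambda>i. replicate (Poly_Mapping.lookup \<nu> i) i) xs))
     = sum_list (map (Poly_Mapping.lookup \<nu>) xs)" for xs
    by (induction xs) auto
  then show ?thesis
    using sum.distinct_set_conv_list[OF index_list(1), of "Poly_Mapping.lookup \<nu>"]
    by (simp add: word_def multi_degree_def index_list(2))
qed

text \<open>The coefficient of \<lambda>^N in exp (- \<lambda> \<xi> \<bullet> x) a (h exp
  (\<lambda> \<xi> \<bullet> x)), as \<open>op_apply_mult_exp\<close> shows. For h = 1 it is the
  part of degree N of the full symbol at \<xi>.\<close>

definition op_conj ::
  "(real^'n::finite) set \<Rightarrow> 'n coeffs \<Rightarrow> real^'n \<Rightarrow> nat \<Rightarrow> (real^'n \<Rightarrow> real) \<Rightarrow> real^'n \<Rightarrow> real" where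
  "op_conj U a \<xi> N h x = (\<Sum>\<nu>\<in>op_support U a. a \<nu> x * conj_coeff \<xi> (word \<nu>) N h x)"

lemma op_conj_smooth:
  assumes "open U" "diff_op U a" "smooth_on U h"
  shows "smooth_on U (op_conj U a \<xi> N h)"
  unfolding op_conj_def[abs_def]
  using assms by (intro smooth_on_sum smooth_on_mult conj_coeff_smooth) (auto simp: diff_op_def)

lemma op_conj_lin:
  assumes "open U" "smooth_on U h" "smooth_on U g" "x \<in> U"
  shows "op_conj U a \<xi> N (\<lambda>x. h x + c * g x) x = op_conj U a \<xi> N h x + c * op_conj U a \<xi> N g x"
  unfolding op_conj_def
  by (simp add: conj_coeff_lin[OF assms] distrib_left sum.distrib sum_distrib_left mult_ac)

lemma op_conj_vanish:
  assumes "\<And>\<nu>. \<nu> \<in> op_support U a \<Longrightarrow> multi_degree \<nu> < N"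
  shows "op_conj U a \<xi> N h = (\<lambda>x. 0)"
  unfolding op_conj_def[abs_def] using assms by (auto simp: conj_coeff_vanish length_word)

lemma op_apply_mult_exp:
  assumes "open U" "smooth_on U h" "x \<in> U" "\<And>\<nu>. \<nu> \<in> op_support U a \<Longrightarrow> multi_degree \<nu> \<le> M"
  shows "op_apply U a (\<lambda>x. h x * exp ((l *\<^sub>R \<xi>) \<bullet> x)) x
    = (\<Sum>N\<le>M. l ^ N * op_conj U a \<xi> N h x) * exp ((l *\<^sub>R \<xi>) \<bullet> x)"
proof -
  have "op_apply U a (\<lambda>x. h x * exp ((l *\<^sub>R \<xi>) \<bullet> x)) x = (\<Sum>\<nu>\<in>op_support U a.
      a \<nu> x * ((\<Sum>N\<le>M. l ^ N * conj_coeff \<xi> (word \<nu>) N h x) * exp ((l *\<^sub>R \<xi>) \<bullet> x)))"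
    unfolding op_apply_def multi_partial_word
    by (intro sum.cong refl arg_cong2[where f = "(*)"] foldr_partial_mult_exp[OF assms(1,2)] assms)
      (simp_all add: length_word assms)
  also have "\<dots> = (\<Sum>\<nu>\<in>op_support U a. \<Sum>N\<le>M. l ^ N * (a \<nu> x * conj_coeff \<xi> (word \<nu>) N h x)) *
      exp ((l *\<^sub>R \<xi>) \<bullet> x)"
    by (simp add: sum_distrib_left sum_distrib_right mult_ac)
  finally show ?thesis
    unfolding op_conj_def sum_distrib_left by (subst sum.swap) simp
qed

section \<open>The Laplacian under conjugation with an exponential\<close>

lemma laplacian_cong:
  assumes "open U" "x \<in> U" "\<And>y. y \<in> U \<Longrightarrow> f y = g y"
  shows "laplacian f x = laplacian g x"
proof -
  have "foldr partial [i, i] f x = foldr partial [i, i] g x" for i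
    by (rule foldr_partial_cong[OF assms(1) _ assms(2)]) (rule assms(3))
  then show ?thesis by (simp add: laplacian_def)
qed

lemma laplacian_sum:
  assumes "open U" "x \<in> U" "finite I" "\<And>i. i \<in> I \<Longrightarrow> smooth_on U (f i)"
  shows "laplacian (\<lambda>x. \<Sum>i\<in>I. c i * f i x) x = (\<Sum>i\<in>I. c i * laplacian (f i) x)"
proof -
  have "partial j (partial j (\<lambda>x. \<Sum>i\<in>I. c i * f i x)) x = (\<Sum>i\<in>I. c i * partial j (partial j (f i)) x)" for j
  proof -
    have 1: "partial j (\<lambda>x. \<Sum>i\<in>I. c i * f i x) y = (\<Sum>i\<in>I. c i * partial j (f i) y)"
      if "y \<in> U" for y
      unfolding partial_eq_dd using assms(4)[THEN smooth_on_differentiable] that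
      by (subst dd_sum) (auto simp: dd_cmult)
    have "partial j (partial j (\<lambda>x. \<Sum>i\<in>I. c i * f i x)) x
       = partial j (\<lambda>x. \<Sum>i\<in>I. c i * partial j (f i) x) x"
      using dd_cong[OF assms(1,2) 1] by (simp add: partial_eq_dd)
    also have "\<dots> = (\<Sum>i\<in>I. c i * partial j (partial j (f i)) x)"
      using assms(4)[THEN smooth_on_partial, THEN smooth_on_differentiable] assms(2)
      unfolding partial_eq_dd by (subst dd_sum) (auto simp: dd_cmult)
    finally show ?thesis .
  qed
  then show ?thesis
    unfolding laplacian_def by (simp add: sum_distrib_left) (rule sum.swap)
qed

lemma smooth_on_laplacian: "open U \<Longrightarrow> smooth_on U f \<Longrightarrow> smooth_on U (laplacian f)"
  unfolding laplacian_def[abs_def] by (intro smooth_on_sum smooth_on_partial)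

lemma laplacian_mult_exp:
  assumes U: "open U" "x \<in> U" and sm: "smooth_on U h"
  shows "laplacian (\<lambda>x. h x * exp ((l *\<^sub>R \<xi>) \<bullet> x)) x
    = (laplacian h x + l * (2 * dd \<xi> h x) + l\<^sup>2 * (\<xi> \<bullet> \<xi>) * h x) * exp ((l *\<^sub>R \<xi>) \<bullet> x)"
proof -
  let ?e = "\<lambda>x. exp ((l *\<^sub>R \<xi>) \<bullet> x)"
  have "partial i (partial i (\<lambda>x. h x * ?e x)) x
    = (partial i (partial i h) x + 2 * l * (\<xi> $ i * partial i h x) + l\<^sup>2 * (\<xi> $ i * \<xi> $ i) * h x) * ?e x" for i
  proof -
    let ?g = "\<lambda>x. partial i h x + (l *\<^sub>R \<xi>) $ i * h x"
    have "partial i (partial i (\<lambda>x. h x * ?e x)) x = partial i (\<lambda>x. ?g x * ?e x) x"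
      unfolding partial_eq_dd
      by (rule dd_cong[OF U]) (simp only: partial_mult_exp[unfolded partial_eq_dd] smooth_on_differentiable[OF sm])
    also have "\<dots> = (partial i ?g x + (l *\<^sub>R \<xi>) $ i * ?g x) * ?e x"
      by (rule partial_mult_exp, rule smooth_on_differentiable[OF _ U(2)])
        (intro smooth_on_add smooth_on_cmult smooth_on_partial U sm)
    also have "partial i ?g x = partial i (partial i h) x + (l *\<^sub>R \<xi>) $ i * partial i h x"
      using smooth_on_differentiable[OF sm U(2)]
        smooth_on_differentiable[OF smooth_on_partial[OF sm] U(2), of i]
      by (simp add: partial_eq_dd dd_add dd_cmult)
    finally show ?thesis by (simp add: power2_eq_square algebra_simps)
  qed
  then show ?thesis
    by (simp add: laplacian_def dd_expand[OF smooth_on_differentiable[OF sm U(2)]] inner_vec_def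
        sum.distrib sum_distrib_left sum_distrib_right algebra_simps)
qed

lemma op_apply_cong:
  assumes "open U" "x \<in> U" "\<And>y. y \<in> U \<Longrightarrow> f y = g y"
  shows "op_apply U a f x = op_apply U a g x"
  unfolding op_apply_def multi_partial_word by (simp only: foldr_partial_cong[OF assms(1,3,2)])

text \<open>Comparison of the coefficients of \<open>\<lambda>\<^sup>N\<close> in the commutation relation, applied to
  \<open>h exp (\<lambda> \<xi> \<bullet> x)\<close>.\<close>

lemma commute_coeff:
  assumes U: "open U" and u: "smooth_on U u" and a: "diff_op U a" and h: "smooth_on U h"
    and com: "\<And>f x. smooth_on U f \<Longrightarrow> x \<in> U \<Longrightarrow>
      op_apply U a (\<lambda>y. laplacian f y - u y * f y) x
        = laplacian (op_apply U a f) x - u x * op_apply U a f x"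
    and x: "x \<in> U"
  shows "laplacian (op_conj U a \<xi> N h) x - u x * op_conj U a \<xi> N h x
      - op_conj U a \<xi> N (\<lambda>x. laplacian h x - u x * h x) x
      + (case N of 0 \<Rightarrow> 0 | Suc n \<Rightarrow> 2 * dd \<xi> (op_conj U a \<xi> n h) x - 2 * op_conj U a \<xi> n (dd \<xi> h) x) = 0"
proof -
  let ?F = "op_conj U a \<xi>"
  let ?h0 = "\<lambda>x. laplacian h x - u x * h x"
  obtain M0 where M0: "\<And>\<nu>. \<nu> \<in> op_support U a \<Longrightarrow> multi_degree \<nu> \<le> M0"
    using a finite_imageI[of "op_support U a" multi_degree] finite_nat_set_iff_bounded_le
    unfolding diff_op_def by (metis imageI)
  \<comment> \<open>Beyond every degree in \<open>a\<close>, so that the coefficients of index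
    \<open>M\<close> vanish as \<open>sum_power_shift\<close> requires.\<close>
  define M where "M = Suc (max N M0)"
  have M: "\<And>\<nu>. \<nu> \<in> op_support U a \<Longrightarrow> multi_degree \<nu> \<le> M" "N \<le> M"
    and M': "\<And>\<nu>. \<nu> \<in> op_support U a \<Longrightarrow> multi_degree \<nu> < M"
    using M0 by (fastforce simp: M_def)+
  note F = op_conj_smooth[OF U a h]
  have h0: "smooth_on U ?h0" by (intro smooth_on_diff smooth_on_mult smooth_on_laplacian U u h)
  define X where "X N = laplacian (?F N h) x - u x * ?F N h x - ?F N ?h0 x" for N
  define Y where "Y N = 2 * dd \<xi> (?F N h) x - 2 * ?F N (dd \<xi> h) x" for N
  have YM: "Y M = 0"
  proof -
    have "?F M g = (\<lambda>x. 0)" for g by (rule op_conj_vanish) (rule M')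
    then show ?thesis by (simp add: Y_def)
  qed
  have key: "(\<Sum>N\<le>M. l ^ N * (X N + l * Y N)) = 0" for l
  proof -
    let ?e = "\<lambda>x. exp ((l *\<^sub>R \<xi>) \<bullet> x)"
    let ?G = "\<lambda>x. \<Sum>N\<le>M. l ^ N * ?F N h x"
    let ?p = "\<lambda>x. ?h0 x + l * (2 * dd \<xi> h x)"
    let ?q = "\<lambda>x. ?p x + (l\<^sup>2 * (\<xi> \<bullet> \<xi>)) * h x"
    have sp: "smooth_on U (\<lambda>x. 2 * dd \<xi> h x)" by (intro smooth_on_cmult smooth_on_dd U h)
    have sp': "smooth_on U ?p" by (intro smooth_on_add smooth_on_cmult smooth_on_dd U h h0)
    have q: "smooth_on U ?q" by (intro smooth_on_add smooth_on_cmult sp' h U)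
    have G: "smooth_on U ?G" by (intro smooth_on_sum smooth_on_cmult F U)
    have he: "smooth_on U (\<lambda>x. h x * ?e x)" by (intro smooth_on_mult smooth_on_exp U h)
    have "op_apply U a (\<lambda>y. laplacian (\<lambda>x. h x * ?e x) y - u y * (h y * ?e y)) x
       = op_apply U a (\<lambda>y. ?q y * ?e y) x"
      by (rule op_apply_cong[OF U x]) (simp only: laplacian_mult_exp[OF U _ h], simp add: algebra_simps)
    also have "\<dots> = (\<Sum>N\<le>M. l ^ N * ?F N ?q x) * ?e x"
      by (rule op_apply_mult_exp[OF U q x M(1)])
    also have "(\<lambda>N. ?F N ?q x) =
       (\<lambda>N. ?F N ?h0 x + l * (2 * ?F N (dd \<xi> h) x) + (l\<^sup>2 * (\<xi> \<bullet> \<xi>)) * ?F N h x)"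
    proof
      fix N
      \<comment> \<open>Homogeneity is linearity with first summand zero; a second instance, with
        all functions zero, shows that zero is mapped to zero.\<close>
      have "?F N (\<lambda>x. 2 * dd \<xi> h x) x = 2 * ?F N (dd \<xi> h) x"
        using op_conj_lin[OF U smooth_on_const[OF U] smooth_on_dd[OF U h] x, of a \<xi> N 0 2 \<xi>]
          op_conj_lin[OF U smooth_on_const[OF U] smooth_on_const[OF U] x, of a \<xi> N 0 1 0] by simp
      then show "?F N ?q x = ?F N ?h0 x + l * (2 * ?F N (dd \<xi> h) x) + (l\<^sup>2 * (\<xi> \<bullet> \<xi>)) * ?F N h x"
        using op_conj_lin[OF U sp' h x] op_conj_lin[OF U h0 sp x] by simp
    qed
    finally have left: "op_apply U a (\<lambda>y. laplacian (\<lambda>x. h x * ?e x) y - u y * (h y * ?e y)) x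
       = (\<Sum>N\<le>M. l ^ N * (?F N ?h0 x + l * (2 * ?F N (dd \<xi> h) x) + (l\<^sup>2 * (\<xi> \<bullet> \<xi>)) * ?F N h x)) * ?e x" .
    have opG: "op_apply U a (\<lambda>x. h x * ?e x) y = ?G y * ?e y" if "y \<in> U" for y
      by (rule op_apply_mult_exp[OF U h that M(1)])
    have "laplacian (op_apply U a (\<lambda>x. h x * ?e x)) x = laplacian (\<lambda>x. ?G x * ?e x) x"
      by (rule laplacian_cong[OF U x opG])
    also have "\<dots> = (laplacian ?G x + l * (2 * dd \<xi> ?G x) + l\<^sup>2 * (\<xi> \<bullet> \<xi>) * ?G x) * ?e x"
      by (rule laplacian_mult_exp[OF U x G])
    also have "laplacian ?G x = (\<Sum>N\<le>M. l ^ N * laplacian (?F N h) x)"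
      by (rule laplacian_sum[OF U x]) (simp_all add: F)
    also have "dd \<xi> ?G x = (\<Sum>N\<le>M. l ^ N * dd \<xi> (?F N h) x)"
      using smooth_on_differentiable[OF F x] by (subst dd_sum) (auto simp: dd_cmult)
    finally have right: "laplacian (op_apply U a (\<lambda>x. h x * ?e x)) x = ((\<Sum>N\<le>M. l ^ N * laplacian (?F N h) x)
       + l * (2 * (\<Sum>N\<le>M. l ^ N * dd \<xi> (?F N h) x)) + l\<^sup>2 * (\<xi> \<bullet> \<xi>) * ?G x) * ?e x" .
    have "(\<Sum>N\<le>M. l ^ N * (?F N ?h0 x + l * (2 * ?F N (dd \<xi> h) x) + (l\<^sup>2 * (\<xi> \<bullet> \<xi>)) * ?F N h x)) * ?e x
      = ((\<Sum>N\<le>M. l ^ N * laplacian (?F N h) x)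
       + l * (2 * (\<Sum>N\<le>M. l ^ N * dd \<xi> (?F N h) x)) + l\<^sup>2 * (\<xi> \<bullet> \<xi>) * ?G x - u x * ?G x) * ?e x"
      using com[OF he x] left right opG[OF x] by (simp add: algebra_simps)
    then have "(\<Sum>N\<le>M. l ^ N * (?F N ?h0 x + l * (2 * ?F N (dd \<xi> h) x) + (l\<^sup>2 * (\<xi> \<bullet> \<xi>)) * ?F N h x))
      = (\<Sum>N\<le>M. l ^ N * laplacian (?F N h) x)
       + l * (2 * (\<Sum>N\<le>M. l ^ N * dd \<xi> (?F N h) x)) + l\<^sup>2 * (\<xi> \<bullet> \<xi>) * ?G x - u x * ?G x"
      by simp
    \<comment> \<open>The terms with l^2 (\<xi> \<bullet> \<xi>) agree on both sides and
      cancel.\<close>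
    then show ?thesis
      unfolding X_def Y_def
      by (simp add: sum.distrib sum_subtractf sum_distrib_left algebra_simps)
  qed
  have "\<forall>l. (\<Sum>N\<le>M. (X N + (case N of 0 \<Rightarrow> 0 | Suc n \<Rightarrow> Y n)) * l ^ N) = 0"
    using key unfolding sum_power_shift[where Y = Y, OF YM] by (simp add: mult.commute)
  then have "X N + (case N of 0 \<Rightarrow> 0 | Suc n \<Rightarrow> Y n) = 0"
    using M(2) unfolding polyfun_eq_0 by blast
  then show ?thesis unfolding X_def Y_def .
qed

subsection \<open>Extraction of coefficients\<close>

text \<open>Lagrange interpolation: a polynomial of degree at most \<open>K\<close> is determined by
  its values at more than \<open>K\<close> points, and each of its coefficients is a fixed linear
  combination of them. The weights are the coefficients of the basis polynomials
  \<open>L z\<close>.\<close>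

lemma coeff_weights:
  fixes Z :: "real set"
  assumes Z: "finite Z" "K < card Z" and k: "k \<le> K"
  shows "\<exists>w. \<forall>j\<le>K. (\<Sum>z\<in>Z. w z * z ^ j) = (if j = k then 1 else 0)"
proof -
  define L where "L z = (\<Prod>y\<in>Z - {z}. smult (1 / (z - y)) [:- y, 1:])" for z :: real
  have degL: "degree (L z) < card Z" if "z \<in> Z" for z
  proof -
    have "degree (L z) \<le> (\<Sum>y\<in>Z - {z}. degree (smult (1 / (z - y)) [:- y, 1:]))"
      unfolding L_def by (rule degree_prod_sum_le[unfolded comp_def]) (use Z in simp)
    also have "\<dots> \<le> (\<Sum>y\<in>Z - {z}. 1)" by (rule sum_mono) (simp add: degree_smult_le[THEN order_trans])
    also have "\<dots> < card Z" using Z that card_gt_0_iff[of Z] by (auto simp: card_Diff_singleton)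
    finally show ?thesis .
  qed
  have evalL: "poly (L z) x = (if x = z then 1 else 0)" if "z \<in> Z" "x \<in> Z" for x z
  proof (cases "x = z")
    case True
    have "poly (smult (1 / (z - y)) [:- y, 1:]) z = 1" if "y \<in> Z - {z}" for y
      using that by (simp add: divide_simps)
    then show ?thesis using True unfolding L_def poly_prod by (simp add: prod.neutral)
  next
    case False
    then have "\<exists>y\<in>Z - {z}. poly (smult (1 / (z - y)) [:- y, 1:]) x = 0"
      using that by (intro bexI[of _ x]) auto
    then show ?thesis using False Z unfolding L_def poly_prod by (simp add: prod_zero_iff)
  qed
  have mono: "monom 1 j = (\<Sum>z\<in>Z. smult (z ^ j) (L z))" if "j \<le> K" for j
  proof (rule poly_eqI_degree[of Z])
    fix x assume x: "x \<in> Z"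
    have "poly (\<Sum>z\<in>Z. smult (z ^ j) (L z)) x = (\<Sum>z\<in>Z. if x = z then z ^ j else 0)"
      unfolding poly_sum by (rule sum.cong) (use x evalL in auto)
    then show "poly (monom 1 j) x = poly (\<Sum>z\<in>Z. smult (z ^ j) (L z)) x"
      using Z x by (simp add: poly_monom)
  next
    show "card Z > degree (monom (1::real) j)" using Z that by (simp add: degree_monom_eq)
    have "degree (\<Sum>z\<in>Z. smult (z ^ j) (L z)) \<le> card Z - 1"
      by (rule degree_sum_le) (use Z degL in \<open>force simp: degree_smult_le[THEN order_trans]\<close>)+
    then show "card Z > degree (\<Sum>z\<in>Z. smult (z ^ j) (L z))" using Z by linarith
  qed
  show ?thesis
  proof (intro exI allI impI)
    fix j assume "j \<le> K"
    from arg_cong[OF mono[OF this], of "\<lambda>p. coeff p k"]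
    show "(\<Sum>z\<in>Z. coeff (L z) k * z ^ j) = (if j = k then 1 else 0)"
      by (simp add: coeff_sum mult.commute)
  qed
qed

text \<open>Uniqueness of digits, by reduction modulo \<open>B\<close>. It makes the substitution in
  \<open>multi_coeff_weights\<close> injective on monomials.\<close>

lemma base_expansion_inj:
  fixes a b :: "nat \<Rightarrow> nat"
  assumes "\<And>k. k < n \<Longrightarrow> a k < B" "\<And>k. k < n \<Longrightarrow> b k < B"
    and "(\<Sum>k<n. a k * B ^ k) = (\<Sum>k<n. b k * B ^ k)"
  shows "\<forall>k<n. a k = b k"
  using assms
proof (induction n arbitrary: a b)
  case (Suc n)
  have e: "(\<Sum>k<Suc n. c k * B ^ k) = c 0 + B * (\<Sum>k<n. c (Suc k) * B ^ k)" for c :: "nat \<Rightarrow> nat"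
    unfolding sum.lessThan_Suc_shift by (simp add: sum_distrib_left mult_ac)
  have B: "a 0 < B" "b 0 < B" using Suc.prems by auto
  have eq: "a 0 + B * (\<Sum>k<n. a (Suc k) * B ^ k) = b 0 + B * (\<Sum>k<n. b (Suc k) * B ^ k)"
    using Suc.prems(3) unfolding e .
  have 0: "a 0 = b 0" using arg_cong[OF eq, of "\<lambda>x. x mod B"] B by simp
  then have "(\<Sum>k<n. a (Suc k) * B ^ k) = (\<Sum>k<n. b (Suc k) * B ^ k)" using eq B by simp
  with Suc.IH[of "\<lambda>k. a (Suc k)" "\<lambda>k. b (Suc k)"] Suc.prems(1,2)
  have "\<forall>k<n. a (Suc k) = b (Suc k)" by simp
  then show ?case using 0 less_Suc_eq_0_disj by auto
qed simp

abbreviation monomial_at :: "real^'n::finite \<Rightarrow> ('n \<Rightarrow>\<^sub>0 nat) \<Rightarrow> real" where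
  "monomial_at \<xi> \<nu> \<equiv> (\<Prod>i\<in>UNIV. (\<xi> $ i) ^ Poly_Mapping.lookup \<nu> i)"

text \<open>The substitution \<open>\<xi>\<^sub>i = z^(B^i)\<close> separates the given monomials by their degree in \<open>z\<close>.\<close>

lemma multi_coeff_weights:
  fixes h :: "real^'n::finite" and V :: "('n \<Rightarrow>\<^sub>0 nat) set"
  assumes V: "finite V" and h: "h \<noteq> 0" and \<nu>: "\<nu> \<in> V"
  shows "\<exists>Z w. finite Z \<and> (\<forall>\<xi>\<in>Z. h \<bullet> \<xi> \<noteq> 0) \<and>
     (\<forall>\<mu>\<in>V. (\<Sum>\<xi>\<in>Z. w \<xi> * monomial_at \<xi> \<mu>) = (if \<mu> = \<nu> then 1 else 0))"
proof -
  define n where "n = CARD('n)"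
  obtain e :: "'n \<Rightarrow> nat" where e: "bij_betw e UNIV {..<n}"
    using ex_bij_betw_finite_nat[of "UNIV :: 'n set"] by (auto simp: n_def atLeast0LessThan)
  \<comment> \<open>Larger than every exponent that occurs, so these are digits in base
    \<open>B\<close>; at least 2, so that the powers \<open>B ^ e i\<close> are distinct.\<close>
  define B where "B = 2 + (\<Sum>\<mu>\<in>V. \<Sum>i\<in>UNIV. Poly_Mapping.lookup \<mu> i)"
  have B: "Poly_Mapping.lookup \<mu> i < B" if "\<mu> \<in> V" for \<mu> i
  proof -
    have "Poly_Mapping.lookup \<mu> i \<le> (\<Sum>i\<in>UNIV. Poly_Mapping.lookup \<mu> i)" by (rule member_le_sum) auto
    also have "\<dots> \<le> (\<Sum>\<mu>\<in>V. \<Sum>i\<in>UNIV. Poly_Mapping.lookup \<mu> i)"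
      by (rule member_le_sum[OF that, where f = "\<lambda>\<mu>. \<Sum>i\<in>UNIV. Poly_Mapping.lookup \<mu> i"]) (auto simp: V)
    finally show ?thesis by (simp add: B_def)
  qed
  have B2: "2 \<le> B" by (simp add: B_def)
  define \<kappa> where "\<kappa> \<mu> = (\<Sum>i\<in>UNIV. Poly_Mapping.lookup \<mu> i * B ^ e i)" for \<mu> :: "'n \<Rightarrow>\<^sub>0 nat"
  have ie: "inv_into UNIV e (e i) = i" "e i < n" for i
    using e bij_betw_inv_into_left[OF e] by (auto simp: bij_betw_def)
  have ie': "e (inv_into UNIV e k) = k" if "k < n" for k
    using bij_betw_inv_into_right[OF e] that by auto
  have \<kappa>_inj: "inj_on \<kappa> V"
  proof (rule inj_onI)
    fix \<mu> \<mu>' assume *: "\<mu> \<in> V" "\<mu>' \<in> V" "\<kappa> \<mu> = \<kappa> \<mu>'"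
    have "\<kappa> \<mu> = (\<Sum>k<n. Poly_Mapping.lookup \<mu> (inv_into UNIV e k) * B ^ k)" for \<mu>
      unfolding \<kappa>_def
      using sum.reindex_bij_betw[OF e, of "\<lambda>k. Poly_Mapping.lookup \<mu> (inv_into UNIV e k) * B ^ k"]
      by (simp add: ie)
    then have "\<forall>k<n. Poly_Mapping.lookup \<mu> (inv_into UNIV e k) = Poly_Mapping.lookup \<mu>' (inv_into UNIV e k)"
      using * B by (intro base_expansion_inj[of n _ B]) auto
    then have "Poly_Mapping.lookup \<mu> i = Poly_Mapping.lookup \<mu>' i" for i
      using ie[of i] by metis
    then show "\<mu> = \<mu>'" by (simp add: poly_mapping_eq_iff fun_eq_iff)
  qed
  define \<xi> where "\<xi> z = (\<chi> i. z ^ (B ^ e i))" for z :: real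
  have mon: "monomial_at (\<xi> z) \<mu> = z ^ \<kappa> \<mu>" for z \<mu>
    by (simp add: \<xi>_def \<kappa>_def power_sum power_mult[symmetric] mult.commute)
  \<comment> \<open>Along the curve \<xi> the linear form of \<open>h\<close> is a polynomial in
    \<open>z\<close>, nonzero because the exponents \<open>B ^ e i\<close> are distinct; the sample
    points avoid its finitely many roots.\<close>
  define P where "P = (\<Sum>i\<in>UNIV. monom (h $ i) (B ^ e i))"
  have hP: "h \<bullet> \<xi> z = poly P z" for z
    by (simp add: P_def \<xi>_def inner_vec_def poly_sum poly_monom)
  have "P \<noteq> 0"
  proof -
    obtain j where j: "h $ j \<noteq> 0" using h by (auto simp: vec_eq_iff)
    have "B ^ e i = B ^ e j \<longleftrightarrow> i = j" for i
      using B2 ie(1) by (metis power_inject_exp One_nat_def Suc_1 Suc_le_lessD)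
    then have "coeff P (B ^ e j) = h $ j"
      by (simp add: P_def coeff_sum coeff_monom)
    then show ?thesis using j by auto
  qed
  then have "finite {z. poly P z = 0}" by (rule poly_roots_finite)
  then have "infinite (- {z. poly P z = 0})"
    using infinite_UNIV_char_0 by (metis Compl_eq_Diff_UNIV finite_Diff2)
  moreover define K where "K = (\<Sum>\<mu>\<in>V. \<kappa> \<mu>)"
  ultimately obtain Z where Z: "finite Z" "card Z = Suc K" "Z \<subseteq> - {z. poly P z = 0}"
    using infinite_arbitrarily_large by metis
  have K: "\<kappa> \<mu> \<le> K" if "\<mu> \<in> V" for \<mu>
    unfolding K_def using V that by (intro member_le_sum) auto
  obtain w where w: "\<forall>j\<le>K. (\<Sum>z\<in>Z. w z * z ^ j) = (if j = \<kappa> \<nu> then 1 else 0)"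
    using coeff_weights[OF Z(1) _ K[OF \<nu>]] Z(2) by auto
  have inj: "inj \<xi>"
  proof (rule inj_onI)
    fix y z assume "\<xi> y = \<xi> z"
    moreover obtain i where i: "e i = 0"
      using e ie'[of 0] by (metis n_def zero_less_card_finite)
    ultimately have "\<xi> y $ i = \<xi> z $ i" by simp
    then show "y = z" by (simp add: \<xi>_def i)
  qed
  show ?thesis
  proof (intro exI conjI ballI)
    show "finite (\<xi> ` Z)" using Z by simp
    show "h \<bullet> x \<noteq> 0" if "x \<in> \<xi> ` Z" for x using that Z hP by auto
    fix \<mu> assume \<mu>: "\<mu> \<in> V"
    have "(\<Sum>x\<in>\<xi> ` Z. w (inv_into UNIV \<xi> x) * monomial_at x \<mu>) = (\<Sum>z\<in>Z. w z * z ^ \<kappa> \<mu>)"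
      by (subst sum.reindex) (auto simp: inj mon intro: inj_on_subset[OF inj])
    also have "\<dots> = (if \<mu> = \<nu> then 1 else 0)"
      using w K[OF \<mu>] inj_onD[OF \<kappa>_inj _ \<mu> \<nu>] by auto
    finally show "(\<Sum>x\<in>\<xi> ` Z. w (inv_into UNIV \<xi> x) * monomial_at x \<mu>) = (if \<mu> = \<nu> then 1 else 0)" .
  qed
qed

subsection \<open>Growth of the coefficients\<close>

lemma conj_coeff_one:
  "conj_coeff \<xi> w N (\<lambda>x. 1) = (\<lambda>x. if N = length w then prod_list (map (($) \<xi>) w) else 0)"
proof (induction w arbitrary: N)
  case (Cons i w)
  show ?case unfolding conj_coeff.simps Cons.IH by (cases N) (simp_all add: partial_eq_dd fun_eq_iff)
qed (simp add: fun_eq_iff)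

text \<open>In the top power of \<lambda> every derivative falls on the exponential, so
  \<open>h\<close> is merely multiplied. This is what cancels the undifferentiated potential in
  \<open>Lead_coeff\<close>.\<close>

lemma conj_coeff_top:
  "conj_coeff \<xi> w (length w) h = (\<lambda>x. prod_list (map (($) \<xi>) w) * h x)"
proof (induction w)
  case (Cons i w)
  have "conj_coeff \<xi> w (Suc (length w)) h = (\<lambda>x. 0)" by (rule conj_coeff_vanish) simp
  then show ?case using Cons by (simp add: partial_eq_dd mult.assoc)
qed simp

lemma op_conj_one:
  assumes "finite (op_support U a)"
  shows "op_conj U a \<xi> N (\<lambda>x. 1) x
    = (\<Sum>\<nu> | \<nu> \<in> op_support U a \<and> multi_degree \<nu> = N. a \<nu> x * monomial_at \<xi> \<nu>)"
proof -
  have "op_conj U a \<xi> N (\<lambda>x. 1) x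
     = (\<Sum>\<nu>\<in>op_support U a. if multi_degree \<nu> = N then a \<nu> x * monomial_at \<xi> \<nu> else 0)"
    unfolding op_conj_def conj_coeff_one length_word prod_list_word by (auto intro: sum.cong)
  also have "\<dots> = (\<Sum>\<nu> | \<nu> \<in> op_support U a \<and> multi_degree \<nu> = N. a \<nu> x * monomial_at \<xi> \<nu>)"
    using assms by (subst sum.inter_filter[symmetric]) auto
  finally show ?thesis .
qed

context mirror_point begin

text \<open>Integration works only along directions transversal to the mirror, so the symbol is
  controlled only at such \<xi>. \<open>multi_coeff_weights\<close> recovers each coefficient from
  finitely many of these values.\<close>

lemma Lead_extract:
  assumes V: "finite V" and \<nu>: "\<nu> \<in> V"
    and L: "\<And>\<xi>. ah \<bullet> \<xi> \<noteq> 0 \<Longrightarrow> Lead s (\<lambda>x. \<Sum>\<mu>\<in>V. a \<mu> x * monomial_at \<xi> \<mu>)"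
  shows "Lead s (a \<nu>)"
proof -
  have "ah \<noteq> 0" using unit by auto
  from multi_coeff_weights[OF V this \<nu>] obtain Z w where Z: "finite Z" "\<forall>\<xi>\<in>Z. ah \<bullet> \<xi> \<noteq> 0"
    "\<forall>\<mu>\<in>V. (\<Sum>\<xi>\<in>Z. w \<xi> * monomial_at \<xi> \<mu>) = (if \<mu> = \<nu> then 1 else 0)" by blast
  have "Lead s (\<lambda>x. \<Sum>\<xi>\<in>Z. w \<xi> * (\<Sum>\<mu>\<in>V. a \<mu> x * monomial_at \<xi> \<mu>))"
    using Z(2) by (intro Lead_sum Lead_cmult L) auto
  then show ?thesis
  proof (rule Lead_cong)
    fix x
    have "(\<Sum>\<xi>\<in>Z. w \<xi> * (\<Sum>\<mu>\<in>V. a \<mu> x * monomial_at \<xi> \<mu>))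
       = (\<Sum>\<mu>\<in>V. a \<mu> x * (\<Sum>\<xi>\<in>Z. w \<xi> * monomial_at \<xi> \<mu>))"
      unfolding sum_distrib_left by (subst sum.swap) (simp add: mult_ac)
    also have "\<dots> = (\<Sum>\<mu>\<in>V. if \<mu> = \<nu> then a \<mu> x else 0)"
      by (rule sum.cong) (use Z(3) in auto)
    also have "\<dots> = a \<nu> x" using V \<nu> by simp
    finally show "(\<Sum>\<xi>\<in>Z. w \<xi> * (\<Sum>\<mu>\<in>V. a \<mu> x * monomial_at \<xi> \<mu>)) = a \<nu> x" .
  qed
qed

text \<open>In the coefficient of \<lambda>^N, N letters of the word fall on the exponential and the
  others differentiate \<open>h\<close>, each raising the order by 1.\<close>

lemma Lead_conj_coeff:
  "Lead s h \<Longrightarrow> Lead (s + real (length w) - real N) (conj_coeff \<xi> w N h)"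
proof (induction w arbitrary: N)
  case Nil
  then show ?case by (cases "N = 0") (simp_all add: Lead_zero)
next
  case (Cons i w)
  have "Lead (s + real (length w) - real N + 1) (partial i (conj_coeff \<xi> w N h))"
    unfolding partial_eq_dd by (rule Lead_dd[OF Cons.IH[OF Cons.prems]])
  moreover have "Lead (s + real (length w) - real N + 1)
     (\<lambda>x. case N of 0 \<Rightarrow> 0 | Suc M \<Rightarrow> \<xi> $ i * conj_coeff \<xi> w M h x)"
    using Cons.IH[OF Cons.prems] by (cases N) (simp_all add: Lead_zero Lead_cmult algebra_simps)
  ultimately show ?case using Lead_add by (simp add: algebra_simps)
qed

lemma S_conj_coeff:
  "S s h \<Longrightarrow> S (s + real (length w) - real N) (conj_coeff \<xi> w N h)"
proof (induction w arbitrary: N)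
  case Nil
  then show ?case by (cases "N = 0") (simp_all add: S_zero)
next
  case (Cons i w)
  have "S (s + real (length w) - real N + 1) (partial i (conj_coeff \<xi> w N h))"
    unfolding partial_eq_dd by (rule S_dd1[OF Cons.IH[OF Cons.prems]])
  moreover have "S (s + real (length w) - real N + 1)
     (\<lambda>x. case N of 0 \<Rightarrow> 0 | Suc M \<Rightarrow> \<xi> $ i * conj_coeff \<xi> w M h x)"
    using Cons.IH[OF Cons.prems] by (cases N) (simp_all add: S_zero S_cmult algebra_simps)
  ultimately show ?case using S_add by (simp add: algebra_simps)
qed

lemma Lead_laplacian_rough: "Lead s f \<Longrightarrow> Lead (s + 2) (laplacian f)"
  unfolding laplacian_def[abs_def] partial_eq_dd
  using Lead_dd[OF Lead_dd] by (intro Lead_sum) (simp add: add.assoc)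

end

text \<open>The local situation at one mirror: a potential with singular part c / t^2 and a
  remainder \<open>v\<close> smooth across \<open>x0\<close>, and an operator whose part of degree
  \<open>m\<close> is constant. Commutation is available only for functions smooth on all of
  \<open>U\<close>, which may reach beyond the half ball.\<close>

locale commuting_operator = mirror_point ah x0 \<rho> for ah x0 :: "real^'n::finite" and \<rho> :: real +
  fixes U :: "(real^'n) set" and a :: "'n coeffs" and u v :: "real^'n \<Rightarrow> real"
    and c :: real and m :: nat and p :: "real^'n \<Rightarrow> real"
  assumes U: "open U" "Om \<subseteq> U" and u_smooth: "smooth_on U u" and a: "diff_op U a"
    and u_eq: "\<And>x. x \<in> Om \<Longrightarrow> u x = c * T (- 2) x + v x" and v: "smooth_on (ball x0 \<rho>) v"
    and deg: "\<And>\<nu>. \<nu> \<in> op_support U a \<Longrightarrow> multi_degree \<nu> \<le> m"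
    and sym: "\<And>x \<xi>. x \<in> U \<Longrightarrow>
      (\<Sum>\<nu> | \<nu> \<in> op_support U a \<and> multi_degree \<nu> = m. a \<nu> x * monomial_at \<xi> \<nu>) = p \<xi>"
    and com: "\<And>f x. smooth_on U f \<Longrightarrow> x \<in> U \<Longrightarrow>
      op_apply U a (\<lambda>y. laplacian f y - u y * f y) x
        = laplacian (op_apply U a f) x - u x * op_apply U a f x"
begin

lemma Om_U: "x \<in> Om \<Longrightarrow> x \<in> U"
  using U by blast

lemma supp: "finite (op_support U a)"
  using a by (simp add: diff_op_def)

lemma S_v: "S 0 v"
  using v by (rule S_regular)

lemma Lead_u: "Lead 2 u"
proof (rule Lead_cong)
  show "Lead 2 (\<lambda>x. c * T (- 2) x + v x)"
    using Lead_T[of "- 2"] S_imp_Lead[OF S_v, of 2] by (intro Lead_add Lead_cmult) auto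
qed (simp add: u_eq)

text \<open>For h = 1, twice the derivative along \<xi> of the part of degree N equals a commutator
  with the potential minus the Laplacian of the part of degree N + 1. By induction both are
  homogeneous to leading order, of order m - N + 1. Integration lowers this to m - N, and N < m
  gives the bound that \<open>Lead_integrate\<close> requires.\<close>

lemma Lead_coeff: "\<nu> \<in> op_support U a \<Longrightarrow> Lead (real m - real (multi_degree \<nu>)) (a \<nu>)"
proof (induction "m - multi_degree \<nu>" arbitrary: \<nu> rule: less_induct)
  case less
  define N where "N = multi_degree \<nu>"
  have N: "N \<le> m" using deg[OF less.prems] by (simp add: N_def)
  let ?V = "{\<nu> \<in> op_support U a. multi_degree \<nu> = N}"
  have one: "op_conj U a \<xi> N (\<lambda>x. 1) = (\<lambda>x. \<Sum>\<nu>\<in>?V. a \<nu> x * monomial_at \<xi> \<nu>)" for \<xi>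
    using op_conj_one[OF supp] by (simp add: fun_eq_iff)
  have L: "Lead (real m - real N) (op_conj U a \<xi> N (\<lambda>x. 1))" if \<xi>: "ah \<bullet> \<xi> \<noteq> 0" for \<xi>
  proof (cases "N = m")
    case True
    have "Lead 0 (op_conj U a \<xi> N (\<lambda>x. 1))"
      by (rule Lead_cong[OF Lead_const[of "p \<xi>"]])
        (use True Om_U sym op_conj_one[OF supp] in simp)
    then show ?thesis using True by simp
  next
    case False
    then have Nm: "N < m" using N by simp
    let ?F = "op_conj U a \<xi>"
    let ?s = "real m - real N + 1"
    have IH: "Lead (real m - real (multi_degree \<mu>)) (a \<mu>)"
      if "\<mu> \<in> op_support U a" "N < multi_degree \<mu>" for \<mu>
      using less.hyps[of \<mu>] that deg[OF that(1)] by (simp add: N_def)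
    have "Lead (real m - real (Suc N)) (?F (Suc N) (\<lambda>x. 1))"
    proof (rule Lead_cong)
      show "Lead (real m - real (Suc N))
          (\<lambda>x. \<Sum>\<mu> | \<mu> \<in> op_support U a \<and> multi_degree \<mu> = Suc N. monomial_at \<xi> \<mu> * a \<mu> x)"
        using IH by (intro Lead_sum Lead_cmult) fastforce
    qed (simp add: op_conj_one[OF supp] mult.commute)
    from Lead_laplacian_rough[OF this] have lap: "Lead ?s (laplacian (?F (Suc N) (\<lambda>x. 1)))"
      by (simp add: algebra_simps)
    \<comment> \<open>The contribution of \<partial>^\<mu> to the commutator with \<open>u\<close>.
      Terms with \<open>u\<close> undifferentiated cancel, so only degrees above N + 1 matter; there
      the orders m - |\<mu>| and 2 + |\<mu>| - (N + 1) add up to m - N + 1.\<close>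
    define R where "R \<mu> x = u x * conj_coeff \<xi> (word \<mu>) (Suc N) (\<lambda>x. 1) x
        - conj_coeff \<xi> (word \<mu>) (Suc N) u x" for \<mu> x
    have R: "Lead ?s (\<lambda>x. a \<mu> x * R \<mu> x)" if \<mu>: "\<mu> \<in> op_support U a" for \<mu>
    proof -
      consider "multi_degree \<mu> < Suc N" | "multi_degree \<mu> = Suc N" | "Suc N < multi_degree \<mu>" by linarith
      then show ?thesis
      proof cases
        case 1
        then have "R \<mu> = (\<lambda>x. 0)"
          by (simp add: R_def[abs_def] conj_coeff_vanish length_word)
        then show ?thesis by (simp add: Lead_zero)
      next
        case 2
        then have e: "Suc N = length (word \<mu>)" by (simp add: length_word)
        have "R \<mu> = (\<lambda>x. 0)"
          unfolding R_def[abs_def] e conj_coeff_top by simp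
        then show ?thesis by (simp add: Lead_zero)
      next
        case 3
        then have R3: "R \<mu> = (\<lambda>x. - 1 * conj_coeff \<xi> (word \<mu>) (Suc N) u x)"
          by (simp add: R_def[abs_def] conj_coeff_one length_word)
        have "Lead (2 + real (multi_degree \<mu>) - real (Suc N)) (R \<mu>)"
          unfolding R3 length_word[symmetric] by (intro Lead_cmult Lead_conj_coeff Lead_u)
        from Lead_mult[OF IH[OF \<mu>] this] 3 show ?thesis by (simp add: algebra_simps)
      qed
    qed
    have "Lead ?s (\<lambda>x. 1 / 2 * ((\<Sum>\<mu>\<in>op_support U a. a \<mu> x * R \<mu> x) - laplacian (?F (Suc N) (\<lambda>x. 1)) x))"
      by (intro Lead_cmult Lead_diff Lead_sum R lap)
    then have G: "Lead ?s (dd \<xi> (?F N (\<lambda>x. 1)))"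
    proof (rule Lead_cong)
      fix x assume x: "x \<in> Om"
      note xU = Om_U[OF x]
      have s1: "smooth_on U (\<lambda>x. 1)" by (rule smooth_on_const[OF U(1)])
      have d1: "dd y (\<lambda>x::real^'n. 1) = (\<lambda>x. 0)" for y by (simp add: fun_eq_iff)
      have z: "(\<lambda>x::real^'n. laplacian (\<lambda>x. 1) x - u x * 1) = (\<lambda>x. 0 + (- 1) * u x)"
        by (simp add: laplacian_def partial_eq_dd d1)
      have z0: "?F M (\<lambda>x. 0) x = 0" for M
        using op_conj_lin[OF U(1) s1 s1 xU, of a \<xi> M "- 1"] by simp
      have F1: "?F (Suc N) (\<lambda>x. laplacian (\<lambda>x. 1) x - u x * 1) x = - ?F (Suc N) u x"
        unfolding z using op_conj_lin[OF U(1) smooth_on_const[OF U(1)] u_smooth xU, of a \<xi> "Suc N" 0 "- 1"]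
        by (simp add: z0)
      have dz: "dd \<xi> (\<lambda>x::real^'n. 1) = (\<lambda>x. 0)" by (simp add: fun_eq_iff)
      have "laplacian (?F (Suc N) (\<lambda>x. 1)) x - u x * ?F (Suc N) (\<lambda>x. 1) x + ?F (Suc N) u x
         + 2 * dd \<xi> (?F N (\<lambda>x. 1)) x = 0"
        using commute_coeff[OF U(1) u_smooth a s1 com xU, of \<xi> "Suc N"]
        unfolding F1 dz by (simp add: z0)
      moreover have "(\<Sum>\<mu>\<in>op_support U a. a \<mu> x * R \<mu> x) = u x * ?F (Suc N) (\<lambda>x. 1) x - ?F (Suc N) u x"
        unfolding op_conj_def R_def
        by (simp add: sum_distrib_left sum_subtractf[symmetric] algebra_simps)
      ultimately show "1 / 2 * ((\<Sum>\<mu>\<in>op_support U a. a \<mu> x * R \<mu> x) - laplacian (?F (Suc N) (\<lambda>x. 1)) x)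
         = dd \<xi> (?F N (\<lambda>x. 1)) x" by simp
    qed
    have "smooth_on Om (?F N (\<lambda>x. 1))"
      by (rule smooth_on_subset[OF op_conj_smooth[OF U(1) a smooth_on_const[OF U(1)]] U(2)])
    then show ?thesis
      by (rule Lead_integrate[OF _ G _ \<xi>]) (use Nm in simp)
  qed
  have "Lead (real m - real N) (a \<nu>)"
  proof (rule Lead_extract[of ?V])
    show "finite ?V" using supp by simp
    show "\<nu> \<in> ?V" using less.prems by (simp add: N_def)
    show "Lead (real m - real N) (\<lambda>x. \<Sum>\<mu>\<in>?V. a \<mu> x * monomial_at \<xi> \<mu>)" if "ah \<bullet> \<xi> \<noteq> 0" for \<xi>
      using L[OF that] unfolding one .
  qed
  then show ?case by (simp add: N_def)
qed

end

subsection \<open>The leading relation\<close>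

text \<open>Test functions must be smooth on the whole regular set, which has points on both sides
  of the mirror. The power of the distance is therefore extended by zero to the other side; the jump
  lies on the mirror, outside the set.\<close>

definition half_powr :: "real^'n::finite \<Rightarrow> real \<Rightarrow> real^'n \<Rightarrow> real" where
  "half_powr \<beta> s x = (if 0 < \<beta> \<bullet> x then (\<beta> \<bullet> x) powr s else 0)"

lemma half_powr_derivative:
  assumes "\<beta> \<bullet> x \<noteq> 0"
  shows "(half_powr \<beta> s has_derivative (\<lambda>v. s * (\<beta> \<bullet> v) * half_powr \<beta> (s - 1) x)) (at x)"
proof (cases "0 < \<beta> \<bullet> x")
  case True
  have "((\<lambda>x. (\<beta> \<bullet> x) powr s) has_derivative (\<lambda>v. s * (\<beta> \<bullet> v) * half_powr \<beta> (s - 1) x)) (at x)"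
    using True by (auto simp: half_powr_def powr_diff intro!: derivative_eq_intros ext)
  then show ?thesis
    by (rule has_derivative_transform_within_open[of _ _ x UNIV "{x. 0 < \<beta> \<bullet> x}"])
      (use True in \<open>auto simp: half_powr_def open_halfspace_gt\<close>)
next
  case False
  have "((\<lambda>x. 0::real) has_derivative (\<lambda>v. s * (\<beta> \<bullet> v) * half_powr \<beta> (s - 1) x)) (at x)"
    using False by (simp add: half_powr_def)
  then show ?thesis
    by (rule has_derivative_transform_within_open[of _ _ x UNIV "{x. \<beta> \<bullet> x < 0}"])
      (use False assms in \<open>auto simp: half_powr_def open_halfspace_lt\<close>)
qed

lemma half_powr_dd: "\<beta> \<bullet> x \<noteq> 0 \<Longrightarrow> dd v (half_powr \<beta> s) x = s * (\<beta> \<bullet> v) * half_powr \<beta> (s - 1) x"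
  by (rule dd_eqI[OF half_powr_derivative])

lemma smooth_half_powr:
  assumes "open U" "\<And>x. x \<in> U \<Longrightarrow> \<beta> \<bullet> x \<noteq> 0"
  shows "smooth_on U (half_powr \<beta> s)"
proof (rule smooth_on_coinduct[where P = "\<lambda>f. \<exists>c s. f = (\<lambda>x. c * half_powr \<beta> s x)", OF assms(1)])
  show "\<exists>c s'. half_powr \<beta> s = (\<lambda>x. c * half_powr \<beta> s' x)" by (intro exI[of _ 1] exI[of _ s]) simp
  have diff: "half_powr \<beta> s differentiable (at x)" if "x \<in> U" for s x
    using half_powr_derivative[OF assms(2)[OF that]] by (rule differentiableI)
  show "f differentiable (at x)" if "\<exists>c s. f = (\<lambda>x. c * half_powr \<beta> s x)" "x \<in> U" for f x
    using diff that by auto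
  fix f i assume "\<exists>c s. f = (\<lambda>x. c * half_powr \<beta> s x)"
  then obtain c s where f: "f = (\<lambda>x. c * half_powr \<beta> s x)" by blast
  show "\<exists>g. (\<exists>c s. g = (\<lambda>x. c * half_powr \<beta> s x)) \<and> (\<forall>x\<in>U. partial i f x = g x)"
    by (intro exI[of _ "\<lambda>x. (c * (s * (\<beta> \<bullet> axis i 1))) * half_powr \<beta> (s - 1) x"] conjI exI[of _ "s - 1"]
        exI[of _ "c * (s * (\<beta> \<bullet> axis i 1))"] refl)
      (simp add: f partial_eq_dd dd_cmult[OF diff] half_powr_dd assms(2))
qed

lemma laplacian_half_powr:
  assumes "open U" "x \<in> U" "\<And>x. x \<in> U \<Longrightarrow> \<beta> \<bullet> x \<noteq> 0"
  shows "laplacian (half_powr \<beta> s) x = s * (s - 1) * (\<beta> \<bullet> \<beta>) * half_powr \<beta> (s - 2) x"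
proof -
  have eq: "partial i (partial i (half_powr \<beta> s)) x = s * (s - 1) * half_powr \<beta> (s - 2) x * (\<beta> $ i)\<^sup>2" for i
  proof -
    have "partial i (partial i (half_powr \<beta> s)) x
       = dd (axis i 1) (\<lambda>x. (s * (\<beta> \<bullet> axis i 1)) * half_powr \<beta> (s - 1) x) x"
      unfolding partial_eq_dd by (rule dd_cong[OF assms(1,2)]) (simp add: half_powr_dd assms(3))
    also have "\<dots> = s * (\<beta> \<bullet> axis i 1) * ((s - 1) * (\<beta> \<bullet> axis i 1) * half_powr \<beta> (s - 1 - 1) x)"
      using differentiableI[OF half_powr_derivative[OF assms(3)[OF assms(2)]]]
      by (simp add: dd_cmult half_powr_dd assms(2,3))
    finally show ?thesis by (simp add: inner_axis power2_eq_square mult_ac)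
  qed
  then show ?thesis
    unfolding laplacian_def eq sum_distrib_left[symmetric]
    by (simp add: inner_vec_def power2_eq_square)
qed

section \<open>Locality, and the action on powers of the distance\<close>

lemma conj_coeff_cong:
  assumes "open U" "\<And>x. x \<in> U \<Longrightarrow> h x = g x"
  shows "x \<in> U \<Longrightarrow> conj_coeff \<xi> w N h x = conj_coeff \<xi> w N g x"
proof (induction w arbitrary: N x)
  case (Cons i w)
  have "partial i (conj_coeff \<xi> w N h) x = partial i (conj_coeff \<xi> w N g) x"
    unfolding partial_eq_dd by (rule dd_cong[OF assms(1) Cons.prems Cons.IH])
  then show ?case by (cases N) (simp_all only: conj_coeff.simps nat.case Cons.IH[OF Cons.prems])
qed (simp add: assms)

lemma op_conj_cong:
  assumes "open V" "x \<in> V" "\<And>x. x \<in> V \<Longrightarrow> h x = g x"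
  shows "op_conj U a \<xi> N h x = op_conj U a \<xi> N g x"
  unfolding op_conj_def by (simp only: conj_coeff_cong[OF assms(1,3,2)])

lemma op_conj_lin_local:
  assumes "open V" "smooth_on V h" "smooth_on V g" "x \<in> V"
  shows "op_conj U a \<xi> N (\<lambda>x. h x + c * g x) x = op_conj U a \<xi> N h x + c * op_conj U a \<xi> N g x"
  unfolding op_conj_def
  by (simp add: conj_coeff_lin[OF assms] distrib_left sum.distrib sum_distrib_left mult_ac)

text \<open>The falling factorial s (s - 1) ... (s - q + 1), the factor that \<open>q\<close> normal
  derivatives of t^s produce.\<close>

definition ff_poly :: "nat \<Rightarrow> real poly" where
  "ff_poly q = (\<Prod>j<q. [:- real j, 1:])"

lemma ff_poly_Suc: "poly (ff_poly (Suc q)) s = poly (ff_poly q) s * (s - real q)"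
  by (simp add: ff_poly_def algebra_simps)

lemma degree_ff_poly: "degree (ff_poly q) = q"
  unfolding ff_poly_def by (subst degree_prod_eq_sum_degree) auto

lemma coeff_ff_poly: "coeff (ff_poly q) q = 1"
proof -
  have "lead_coeff (ff_poly q) = (\<Prod>j<q. lead_coeff [:- real j, 1:])"
    unfolding ff_poly_def by (rule lead_coeff_prod)
  then show ?thesis by (simp add: degree_ff_poly)
qed

text \<open>The monomial of the word on the line \<tau> h + \<eta>, as a polynomial in \<tau>. Its
  coefficient of \<tau>^q sums over the ways to take the component of \<open>h\<close> at q letters
  and that of \<eta> at the others.\<close>

definition word_poly :: "real^'n::finite \<Rightarrow> real^'n \<Rightarrow> 'n list \<Rightarrow> real poly" where
  "word_poly \<eta> h w = prod_list (map (\<lambda>i. [:\<eta> $ i, h $ i:]) w)"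

lemma degree_word_poly: "degree (word_poly \<eta> h w) \<le> length w"
proof (induction w)
  case (Cons i w)
  have "degree (word_poly \<eta> h (i # w)) \<le> degree [:\<eta> $ i, h $ i:] + degree (word_poly \<eta> h w)"
    unfolding word_poly_def list.map prod_list.Cons by (rule degree_mult_le)
  moreover have "degree [:\<eta> $ i, h $ i:] \<le> 1" by simp
  ultimately show ?case using Cons by simp
qed (simp add: word_poly_def)

lemma poly_word_poly: "poly (word_poly \<eta> h (word \<nu>)) \<tau> = monomial_at (\<tau> *\<^sub>R h + \<eta>) \<nu>"
proof -
  have "poly (word_poly \<eta> h w) \<tau> = prod_list (map (\<lambda>i. (\<tau> *\<^sub>R h + \<eta>) $ i) w)" for w
    by (induction w) (auto simp: word_poly_def algebra_simps)
  then show ?thesis using prod_list_word by metis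
qed

text \<open>N letters fall on the exponential, each with a component of \<eta>, and q differentiate
  the power, each with a component of \<open>ah\<close>. The falling factorial depends only on q, so
  the sum over all choices is a coefficient of \<open>word_poly\<close>.\<close>

lemma (in mirror_point) conj_coeff_T:
  "length w = N + q \<Longrightarrow> x \<in> Om \<Longrightarrow>
    conj_coeff \<eta> w N (T s) x = coeff (word_poly \<eta> ah w) q * poly (ff_poly q) s * T (s - real q) x"
proof (induction w arbitrary: N q x)
  case Nil
  then show ?case by (simp add: word_poly_def ff_poly_def)
next
  case (Cons i w)
  note x = Cons.prems(2)
  have 1: "partial i (conj_coeff \<eta> w N (T s)) x
    = (case q of 0 \<Rightarrow> 0 | Suc q' \<Rightarrow> ah $ i * coeff (word_poly \<eta> ah w) q') * poly (ff_poly q) s * T (s - real q) x"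
  proof (cases q)
    case 0
    then show ?thesis using Cons.prems by (simp add: conj_coeff_vanish partial_eq_dd)
  next
    case (Suc q')
    let ?C = "coeff (word_poly \<eta> ah w) q' * poly (ff_poly q') s"
    have "partial i (conj_coeff \<eta> w N (T s)) x = dd (axis i 1) (\<lambda>x. ?C * T (s - real q') x) x"
      unfolding partial_eq_dd by (rule dd_cong[OF open_Om x Cons.IH]) (use Cons.prems Suc in auto)
    also have "\<dots> = ?C * ((s - real q') * (ah \<bullet> axis i 1) * T (s - real q' - 1) x)"
      using x by (simp add: dd_cmult smooth_on_differentiable[OF smooth_T] dd_T)
    finally show ?thesis
      using Suc by (simp add: ff_poly_Suc inner_axis diff_diff_eq add.commute[of _ 1])
  qed
  have 2: "(case N of 0 \<Rightarrow> 0 | Suc M \<Rightarrow> \<eta> $ i * conj_coeff \<eta> w M (T s) x)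
    = \<eta> $ i * coeff (word_poly \<eta> ah w) q * poly (ff_poly q) s * T (s - real q) x"
  proof (cases N)
    case 0
    then have "degree (word_poly \<eta> ah w) < q"
      using Cons.prems degree_word_poly[of \<eta> ah w] by simp
    then show ?thesis using 0 by (simp add: coeff_eq_0)
  next
    case (Suc M)
    then show ?thesis using Cons.IH[of M q, OF _ x] Cons.prems by simp
  qed
  have 3: "coeff (word_poly \<eta> ah (i # w)) q
    = \<eta> $ i * coeff (word_poly \<eta> ah w) q + (case q of 0 \<Rightarrow> 0 | Suc q' \<Rightarrow> ah $ i * coeff (word_poly \<eta> ah w) q')"
    by (cases q) (simp_all add: word_poly_def)
  show ?case unfolding conj_coeff.simps 1 2 3 by (simp add: algebra_simps)
qed

lemma weights_poly:
  assumes w: "\<And>j. j \<le> K \<Longrightarrow> (\<Sum>z\<in>Z. w z * z ^ j) = (if j = K then 1 else (0::real))"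
    and deg: "degree p \<le> K"
  shows "(\<Sum>z\<in>Z. w z * poly p z) = coeff p K"
proof -
  have "(\<Sum>z\<in>Z. w z * poly p z) = (\<Sum>z\<in>Z. \<Sum>j\<le>K. coeff p j * (w z * z ^ j))"
  proof (rule sum.cong[OF refl])
    fix z
    have "poly p z = (\<Sum>j\<le>K. coeff p j * z ^ j)"
      unfolding poly_altdef by (rule sum.mono_neutral_left) (use deg in \<open>auto simp: coeff_eq_0\<close>)
    then show "w z * poly p z = (\<Sum>j\<le>K. coeff p j * (w z * z ^ j))"
      by (simp add: sum_distrib_left mult_ac)
  qed
  also have "\<dots> = (\<Sum>j\<le>K. coeff p j * (\<Sum>z\<in>Z. w z * z ^ j))"
    by (subst sum.swap) (simp add: sum_distrib_left)
  also have "\<dots> = (\<Sum>j\<le>K. if j = K then coeff p j else 0)"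
    by (rule sum.cong) (auto simp: w)
  also have "\<dots> = coeff p K" by simp
  finally show ?thesis .
qed

context commuting_operator begin

lemma Lead_op_conj:
  assumes "Lead s h"
  shows "Lead (real m - real N + s) (op_conj U a \<eta> N h)"
  unfolding op_conj_def[abs_def]
proof (rule Lead_sum)
  fix \<nu> assume "\<nu> \<in> op_support U a"
  from Lead_mult[OF Lead_coeff[OF this] Lead_conj_coeff[OF assms, of "word \<nu>" N \<eta>]]
  show "Lead (real m - real N + s) (\<lambda>x. a \<nu> x * conj_coeff \<eta> (word \<nu>) N h x)"
    by (simp add: length_word algebra_simps)
qed

lemma S_op_conj:
  assumes "S s h"
  shows "S (real m - real N + s) (op_conj U a \<eta> N h)"
  unfolding op_conj_def[abs_def]
proof (rule S_sum)
  fix \<nu> assume "\<nu> \<in> op_support U a"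
  from S_mult[OF Lead_S[OF Lead_coeff[OF this]] S_conj_coeff[OF assms, of "word \<nu>" N \<eta>]]
  show "S (real m - real N + s) (\<lambda>x. a \<nu> x * conj_coeff \<eta> (word \<nu>) N h x)"
    by (simp add: length_word algebra_simps)
qed

text \<open>The indicial polynomial at the mirror: the Laplacian minus c / t^2 maps t^s to g(s) t^(s
  - 2).\<close>

definition g where "g s = s * (s - 1) - c"

text \<open>To leading order \<Phi> s is homogeneous of degree s - r, so the singular Hamiltonian
  multiplies it by g(s - r) / t^2; applied first, to t^s, it gives g(s) and lowers s by 2. The
  remaining terms \<open>E0\<close> to \<open>E3\<close> are smaller by a factor t^(1/2).\<close>

lemma leading_relation:
  assumes reg: "\<And>x. x \<in> U \<Longrightarrow> ah \<bullet> x \<noteq> 0" and \<eta>: "ah \<bullet> \<eta> = 0" and r: "r \<le> m"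
  defines "\<Phi> s \<equiv> op_conj U a \<eta> (m - r) (T s)"
  shows "((\<lambda>x. g (s - real r) * (T (real r - s) x * \<Phi> s x)
           - g s * (T (real r - (s - 2)) x * \<Phi> (s - 2) x)) \<longlongrightarrow> 0) F"
proof -
  define N where "N = m - r"
  have mN: "real m - real N = real r" using r by (simp add: N_def of_nat_diff)
  let ?F = "op_conj U a \<eta>"
  let ?h = "half_powr ah s"
  let ?\<sigma> = "real r - s"
  have \<Phi>: "\<Phi> s = ?F N (T s)" for s by (simp add: \<Phi>_def N_def)
  have hT: "half_powr ah s x = T s x" if "x \<in> Om" for s x
    using that by (simp add: half_powr_def T_def Om_def)
  have L: "Lead ?\<sigma> (\<Phi> s)"
    using Lead_op_conj[OF Lead_T, of N s \<eta>] by (simp add: \<Phi> mN)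
  define E0 where "E0 x = laplacian (\<Phi> s) x - ?\<sigma> * (?\<sigma> + 1) * (T (- 2) x * \<Phi> s x)" for x
  have E0: "S (?\<sigma> + 2 - 1/2) E0" unfolding E0_def[abs_def] by (rule Lead_laplacian[OF L])
  define E1 where "E1 x = v x * \<Phi> s x" for x
  have E1: "S (?\<sigma> + 2 - 1/2) E1"
    unfolding E1_def[abs_def] by (rule S_mono[OF S_mult[OF S_v Lead_S[OF L]]]) simp
  define E2 where "E2 = ?F N (\<lambda>x. v x * T s x)"
  have E2: "S (?\<sigma> + 2 - 1/2) E2"
    unfolding E2_def
    by (rule S_mono[OF S_op_conj[OF S_mult[OF S_v S_T]]]) (simp add: mN)
  \<comment> \<open>Passing from degree N to N - 1 raises the order by 1, and the derivative along
    the tangential \<eta> adds nothing, so this stays below the leading order \<sigma> + 2.\<close>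
  define E3 where "E3 x = (case N of 0 \<Rightarrow> 0 | Suc n \<Rightarrow> 2 * dd \<eta> (?F n (T s)) x)" for x
  have E3: "S (?\<sigma> + 2 - 1/2) E3"
  proof (cases N)
    case 0
    then show ?thesis by (simp add: E3_def[abs_def] S_zero)
  next
    case (Suc n)
    have "S (real m - real n - s) (?F n (T s))"
      using Lead_S[OF Lead_op_conj[OF Lead_T, of n s \<eta>]] by simp
    then have "S (real m - real n - s) (\<lambda>x. 2 * dd \<eta> (?F n (T s)) x)"
      by (intro S_cmult S_dd0 \<eta>)
    then show ?thesis unfolding E3_def[abs_def] Suc nat.case
      by (rule S_mono) (use mN Suc in simp)
  qed
  define E where "E x = (g (s - real r) * (T (- 2) x * \<Phi> s x) - g s * \<Phi> (s - 2) x)" for x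
  have E: "E x = - E0 x + E1 x - E2 x - E3 x" if x: "x \<in> Om" for x
  proof -
    note xU = Om_U[OF x]
    have h: "smooth_on U ?h" by (rule smooth_half_powr[OF U(1) reg])
    have c1: "?F M (half_powr ah s) y = ?F M (T s) y" if "y \<in> Om" for M y
      by (rule op_conj_cong[OF open_Om that hT])
    have lap: "laplacian (?F N ?h) x = laplacian (\<Phi> s) x"
      unfolding \<Phi> by (rule laplacian_cong[OF open_Om x c1])
    have "?F N (\<lambda>x. laplacian ?h x - u x * ?h x) x
       = ?F N (\<lambda>x. (g s * T (s - 2) x) + (- 1) * (v x * T s x)) x"
    proof (rule op_conj_cong[OF open_Om x])
      fix y assume y: "y \<in> Om"
      have T2: "T s y = T 2 y * T (s - 2) y" "T (- 2) y * T 2 y = 1"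
        using y by (simp_all add: T_add[symmetric]) (simp add: T_def Om_def)
      have "T (- 2) y * T s y = T (s - 2) y"
        using T2 by (simp add: mult.assoc[symmetric])
      moreover have "laplacian ?h y = s * (s - 1) * (ah \<bullet> ah) * half_powr ah (s - 2) y"
        by (rule laplacian_half_powr[OF U(1) Om_U[OF y]]) (rule reg)
      ultimately show "laplacian ?h y - u y * ?h y = g s * T (s - 2) y + - 1 * (v y * T s y)"
        unfolding u_eq[OF y] unit hT[OF y]
        by (simp add: g_def algebra_simps)
    qed
    also have "\<dots> = ?F N (\<lambda>x. g s * T (s - 2) x) x + (- 1) * E2 x"
      unfolding E2_def
      by (rule op_conj_lin_local[OF open_Om _ _ x])
        (intro smooth_on_cmult smooth_T open_Om S_smooth[OF S_mult[OF S_v S_T]])+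
    also have "?F N (\<lambda>x. g s * T (s - 2) x) x = g s * \<Phi> (s - 2) x"
      using op_conj_lin_local[OF open_Om smooth_on_const[OF open_Om] smooth_T x, of U a \<eta> N 0 "g s" "s - 2"]
        op_conj_lin_local[OF open_Om smooth_on_const[OF open_Om] smooth_on_const[OF open_Om] x, of U a \<eta> N 0 1 0]
      by (simp add: \<Phi>)
    finally have F0: "?F N (\<lambda>x. laplacian ?h x - u x * ?h x) x = g s * \<Phi> (s - 2) x - E2 x" by simp
    have F3: "(case N of 0 \<Rightarrow> 0 | Suc n \<Rightarrow> 2 * dd \<eta> (?F n ?h) x - 2 * ?F n (dd \<eta> ?h) x) = E3 x"
    proof (cases N)
      case (Suc n)
      \<comment> \<open>\<eta> is tangent to the mirror, so the power of the distance is constant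
        along it.\<close>
      have "?F n (dd \<eta> ?h) x = ?F n (\<lambda>x. 0) x"
        by (rule op_conj_cong[OF U(1) xU]) (simp add: half_powr_dd reg \<eta>)
      also have "\<dots> = 0"
        using op_conj_lin[OF U(1) smooth_on_const[OF U(1)] smooth_on_const[OF U(1)] xU, of a \<eta> n 0 1 0]
        by simp
      finally show ?thesis
        using dd_cong[OF open_Om x c1] Suc by (simp add: E3_def)
    qed (simp add: E3_def)
    show ?thesis
      using commute_coeff[OF U(1) u_smooth a h com xU, of \<eta> N]
      unfolding F0 F3 lap c1[OF x]
      by (simp add: E_def E0_def E1_def u_eq[OF x] \<Phi> g_def algebra_simps)
  qed
  have "S (?\<sigma> + 2 - 1/2) (\<lambda>x. - 1 * E0 x + E1 x - E2 x - E3 x)"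
    by (intro S_diff S_add S_cmult E0 E1 E2 E3)
  then have "S (?\<sigma> + 2 - 1/2) E"
    by (rule S_cong) (simp add: E)
  from landau_o.big_mult[OF landau_o.big_refl S_bigo[OF this], of "T (?\<sigma> + 2)"]
  have "(\<lambda>x. T (?\<sigma> + 2) x * E x) \<in> O[F](T (1/2))"
    by (simp add: T_add[symmetric])
  then obtain C where C: "eventually (\<lambda>x. norm (T (?\<sigma> + 2) x * E x) \<le> C * norm (T (1/2) x)) F"
    using landau_o.bigE by blast
  have "((\<lambda>x. T (1/2) x) \<longlongrightarrow> 0) F"
    unfolding T_def
    by (rule tendsto_zero_powrI[OF tendsto_F tendsto_const eventually_mono[OF eventually_F_small[of 1]]]) auto
  then have "((\<lambda>x. C * norm (T (1/2) x)) \<longlongrightarrow> 0) F"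
    by (auto intro!: tendsto_eq_intros)
  from Lim_null_comparison[OF C this]
  have "((\<lambda>x. T (?\<sigma> + 2) x * E x) \<longlongrightarrow> 0) F" .
  moreover have "T (?\<sigma> + 2) x * E x = g (s - real r) * (T (real r - s) x * \<Phi> s x)
      - g s * (T (real r - (s - 2)) x * \<Phi> (s - 2) x)" if "x \<in> Om" for x
  proof -
    have "T (?\<sigma> + 2) x * T (- 2) x = T ?\<sigma> x" by (simp add: T_add[symmetric])
    moreover have "real r - (s - 2) = ?\<sigma> + 2" by simp
    ultimately show ?thesis
      unfolding E_def by (simp only: right_diff_distrib mult_ac)
  qed
  ultimately show ?thesis
    by (rule Lim_transform_eventually[OF _ eventually_mono[OF eventually_Om]])
qed

text \<open>For fixed \<open>x\<close> the function \<open>e s x\<close> is a polynomial in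
  \<open>s\<close> of degree at most r, whose coefficient of s^r involves only multi-indices of
  degree m. It tends to 0 at r + 1 values of \<open>s\<close>, hence so does this
  coefficient.\<close>

lemma symbol_coeff_odd:
  assumes reg: "\<And>x. x \<in> U \<Longrightarrow> ah \<bullet> x \<noteq> 0" and \<eta>: "ah \<bullet> \<eta> = 0" and r: "r \<le> m" "odd r"
    and c: "c = \<kappa> * (\<kappa> + 1)" and \<kappa>: "\<kappa> \<notin> \<int>"
  shows "((\<lambda>x. \<Sum>\<nu> | \<nu> \<in> op_support U a \<and> multi_degree \<nu> = m.
      a \<nu> x * coeff (word_poly \<eta> ah (word \<nu>)) r) \<longlongrightarrow> 0) F"
proof -
  define N where "N = m - r"
  have N: "N + r = m" using r by (simp add: N_def)
  define e where "e s x = T (real r - s) x * op_conj U a \<eta> N (T s) x" for s x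
  have gnz: "g (\<kappa> + 1 + 2 * real i - real r) \<noteq> 0" for i
  proof
    assume *: "g (\<kappa> + 1 + 2 * real i - real r) = 0"
    define d where "d = 2 * int i - int r"
    have d: "odd d" using r(2) by (simp add: d_def)
    have "g (\<kappa> + 1 + 2 * real i - real r) = real_of_int d * (2 * \<kappa> + 1 + real_of_int d)"
      unfolding g_def unfolding c d_def by (simp add: algebra_simps)
    then have "2 * \<kappa> + 1 + real_of_int d = 0" using * d by auto
    moreover obtain b where "d = 2 * b + 1" using d oddE by blast
    ultimately have "\<kappa> = real_of_int (- 1 - b)" by simp
    then show False using \<kappa> by (metis Ints_of_int)
  qed
  have rel: "((\<lambda>x. g (s - real r) * e s x - g s * e (s - 2) x) \<longlongrightarrow> 0) F" for s
    using leading_relation[OF reg \<eta> r(1), of s] by (simp add: e_def N_def)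
  have e0: "((\<lambda>x. e (\<kappa> + 1 + 2 * real i) x) \<longlongrightarrow> 0) F" for i
  proof (induction i)
    case 0
    have "g (\<kappa> + 1) = 0" unfolding g_def unfolding c by (simp add: algebra_simps)
    then have "((\<lambda>x. g (\<kappa> + 1 - real r) * e (\<kappa> + 1) x) \<longlongrightarrow> 0) F"
      using rel[of "\<kappa> + 1"] by simp
    from tendsto_mult_left[OF this, of "1 / g (\<kappa> + 1 - real r)"] show ?case
      using gnz[of 0] by simp
  next
    case (Suc i)
    let ?s = "\<kappa> + 1 + 2 * real (Suc i)"
    have s2: "?s - 2 = \<kappa> + 1 + 2 * real i" by simp
    have "((\<lambda>x. g (?s - real r) * e ?s x - g ?s * e (?s - 2) x + g ?s * e (?s - 2) x) \<longlongrightarrow> 0 + g ?s * 0) F"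
      by (intro tendsto_add tendsto_mult_left rel) (unfold s2, rule Suc)
    then have "((\<lambda>x. g (?s - real r) * e ?s x) \<longlongrightarrow> 0) F" by simp
    from tendsto_mult_left[OF this, of "1 / g (?s - real r)"] show ?case
      using gnz[of "Suc i"] by simp
  qed
  define Z where "Z = (\<lambda>i. \<kappa> + 1 + 2 * real i) ` {..r}"
  have Z: "finite Z" "r < card Z"
    unfolding Z_def by (simp, subst card_image) (auto simp: inj_on_def)
  from coeff_weights[OF Z order_refl] obtain w where
    w: "\<forall>j\<le>r. (\<Sum>z\<in>Z. w z * z ^ j) = (if j = r then 1 else 0)" by blast
  have "((\<lambda>x. \<Sum>z\<in>Z. w z * e z x) \<longlongrightarrow> (\<Sum>z\<in>Z. w z * 0)) F"
    by (intro tendsto_sum tendsto_mult_left) (auto simp: Z_def intro: e0)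
  then have "((\<lambda>x. \<Sum>z\<in>Z. w z * e z x) \<longlongrightarrow> 0) F" by simp
  moreover have "(\<Sum>z\<in>Z. w z * e z x) = (\<Sum>\<nu> | \<nu> \<in> op_support U a \<and> multi_degree \<nu> = m.
      a \<nu> x * coeff (word_poly \<eta> ah (word \<nu>)) r)" if x: "x \<in> Om" for x
  proof -
    have tpos: "0 < ah \<bullet> x" using x by (simp add: Om_def)
    \<comment> \<open>The factor of the falling factorial of degree |\<nu>| - N in
      \<open>e z x\<close>. Only |\<nu>| = m gives degree r, and there the power of the distance has
      exponent 0.\<close>
    define b where "b \<nu> = (if N \<le> multi_degree \<nu>
      then T (real r - real (multi_degree \<nu> - N)) x * a \<nu> x * coeff (word_poly \<eta> ah (word \<nu>)) (multi_degree \<nu> - N)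
      else 0)" for \<nu>
    have ez: "e z x = (\<Sum>\<nu>\<in>op_support U a. b \<nu> * poly (ff_poly (multi_degree \<nu> - N)) z)" for z
      unfolding e_def op_conj_def sum_distrib_left
    proof (rule sum.cong[OF refl])
      fix \<nu>
      show "T (real r - z) x * (a \<nu> x * conj_coeff \<eta> (word \<nu>) N (T z) x)
         = b \<nu> * poly (ff_poly (multi_degree \<nu> - N)) z"
      proof (cases "N \<le> multi_degree \<nu>")
        case True
        define q where "q = multi_degree \<nu> - N"
        have "conj_coeff \<eta> (word \<nu>) N (T z) x
           = coeff (word_poly \<eta> ah (word \<nu>)) q * poly (ff_poly q) z * T (z - real q) x"
          by (rule conj_coeff_T[OF _ x]) (use True in \<open>simp add: length_word q_def\<close>)
        moreover have "T (real r - z) x * T (z - real q) x = T (real r - real q) x"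
          by (simp add: T_add[symmetric])
        ultimately show ?thesis using True unfolding b_def q_def[symmetric] by (simp add: mult_ac)
      next
        case False
        then show ?thesis by (simp add: b_def conj_coeff_vanish length_word)
      qed
    qed
    have "(\<Sum>z\<in>Z. w z * e z x)
       = (\<Sum>\<nu>\<in>op_support U a. b \<nu> * (\<Sum>z\<in>Z. w z * poly (ff_poly (multi_degree \<nu> - N)) z))"
      unfolding ez sum_distrib_left by (subst sum.swap) (simp add: mult_ac)
    also have "\<dots> = (\<Sum>\<nu>\<in>op_support U a. if multi_degree \<nu> = m
        then a \<nu> x * coeff (word_poly \<eta> ah (word \<nu>)) r else 0)"
    proof (rule sum.cong[OF refl])
      fix \<nu> assume \<nu>: "\<nu> \<in> op_support U a"
      have q: "multi_degree \<nu> - N \<le> r" using deg[OF \<nu>] N by simp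
      have wp: "(\<Sum>z\<in>Z. w z * poly (ff_poly (multi_degree \<nu> - N)) z) = coeff (ff_poly (multi_degree \<nu> - N)) r"
        by (rule weights_poly) (use w q in \<open>auto simp: degree_ff_poly\<close>)
      show "b \<nu> * (\<Sum>z\<in>Z. w z * poly (ff_poly (multi_degree \<nu> - N)) z)
        = (if multi_degree \<nu> = m then a \<nu> x * coeff (word_poly \<eta> ah (word \<nu>)) r else 0)"
      proof (cases "multi_degree \<nu> = m")
        case True
        then have "multi_degree \<nu> - N = r" "N \<le> multi_degree \<nu>" using N by auto
        then show ?thesis unfolding wp using True tpos by (simp add: b_def coeff_ff_poly T_def)
      next
        case False
        \<comment> \<open>Truncated subtraction may give 0 here; r is odd and hence
          positive.\<close>
        then have "multi_degree \<nu> - N < r" using deg[OF \<nu>] N r by (cases r) auto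
        then show ?thesis unfolding wp using False by (simp add: coeff_eq_0 degree_ff_poly)
      qed
    qed
    also have "\<dots> = (\<Sum>\<nu> | \<nu> \<in> op_support U a \<and> multi_degree \<nu> = m.
      a \<nu> x * coeff (word_poly \<eta> ah (word \<nu>)) r)"
      using supp by (subst sum.inter_filter[symmetric]) auto
    finally show ?thesis .
  qed
  ultimately show ?thesis
    by (rule Lim_transform_eventually[OF _ eventually_mono[OF eventually_Om]])
qed

text \<open>The polynomial \<open>Q x\<close> in \<tau> is the same for all \<open>x\<close> in the
  half ball, being determined by its values, which are those of the constant symbol. A constant
  coefficient that tends to 0 at the mirror is 0.\<close>

theorem symbol_even:
  assumes reg: "\<And>x. x \<in> U \<Longrightarrow> ah \<bullet> x \<noteq> 0" and \<eta>: "ah \<bullet> \<eta> = 0"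
    and c: "c = \<kappa> * (\<kappa> + 1)" and \<kappa>: "\<kappa> \<notin> \<int>"
  shows "p ((- \<tau>) *\<^sub>R ah + \<eta>) = p (\<tau> *\<^sub>R ah + \<eta>)"
proof -
  let ?V = "{\<nu>. \<nu> \<in> op_support U a \<and> multi_degree \<nu> = m}"
  define Q where "Q x = (\<Sum>\<nu>\<in>?V. smult (a \<nu> x) (word_poly \<eta> ah (word \<nu>)))" for x
  have Q: "poly (Q x) \<tau> = p (\<tau> *\<^sub>R ah + \<eta>)" if "x \<in> U" for x \<tau>
    using sym[OF that, of "\<tau> *\<^sub>R ah + \<eta>"] by (simp add: Q_def poly_sum poly_word_poly)
  have "\<exists>x. x \<in> Om" using eventually_happens'[OF F_nontrivial eventually_Om] .
  then obtain x1 where x1: "x1 \<in> Om" ..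
  have Qeq: "Q x = Q x1" if "x \<in> Om" for x
  proof -
    have "poly (Q x) = poly (Q x1)"
      using Q[OF Om_U[OF that]] Q[OF Om_U[OF x1]] by (simp add: fun_eq_iff)
    then show ?thesis by (simp add: poly_eq_poly_eq_iff)
  qed
  have degQ: "degree (Q x1) \<le> m"
    unfolding Q_def
    by (rule degree_sum_le) (use supp degree_word_poly[of \<eta> ah] length_word in
      \<open>auto intro: order_trans[OF degree_smult_le] simp: length_word[symmetric]\<close>)
  have odd0: "coeff (Q x1) r = 0" if r: "odd r" for r
  proof (cases "r \<le> m")
    case True
    have *: "(\<Sum>\<nu>\<in>?V. a \<nu> x * coeff (word_poly \<eta> ah (word \<nu>)) r) = coeff (Q x1) r" if "x \<in> Om" for x
      unfolding Qeq[OF that, symmetric] by (simp add: Q_def coeff_sum)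
    have lim: "((\<lambda>x. \<Sum>\<nu>\<in>?V. a \<nu> x * coeff (word_poly \<eta> ah (word \<nu>)) r) \<longlongrightarrow> 0) F"
      by (rule symbol_coeff_odd[OF _ \<eta> True r c \<kappa>]) (rule reg)
    have "((\<lambda>x. coeff (Q x1) r) \<longlongrightarrow> 0) F"
      by (rule Lim_transform_eventually[OF lim eventually_mono[OF eventually_Om]]) (rule *)
    from tendsto_unique[OF F_nontrivial tendsto_const this] show ?thesis .
  next
    case False
    then show ?thesis using degQ by (intro coeff_eq_0) simp
  qed
  have "poly (Q x1) (- \<tau>) = poly (Q x1) \<tau>"
    unfolding poly_altdef
  proof (rule sum.cong[OF refl])
    fix i show "coeff (Q x1) i * (- \<tau>) ^ i = coeff (Q x1) i * \<tau> ^ i"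
      using odd0[of i] by (cases "even i") auto
  qed
  then show ?thesis using Q[OF Om_U[OF x1]] by simp
qed

end

section \<open>Algebraically independent polynomials have finite symmetry groups\<close>

text \<open>Gaussian elimination: an unknown \<open>k\<close> that occurs in equation
  \<open>i\<close> is eliminated from the others, which lowers both the number of equations and that
  of unknowns by 1.\<close>

lemma underdetermined_system:
  fixes M :: "'a \<Rightarrow> 'b \<Rightarrow> real"
  assumes "finite I" "finite J" "card I < card J"
  shows "\<exists>c. (\<exists>j\<in>J. c j \<noteq> 0) \<and> (\<forall>i\<in>I. (\<Sum>j\<in>J. c j * M i j) = 0)"
  using assms
proof (induction I arbitrary: J M rule: finite_induct)
  case empty
  then have "J \<noteq> {}" by auto
  then show ?case by (intro exI[of _ "\<lambda>_. 1"]) auto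
next
  case (insert i I)
  show ?case
  proof (cases "\<forall>j\<in>J. M i j = 0")
    case True
    have "card I < card J" using insert by simp
    from insert.IH[OF insert.prems(1) this] True show ?thesis by fastforce
  next
    case False
    then obtain k where k: "k \<in> J" "M i k \<noteq> 0" by blast
    define J' where "J' = J - {k}"
    have J': "finite J'" "card I < card J'"
      using insert k by (auto simp: J'_def)
    obtain d where d: "\<exists>j\<in>J'. d j \<noteq> 0"
      "\<forall>i'\<in>I. (\<Sum>j\<in>J'. d j * (M i' j - M i' k * M i j / M i k)) = 0"
      using insert.IH[OF J', of "\<lambda>i' j. M i' j - M i' k * M i j / M i k"] by blast
    define c where "c j = (if j = k then - (\<Sum>j\<in>J'. d j * M i j) / M i k else d j)" for j
    have split: "(\<Sum>j\<in>J. c j * M i' j) = c k * M i' k + (\<Sum>j\<in>J'. d j * M i' j)" for i'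
      using sum.remove[OF insert.prems(1) k(1), of "\<lambda>j. c j * M i' j"]
      by (auto simp: J'_def c_def intro!: sum.cong)
    have "(\<Sum>j\<in>J. c j * M i' j) = 0" if i': "i' \<in> insert i I" for i'
    proof (cases "i' = i")
      case True
      then show ?thesis unfolding split using k by (simp add: c_def)
    next
      case False
      then have "(\<Sum>j\<in>J'. d j * (M i' j - M i' k * M i j / M i k)) = 0" using i' d(2) by blast
      then have "(\<Sum>j\<in>J'. d j * M i' j) - M i' k / M i k * (\<Sum>j\<in>J'. d j * M i j) = 0"
        by (simp add: sum_subtractf[symmetric] sum_distrib_left algebra_simps)
      then show ?thesis unfolding split by (simp add: c_def mult.commute)
    qed
    moreover have "\<exists>j\<in>J. c j \<noteq> 0" using d(1) by (auto simp: c_def J'_def)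
    ultimately show ?thesis by blast
  qed
qed

section \<open>Polynomials of bounded degree in each variable\<close>

definition degree_box :: "nat \<Rightarrow> ('n::finite \<Rightarrow>\<^sub>0 nat) set" where
  "degree_box D = {\<mu>. \<forall>i. Poly_Mapping.lookup \<mu> i \<le> D}"

lemma degree_box_finite: "finite (degree_box D :: ('n::finite \<Rightarrow>\<^sub>0 nat) set)"
  and degree_box_card: "card (degree_box D :: ('n::finite \<Rightarrow>\<^sub>0 nat) set) = (D + 1) ^ CARD('n)"
proof -
  have "bij_betw Poly_Mapping.lookup (degree_box D) (PiE (UNIV :: 'n set) (\<lambda>_. {..D}))"
  proof (rule bij_betw_byWitness[where f' = Abs_poly_mapping])
    show "\<forall>a\<in>PiE (UNIV :: 'n set) (\<lambda>_. {..D}). Poly_Mapping.lookup (Abs_poly_mapping a) = a" by simp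
    show "Abs_poly_mapping ` PiE (UNIV :: 'n set) (\<lambda>_. {..D}) \<subseteq> degree_box D" by (auto simp: degree_box_def)
  qed (auto simp: degree_box_def lookup_inverse)
  then show "finite (degree_box D :: ('n \<Rightarrow>\<^sub>0 nat) set)" "card (degree_box D :: ('n \<Rightarrow>\<^sub>0 nat) set) = (D + 1) ^ CARD('n)"
    by (simp_all add: bij_betw_finite bij_betw_same_card finite_PiE card_PiE)
qed

text \<open>Bounding the degree in each variable separately makes the index set a box with a power
  as its exact size, and the bounds add under multiplication; the dimension count relies on
  both.\<close>

definition bpoly :: "nat \<Rightarrow> (real^'n::finite \<Rightarrow> real) \<Rightarrow> bool" where
  "bpoly D f \<longleftrightarrow> (\<exists>c. \<forall>\<xi>. f \<xi> = (\<Sum>\<mu>\<in>degree_box D. c \<mu> * monomial_at \<xi> \<mu>))"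

lemma bpoly_add:
  assumes "bpoly D f" "bpoly D g"
  shows "bpoly D (\<lambda>\<xi>. f \<xi> + g \<xi>)"
proof -
  obtain c d where "\<forall>\<xi>. f \<xi> = (\<Sum>\<mu>\<in>degree_box D. c \<mu> * monomial_at \<xi> \<mu>)"
    "\<forall>\<xi>. g \<xi> = (\<Sum>\<mu>\<in>degree_box D. d \<mu> * monomial_at \<xi> \<mu>)"
    using assms unfolding bpoly_def by blast
  then show ?thesis unfolding bpoly_def
    by (intro exI[of _ "\<lambda>\<mu>. c \<mu> + d \<mu>"]) (simp add: sum.distrib distrib_right)
qed

lemma bpoly_zero: "bpoly D (\<lambda>\<xi>. 0)"
  unfolding bpoly_def by (intro exI[of _ "\<lambda>_. 0"]) simp

lemma bpoly_sum: "(\<And>i. i \<in> I \<Longrightarrow> bpoly D (f i)) \<Longrightarrow> bpoly D (\<lambda>\<xi>. \<Sum>i\<in>I. f i \<xi>)"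
  by (induction I rule: infinite_finite_induct) (auto intro: bpoly_zero bpoly_add)

lemma bpoly_monomial:
  fixes \<mu> :: "'n::finite \<Rightarrow>\<^sub>0 nat"
  assumes "\<mu> \<in> degree_box D"
  shows "bpoly D (\<lambda>\<xi>. c * monomial_at \<xi> \<mu>)"
  unfolding bpoly_def
proof (intro exI allI)
  fix \<xi> :: "real^'n"
  have "(\<Sum>\<nu>\<in>degree_box D. (if \<nu> = \<mu> then c else 0) * monomial_at \<xi> \<nu>)
     = (\<Sum>\<nu>\<in>degree_box D. if \<nu> = \<mu> then c * monomial_at \<xi> \<nu> else 0)"
    by (rule sum.cong) auto
  then show "c * monomial_at \<xi> \<mu> = (\<Sum>\<nu>\<in>degree_box D. (if \<nu> = \<mu> then c else 0) * monomial_at \<xi> \<nu>)"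
    using assms by (simp add: degree_box_finite)
qed

lemma bpoly_le:
  assumes "bpoly D f" "D \<le> E"
  shows "bpoly E f"
proof -
  obtain c where c: "\<forall>\<xi>. f \<xi> = (\<Sum>\<mu>\<in>degree_box D. c \<mu> * monomial_at \<xi> \<mu>)"
    using assms unfolding bpoly_def by blast
  have "bpoly E (\<lambda>\<xi>. \<Sum>\<mu>\<in>degree_box D. c \<mu> * monomial_at \<xi> \<mu>)"
    by (rule bpoly_sum, rule bpoly_monomial) (use assms(2) in \<open>auto simp: degree_box_def intro: order_trans\<close>)
  moreover have "f = (\<lambda>\<xi>. \<Sum>\<mu>\<in>degree_box D. c \<mu> * monomial_at \<xi> \<mu>)" using c by auto
  ultimately show ?thesis by simp
qed

lemma monomial_at_add: "monomial_at \<xi> (\<mu> + \<nu>) = monomial_at \<xi> \<mu> * monomial_at \<xi> \<nu>"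
  by (simp add: lookup_add power_add prod.distrib)

lemma bpoly_mult:
  assumes "bpoly D f" "bpoly E g"
  shows "bpoly (D + E) (\<lambda>\<xi>. f \<xi> * g \<xi>)"
proof -
  obtain c d where c: "\<And>\<xi>. f \<xi> = (\<Sum>\<mu>\<in>degree_box D. c \<mu> * monomial_at \<xi> \<mu>)"
    and d: "\<And>\<xi>. g \<xi> = (\<Sum>\<mu>\<in>degree_box E. d \<mu> * monomial_at \<xi> \<mu>)"
    using assms unfolding bpoly_def by blast
  have eq: "f \<xi> * g \<xi> = (\<Sum>\<mu>\<in>degree_box D. \<Sum>\<nu>\<in>degree_box E. (c \<mu> * d \<nu>) * monomial_at \<xi> (\<mu> + \<nu>))" for \<xi>
    unfolding c d sum_product monomial_at_add by (intro sum.cong refl) (simp add: mult_ac)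
  show ?thesis
    unfolding eq
    by (intro bpoly_sum bpoly_monomial) (auto simp: degree_box_def lookup_add intro: add_mono)
qed

lemma bpoly_one: "bpoly D (\<lambda>\<xi>. 1)"
  using bpoly_monomial[of 0 D 1] by (simp add: degree_box_def)

lemma bpoly_power: "bpoly D f \<Longrightarrow> bpoly (q * D) (\<lambda>\<xi>. f \<xi> ^ q)"
  by (induction q) (auto intro: bpoly_one dest: bpoly_mult)

lemma bpoly_prod: "(\<And>i. i \<in> I \<Longrightarrow> bpoly D (f i)) \<Longrightarrow> bpoly (card I * D) (\<lambda>\<xi>. \<Prod>i\<in>I. f i \<xi>)"
  by (induction I rule: infinite_finite_induct) (auto intro: bpoly_one dest: bpoly_mult)

lemma bpoly_component: "bpoly 1 (\<lambda>\<xi>. \<xi> $ j)"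
proof -
  define \<mu> where "\<mu> = Poly_Mapping.single j (1::nat)"
  have "monomial_at \<xi> \<mu> = (\<Prod>i\<in>UNIV. if i = j then \<xi> $ i else 1)" for \<xi>
    by (rule prod.cong) (auto simp: \<mu>_def lookup_single when_def)
  then have "monomial_at \<xi> \<mu> = \<xi> $ j" for \<xi> by simp
  moreover have "\<mu> \<in> degree_box 1" by (simp add: degree_box_def \<mu>_def lookup_single when_def)
  ultimately show ?thesis using bpoly_monomial[of \<mu> 1 1] by simp
qed

lemma bpoly_continuous: "bpoly D f \<Longrightarrow> continuous_on UNIV f"
proof -
  assume "bpoly D f"
  then obtain c where "f = (\<lambda>\<xi>. \<Sum>\<mu>\<in>degree_box D. c \<mu> * monomial_at \<xi> \<mu>)"
    unfolding bpoly_def by (auto simp: fun_eq_iff)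
  then show ?thesis by (auto intro!: continuous_intros)
qed

text \<open>On the line from a point of \<open>V\<close> to \<open>z\<close> the function is a
  polynomial in one variable, nonzero at parameter 1, so it has only finitely many zeros
  there.\<close>

lemma bpoly_nonzero_dense:
  fixes f :: "real^'n::finite \<Rightarrow> real"
  assumes f: "bpoly D f" and z: "f z \<noteq> 0" and V: "open V" "V \<noteq> {}"
  shows "\<exists>\<xi>\<in>V. f \<xi> \<noteq> 0"
proof -
  obtain y where y: "y \<in> V" using V by blast
  obtain e where e: "e > 0" "ball y e \<subseteq> V" using V y open_contains_ball by blast
  obtain c where c: "\<And>\<xi>. f \<xi> = (\<Sum>\<mu>\<in>degree_box D. c \<mu> * monomial_at \<xi> \<mu>)"
    using f unfolding bpoly_def by blast
  define Q where "Q = (\<Sum>\<mu>\<in>degree_box D. smult (c \<mu>) (word_poly y (z - y) (word \<mu>)))"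
  have Q: "poly Q t = f (t *\<^sub>R (z - y) + y)" for t
    by (simp add: Q_def poly_sum c poly_word_poly)
  have "Q \<noteq> 0" using Q[of 1] z by auto
  then have fin: "finite {t. poly Q t = 0}" by (rule poly_roots_finite)
  define d where "d = e / (norm (z - y) + 1)"
  have n1: "0 < norm (z - y) + 1" using norm_ge_zero[of "z - y"] by linarith
  then have d: "d > 0" using e by (simp add: d_def)
  have "infinite {0<..<d}" using d by (rule infinite_Ioo)
  then obtain t where t: "t \<in> {0<..<d}" "poly Q t \<noteq> 0"
    using fin finite_subset[of "{0<..<d}" "{t. poly Q t = 0}"] by blast
  have "dist y (t *\<^sub>R (z - y) + y) = t * norm (z - y)" using t by (simp add: dist_norm)
  also have "\<dots> \<le> t * (norm (z - y) + 1)" using t by simp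
  also have "\<dots> < d * (norm (z - y) + 1)" using t n1 by simp
  also have "\<dots> = e" using n1 by (simp add: d_def)
  finally have "t *\<^sub>R (z - y) + y \<in> V" using e by auto
  then show ?thesis using Q t by metis
qed

lemma bpolys_nonzero_open:
  fixes H :: "'i \<Rightarrow> real^'n::finite \<Rightarrow> real"
  assumes "finite J" "\<And>j. j \<in> J \<Longrightarrow> bpoly (D j) (H j)" "\<And>j. j \<in> J \<Longrightarrow> \<exists>z. H j z \<noteq> 0"
  shows "\<exists>V. open V \<and> V \<noteq> {} \<and> (\<forall>j\<in>J. \<forall>\<xi>\<in>V. H j \<xi> \<noteq> 0)"
  using assms
proof (induction J rule: finite_induct)
  case empty
  then show ?case by (intro exI[of _ UNIV]) auto
next
  case (insert j J)
  then obtain V where V: "open V" "V \<noteq> {}" "\<forall>j\<in>J. \<forall>\<xi>\<in>V. H j \<xi> \<noteq> 0" by blast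
  have "open {\<xi>. H j \<xi> \<noteq> 0}"
    using open_Collect_neq[OF bpoly_continuous continuous_on_const] insert.prems(1)[of j] by simp
  moreover obtain z where "H j z \<noteq> 0" using insert.prems(2)[of j] by blast
  then have "\<exists>\<xi>\<in>V. H j \<xi> \<noteq> 0"
    using bpoly_nonzero_dense[OF insert.prems(1)[of j] _ V(1,2)] by blast
  ultimately show ?case
    using V by (intro exI[of _ "V \<inter> {\<xi>. H j \<xi> \<noteq> 0}"]) auto
qed

text \<open>There are more products \<open>p\<^sup>m \<xi>\<^sub>j\<^sup>q\<close> with exponents up to \<open>N\<close> than monomials that can occur
  in them, so \<open>\<xi>\<^sub>j\<close> is algebraic over the \<open>p\<^sub>i\<close>.\<close>

lemma component_algebraic:
  fixes p :: "'n::finite \<Rightarrow> real^'n \<Rightarrow> real"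
  assumes p: "\<And>i. bpoly D (p i)" and ind: "alg_independent p"
  shows "\<exists>E H. bpoly E H \<and> (\<exists>z. H z \<noteq> 0) \<and>
    (\<forall>\<xi>. H \<xi> \<noteq> 0 \<longrightarrow> finite {\<zeta> $ j | \<zeta>. \<forall>i. p i \<zeta> = p i \<xi>})"
proof -
  define n where "n = CARD('n)"
  \<comment> \<open>A product of the \<open>p i\<close> and one coordinate, with exponents up to N,
    has degree at most n N D + N = C N in each variable.\<close>
  define C where "C = n * D + 1"
  \<comment> \<open>With this choice (C N + 1)^n is at most C^n (N + 1)^n = N (N + 1)^n, less than
    the number (N + 1)^(n + 1) of products.\<close>
  define N where "N = C ^ n"
  let ?I = "degree_box (C * N) :: ('n \<Rightarrow>\<^sub>0 nat) set"
  let ?B = "degree_box N :: ('n \<Rightarrow>\<^sub>0 nat) set"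
  let ?J = "?B \<times> {..N}"
  define pm where "pm m \<xi> = (\<Prod>i\<in>UNIV. p i \<xi> ^ Poly_Mapping.lookup m i)" for m \<xi>
  have pm: "bpoly (n * (N * D)) (pm m)" if "m \<in> ?B" for m
  proof -
    have "bpoly (N * D) (\<lambda>\<xi>. p i \<xi> ^ Poly_Mapping.lookup m i)" for i
      by (rule bpoly_le[OF bpoly_power[OF p]]) (use that in \<open>simp add: degree_box_def\<close>)
    from bpoly_prod[of UNIV, OF this] show ?thesis unfolding pm_def[abs_def] n_def .
  qed
  have "bpoly (C * N) (\<lambda>\<xi>. pm m \<xi> * \<xi> $ j ^ q)" if "m \<in> ?B" "q \<le> N" for m q
    by (rule bpoly_le[OF bpoly_mult[OF pm[OF that(1)] bpoly_power[OF bpoly_component]]])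
      (use that in \<open>simp add: C_def algebra_simps\<close>)
  then have "\<forall>mq\<in>?J. \<exists>c. \<forall>\<xi>. pm (fst mq) \<xi> * \<xi> $ j ^ snd mq = (\<Sum>\<mu>\<in>?I. c \<mu> * monomial_at \<xi> \<mu>)"
    unfolding bpoly_def by auto
  from bchoice[OF this] obtain c where c: "\<And>mq \<xi>. mq \<in> ?J \<Longrightarrow>
      pm (fst mq) \<xi> * \<xi> $ j ^ snd mq = (\<Sum>\<mu>\<in>?I. c mq \<mu> * monomial_at \<xi> \<mu>)"
    by blast
  have "(C * N + 1) ^ n \<le> (C * (N + 1)) ^ n"
    by (intro power_mono) (simp_all add: C_def)
  also have "\<dots> = N * (N + 1) ^ n" by (simp only: power_mult_distrib N_def[symmetric])
  also have "\<dots> < (N + 1) ^ n * (N + 1)" by simp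
  finally have "card ?I < card ?J"
    by (simp add: degree_box_card card_cartesian_product n_def)
  from underdetermined_system[OF degree_box_finite _ this, of "\<lambda>\<mu> mq. c mq \<mu>"]
  obtain d where d: "\<exists>mq\<in>?J. d mq \<noteq> 0" "\<forall>\<mu>\<in>?I. (\<Sum>mq\<in>?J. d mq * c mq \<mu>) = 0"
    by (auto simp: degree_box_finite)
  \<comment> \<open>The linear relation sorted by powers of the coordinate: \<open>G q\<close> is
    the coefficient of the power q and depends on \<xi> only through the \<open>p i\<close>.\<close>
  define G where "G q \<xi> = (\<Sum>m\<in>?B. d (m, q) * pm m \<xi>)" for q \<xi>
  have G0: "(\<Sum>q\<le>N. G q \<xi> * \<xi> $ j ^ q) = 0" for \<xi>
  proof -
    have "(\<Sum>q\<le>N. G q \<xi> * \<xi> $ j ^ q) = (\<Sum>m\<in>?B. \<Sum>q\<le>N. d (m, q) * (pm m \<xi> * \<xi> $ j ^ q))"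
      unfolding G_def sum_distrib_right by (subst sum.swap) (simp add: mult_ac)
    also have "\<dots> = (\<Sum>mq\<in>?J. d mq * (pm (fst mq) \<xi> * \<xi> $ j ^ snd mq))"
      by (simp add: sum.cartesian_product case_prod_unfold)
    also have "\<dots> = (\<Sum>mq\<in>?J. d mq * (\<Sum>\<mu>\<in>?I. c mq \<mu> * monomial_at \<xi> \<mu>))"
      by (rule sum.cong[OF refl]) (simp only: c)
    also have "\<dots> = (\<Sum>\<mu>\<in>?I. (\<Sum>mq\<in>?J. d mq * c mq \<mu>) * monomial_at \<xi> \<mu>)"
      unfolding sum_distrib_left sum_distrib_right by (subst sum.swap) (simp only: mult.assoc)
    also have "\<dots> = 0" using d(2) by simp
    finally show ?thesis .
  qed
  obtain m0 q0 where mq0: "m0 \<in> ?B" "q0 \<le> N" "d (m0, q0) \<noteq> 0" using d(1) by auto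
  \<comment> \<open>If \<open>G q0\<close> vanished everywhere, it would be a nontrivial polynomial
    relation between the \<open>p i\<close>.\<close>
  have nz: "\<exists>z. G q0 z \<noteq> 0"
  proof (rule ccontr)
    assume "\<nexists>z. G q0 z \<noteq> 0"
    then have G00: "G q0 z = 0" for z by blast
    define Q where "Q = Abs_poly_mapping (\<lambda>m. if m \<in> ?B then d (m, q0) else 0)"
    have "finite {m. (if m \<in> ?B then d (m, q0) else 0) \<noteq> 0}"
      by (rule finite_subset[OF _ degree_box_finite[of N]]) auto
    then have Q: "Poly_Mapping.lookup Q m = (if m \<in> ?B then d (m, q0) else 0)" for m
      by (simp add: Q_def)
    have "(\<Sum>m\<in>Poly_Mapping.keys Q. Poly_Mapping.lookup Q m * pm m \<xi>) = 0" for \<xi>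
    proof -
      have "(\<Sum>m\<in>Poly_Mapping.keys Q. Poly_Mapping.lookup Q m * pm m \<xi>)
         = (\<Sum>m\<in>?B. Poly_Mapping.lookup Q m * pm m \<xi>)"
      proof (rule sum.mono_neutral_left[OF degree_box_finite])
        show "Poly_Mapping.keys Q \<subseteq> ?B" by (auto simp: in_keys_iff Q split: if_splits)
      qed (simp add: in_keys_iff)
      also have "\<dots> = G q0 \<xi>" unfolding G_def by (rule sum.cong) (auto simp: Q)
      finally show ?thesis using G00 by simp
    qed
    then have "Q = 0" using ind unfolding alg_independent_def pm_def by blast
    then show False using Q[of m0] mq0 by simp
  qed
  show ?thesis
  proof (intro exI[of _ "G q0"] exI[of _ "n * (N * D)"] conjI allI impI)
    have "bpoly (n * (N * D) + 0) (\<lambda>\<xi>. pm m \<xi> * d (m, q0))" if "m \<in> ?B" for m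
      using bpoly_mult[OF pm[OF that] bpoly_monomial[of 0 0 "d (m, q0)"]] by (simp add: degree_box_def)
    then show "bpoly (n * (N * D)) (G q0)"
      unfolding G_def[abs_def] by (intro bpoly_sum) (simp add: mult.commute)
    show "\<exists>z. G q0 z \<noteq> 0" by (rule nz)
    fix \<xi> assume \<xi>: "G q0 \<xi> \<noteq> 0"
    define P where "P = (\<Sum>q\<le>N. monom (G q \<xi>) q)"
    have "coeff P q0 = G q0 \<xi>" using mq0(2) by (simp add: P_def coeff_sum)
    then have "P \<noteq> 0" using \<xi> by auto
    then have "finite {t. poly P t = 0}" by (rule poly_roots_finite)
    moreover have "{\<zeta> $ j | \<zeta>. \<forall>i. p i \<zeta> = p i \<xi>} \<subseteq> {t. poly P t = 0}"
    proof clarify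
      fix \<zeta> assume "\<forall>i. p i \<zeta> = p i \<xi>"
      then have "G q \<zeta> = G q \<xi>" for q by (simp add: G_def pm_def)
      then have "poly P (\<zeta> $ j) = (\<Sum>q\<le>N. G q \<zeta> * \<zeta> $ j ^ q)"
        by (simp add: P_def poly_sum poly_monom)
      then show "poly P (\<zeta> $ j) = 0" using G0 by simp
    qed
    ultimately show "finite {\<zeta> $ j | \<zeta>. \<forall>i. p i \<zeta> = p i \<xi>}" by (rule finite_subset[rotated])
  qed
qed

lemma finite_vectors:
  fixes A :: "'n::finite \<Rightarrow> real set"
  assumes "\<And>j. finite (A j)"
  shows "finite {\<zeta> :: real^'n. \<forall>j. \<zeta> $ j \<in> A j}"
proof -
  have "{\<zeta> :: real^'n. \<forall>j. \<zeta> $ j \<in> A j} \<subseteq> vec_lambda ` (PiE UNIV A)"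
  proof
    fix \<zeta> :: "real^'n" assume "\<zeta> \<in> {\<zeta>. \<forall>j. \<zeta> $ j \<in> A j}"
    then show "\<zeta> \<in> vec_lambda ` (PiE UNIV A)"
      by (intro image_eqI[of _ _ "vec_nth \<zeta>"]) auto
  qed
  moreover have "finite (PiE UNIV A)" using assms by (intro finite_PiE) auto
  ultimately show ?thesis using finite_surj by blast
qed

text \<open>A linear map is determined by its values at \<open>x\<close> and at the nearby points
  \<open>y i\<close>, displaced in the coordinate directions. All of them lie in an open set over
  which the common fibres of the \<open>p i\<close> are finite, and a symmetry keeps each point in
  its fibre.\<close>

theorem finite_linear_symmetries:
  fixes p :: "'n::finite \<Rightarrow> real^'n \<Rightarrow> real" and W :: "(real^'n \<Rightarrow> real^'n) set"
  assumes p: "\<And>i. bpoly D (p i)" and ind: "alg_independent p"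
    and lin: "\<And>w. w \<in> W \<Longrightarrow> linear w" and inv: "\<And>w i \<xi>. w \<in> W \<Longrightarrow> p i (w \<xi>) = p i \<xi>"
  shows "finite W"
proof -
  have "\<forall>j. \<exists>E H. bpoly E H \<and> (\<exists>z. H z \<noteq> 0) \<and>
    (\<forall>\<xi>. H \<xi> \<noteq> 0 \<longrightarrow> finite {\<zeta> $ j | \<zeta>. \<forall>i. p i \<zeta> = p i \<xi>})"
    using component_algebraic[OF p ind] by blast
  from choice[OF this] obtain E where "\<forall>j. \<exists>H. bpoly (E j) H \<and> (\<exists>z. H z \<noteq> 0) \<and>
    (\<forall>\<xi>. H \<xi> \<noteq> 0 \<longrightarrow> finite {\<zeta> $ j | \<zeta>. \<forall>i. p i \<zeta> = p i \<xi>})" by blast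
  from choice[OF this] obtain H where H: "\<And>j. bpoly (E j) (H j)" "\<And>j. \<exists>z. H j z \<noteq> 0"
    "\<And>j \<xi>. H j \<xi> \<noteq> 0 \<Longrightarrow> finite {\<zeta> $ j | \<zeta>. \<forall>i. p i \<zeta> = p i \<xi>}"
    by blast
  obtain V where V: "open V" "V \<noteq> {}" "\<forall>j. \<forall>\<xi>\<in>V. H j \<xi> \<noteq> 0"
    using bpolys_nonzero_open[of UNIV E H] H(1,2) by auto
  define A where "A \<xi> = {\<zeta>. \<forall>i. p i \<zeta> = p i \<xi>}" for \<xi>
  have finA: "finite (A \<xi>)" if "\<xi> \<in> V" for \<xi>
  proof (rule finite_subset)
    show "A \<xi> \<subseteq> {\<zeta>. \<forall>j. \<zeta> $ j \<in> {\<zeta> $ j | \<zeta>. \<forall>i. p i \<zeta> = p i \<xi>}}" by (auto simp: A_def)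
    show "finite {\<zeta>. \<forall>j. \<zeta> $ j \<in> {\<zeta> $ j | \<zeta>. \<forall>i. p i \<zeta> = p i \<xi>}}"
      using V(3) that H(3) by (intro finite_vectors) blast
  qed
  obtain x where x: "x \<in> V" using V by blast
  obtain e where e: "e > 0" "ball x e \<subseteq> V" using V x open_contains_ball by blast
  define y where "y i = x + (e / 2) *\<^sub>R axis i (1::real)" for i
  have y: "y i \<in> V" for i
    using e by (intro subsetD[OF e(2)]) (simp add: y_def dist_norm)
  define \<Phi> where "\<Phi> w = (w x, \<lambda>i. w (y i))" for w :: "real^'n \<Rightarrow> real^'n"
  have "inj_on \<Phi> W"
  proof (rule inj_onI)
    fix w w' assume w: "w \<in> W" "w' \<in> W" "\<Phi> w = \<Phi> w'"
    note l = lin[OF w(1)] lin[OF w(2)]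
    have eq: "w x = w' x" "w (y i) = w' (y i)" for i
      using w(3) by (auto simp: \<Phi>_def fun_eq_iff)
    have axes: "w (axis i 1) = w' (axis i 1)" for i
    proof -
      have "(e / 2) *\<^sub>R axis i (1::real) = y i - x" by (simp add: y_def)
      then have "w ((e / 2) *\<^sub>R axis i 1) = w' ((e / 2) *\<^sub>R axis i 1)"
        using eq l by (simp add: linear_diff)
      then have "(e / 2) *\<^sub>R w (axis i 1) = (e / 2) *\<^sub>R w' (axis i 1)"
        by (simp only: linear_cmul[OF l(1)] linear_cmul[OF l(2)])
      then show ?thesis using e by simp
    qed
    show "w = w'"
      by (rule linear_eq_stdbasis[OF l]) (use axes in \<open>auto simp: Basis_vec_def\<close>)
  qed
  moreover have "\<Phi> ` W \<subseteq> A x \<times> PiE UNIV (\<lambda>i. A (y i))"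
    using inv by (auto simp: \<Phi>_def A_def)
  moreover have "finite (A x \<times> PiE UNIV (\<lambda>i. A (y i)))"
    using finA x y by (intro finite_cartesian_product finite_PiE) auto
  ultimately show ?thesis by (meson finite_imageD finite_subset)
qed

section \<open>Symbols of quantum integrals and reflections\<close>

text \<open>A perturbation x + e y meets each hyperplane for at most one value of e. This yields a
  point of one mirror that avoids the others, and also a regular point.\<close>

lemma subspace_avoids_hyperplanes:
  fixes B :: "(real^'n::finite) set"
  assumes "subspace S" "finite B" "\<And>\<beta>. \<beta> \<in> B \<Longrightarrow> \<exists>y\<in>S. \<beta> \<bullet> y \<noteq> 0"
  shows "\<exists>x\<in>S. \<forall>\<beta>\<in>B. \<beta> \<bullet> x \<noteq> 0"
  using assms(2,3)
proof (induction B rule: finite_induct)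
  case empty
  then show ?case using assms(1) subspace_0 by blast
next
  case (insert \<beta> B)
  then obtain x where x: "x \<in> S" "\<forall>\<gamma>\<in>B. \<gamma> \<bullet> x \<noteq> 0" by blast
  obtain y where y: "y \<in> S" "\<beta> \<bullet> y \<noteq> 0" using insert.prems by blast
  have "finite {e. \<gamma> \<bullet> x + e * (\<gamma> \<bullet> y) = 0}" if "\<gamma> \<in> insert \<beta> B" for \<gamma>
  proof (rule finite_subset)
    show "{e. \<gamma> \<bullet> x + e * (\<gamma> \<bullet> y) = 0} \<subseteq> {- (\<gamma> \<bullet> x) / (\<gamma> \<bullet> y)}"
    proof
      fix e assume "e \<in> {e. \<gamma> \<bullet> x + e * (\<gamma> \<bullet> y) = 0}"
      then have e: "\<gamma> \<bullet> x + e * (\<gamma> \<bullet> y) = 0" by simp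
      then have "\<gamma> \<bullet> y \<noteq> 0" using that x(2) y(2) by auto
      then show "e \<in> {- (\<gamma> \<bullet> x) / (\<gamma> \<bullet> y)}" using e by (simp add: field_simps)
    qed
  qed simp
  then have "finite (\<Union>\<gamma>\<in>insert \<beta> B. {e. \<gamma> \<bullet> x + e * (\<gamma> \<bullet> y) = 0})"
    using insert.hyps by blast
  then obtain e where "e \<notin> (\<Union>\<gamma>\<in>insert \<beta> B. {e. \<gamma> \<bullet> x + e * (\<gamma> \<bullet> y) = 0})"
    using ex_new_if_finite[OF infinite_UNIV_char_0] by blast
  then have "\<forall>\<gamma>\<in>insert \<beta> B. \<gamma> \<bullet> (x + e *\<^sub>R y) \<noteq> 0"
    by (auto simp: inner_add_right)
  moreover have "x + e *\<^sub>R y \<in> S"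
    using assms(1) x(1) y(1) by (simp add: subspace_add subspace_scale)
  ultimately show ?case by blast
qed

text \<open>\<open>y\<close> is the component of \<beta> orthogonal to \<alpha>, so \<beta>
  \<bullet> y = y \<bullet> y.\<close>

lemma inner_rejection:
  fixes \<alpha> \<beta> :: "real^'n::finite"
  assumes "\<alpha> \<noteq> 0"
  defines "y \<equiv> \<beta> - ((\<alpha> \<bullet> \<beta>) / (\<alpha> \<bullet> \<alpha>)) *\<^sub>R \<alpha>"
  shows "\<alpha> \<bullet> y = 0" and "\<beta> \<bullet> y = 0 \<Longrightarrow> collinear {0, \<alpha>, \<beta>}"
proof -
  show 1: "\<alpha> \<bullet> y = 0" using assms by (simp add: y_def inner_diff_right)
  assume "\<beta> \<bullet> y = 0"
  then have "y \<bullet> y = 0" using 1 by (subst (1) y_def) (simp add: inner_diff_left)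
  then have "\<exists>c. \<beta> = c *\<^sub>R \<alpha>" by (auto simp: y_def)
  then show "collinear {0, \<alpha>, \<beta>}" by (auto simp: collinear_lemma)
qed

section \<open>From the Hamiltonian to the local situation at a mirror\<close>

definition potential :: "(real^'n::finite) set \<Rightarrow> (real^'n \<Rightarrow> real) \<Rightarrow> real^'n \<Rightarrow> real" where
  "potential B k x = (\<Sum>\<alpha>\<in>B. k \<alpha> * (k \<alpha> + 1) * (\<alpha> \<bullet> \<alpha>) / (\<alpha> \<bullet> x)\<^sup>2)"

lemma smooth_potential:
  assumes U: "open U" and B: "\<And>\<alpha> x. \<alpha> \<in> B \<Longrightarrow> x \<in> U \<Longrightarrow> \<alpha> \<bullet> x \<noteq> 0"
  shows "smooth_on U (potential B k)"
proof (rule smooth_on_cong[OF U])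
  \<comment> \<open>The inverse square is the sum of its parts on the two sides of the mirror, each
    already known to be smooth off the mirror.\<close>
  show "smooth_on U (\<lambda>x. \<Sum>\<alpha>\<in>B. (k \<alpha> * (k \<alpha> + 1) * (\<alpha> \<bullet> \<alpha>)) *
      (half_powr \<alpha> (- 2) x + half_powr (- \<alpha>) (- 2) x))"
    by (intro smooth_on_sum smooth_on_cmult smooth_on_add smooth_half_powr U) (auto simp: B)
  fix x assume x: "x \<in> U"
  have "half_powr \<alpha> (- 2) x + half_powr (- \<alpha>) (- 2) x = 1 / (\<alpha> \<bullet> x)\<^sup>2" if "\<alpha> \<in> B" for \<alpha>
  proof -
    have "y powr (- 2) = 1 / y\<^sup>2" if "y > 0" for y :: real
      using that by (simp add: powr_minus_divide)
    from this[of "\<alpha> \<bullet> x"] this[of "- (\<alpha> \<bullet> x)"] show ?thesis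
      using B[OF that x] by (auto simp: half_powr_def)
  qed
  then show "(\<Sum>\<alpha>\<in>B. (k \<alpha> * (k \<alpha> + 1) * (\<alpha> \<bullet> \<alpha>)) *
      (half_powr \<alpha> (- 2) x + half_powr (- \<alpha>) (- 2) x)) = potential B k x"
    unfolding potential_def by simp
qed

lemma smooth_on_op_apply:
  assumes U: "open U" and a: "diff_op U a" and f: "smooth_on U f"
  shows "smooth_on U (op_apply U a f)"
proof -
  have "smooth_on U (foldr partial w f)" for w
    by (induction w) (auto intro: f smooth_on_partial)
  then show ?thesis
    unfolding op_apply_def[abs_def] multi_partial_word
    using a by (intro smooth_on_sum smooth_on_mult U) (auto simp: diff_op_def)
qed

lemma open_regular_set: "finite Ap \<Longrightarrow> open (regular_set Ap)"
proof -
  assume "finite Ap"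
  moreover have "regular_set Ap = (\<Inter>\<alpha>\<in>all_vectors Ap. {x. \<alpha> \<bullet> x \<noteq> 0})"
    by (auto simp: regular_set_def)
  moreover have "open {x. \<alpha> \<bullet> x \<noteq> 0}" for \<alpha> :: "real^'n"
    by (intro open_Collect_neq continuous_intros)
  ultimately show ?thesis by (auto simp: all_vectors_def)
qed

lemma regular_set_altdef: "regular_set Ap = {x. \<forall>\<alpha>\<in>Ap. \<alpha> \<bullet> x \<noteq> 0}"
  by (auto simp: regular_set_def all_vectors_def)

text \<open>At a point of the mirror of \<alpha> off all other mirrors the remaining terms of the
  potential are smooth, so \<open>symbol_even\<close> applies. Such a point exists because no other
  mirror contains this one, the vectors being nonparallel. The reflection changes the sign of the
  normal component only.\<close>

lemma symbol_reflection_invariant: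
  fixes Ap :: "(real^'n::finite) set"
  assumes conf: "configuration Ap k" and q: "quantum_integrals Ap k L"
    and sym: "has_constant_symbol (regular_set Ap) (L i) p"
    and \<alpha>: "\<alpha> \<in> Ap" and k: "k \<alpha> \<notin> \<int>"
  shows "p (reflection \<alpha> \<xi>) = p \<xi>"
proof -
  let ?U = "regular_set Ap"
  have fin: "finite Ap" and A0: "\<alpha> \<noteq> 0"
    and par: "pairwise (\<lambda>\<alpha> \<beta>. \<not> collinear {0, \<alpha>, \<beta>}) Ap"
    using conf \<alpha> unfolding configuration_def by blast+
  define B where "B = Ap - {\<alpha>}"
  have U: "open ?U" by (rule open_regular_set[OF fin])
  have "\<exists>y\<in>{x. \<alpha> \<bullet> x = 0}. \<beta> \<bullet> y \<noteq> 0" if \<beta>: "\<beta> \<in> B" for \<beta>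
  proof (rule ccontr)
    assume "\<not> (\<exists>y\<in>{x. \<alpha> \<bullet> x = 0}. \<beta> \<bullet> y \<noteq> 0)"
    then have "collinear {0, \<alpha>, \<beta>}"
      using inner_rejection[OF A0, of \<beta>] by blast
    moreover have "\<not> collinear {0, \<alpha>, \<beta>}"
      by (rule pairwiseD[OF par \<alpha>]) (use \<beta> in \<open>auto simp: B_def\<close>)
    ultimately show False by blast
  qed
  then obtain x0 where x0: "\<alpha> \<bullet> x0 = 0" "\<forall>\<beta>\<in>B. \<beta> \<bullet> x0 \<noteq> 0"
    using subspace_avoids_hyperplanes[OF subspace_hyperplane, of B \<alpha>] fin by (auto simp: B_def)
  have "open (regular_set B)" using fin by (intro open_regular_set) (simp add: B_def)
  moreover have "x0 \<in> regular_set B" using x0 by (simp add: regular_set_altdef)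
  ultimately obtain \<rho> where \<rho>: "\<rho> > 0" "ball x0 \<rho> \<subseteq> regular_set B"
    using open_contains_ball by blast
  have nz: "norm \<alpha> \<noteq> 0" using A0 by simp
  define ah where "ah = (1 / norm \<alpha>) *\<^sub>R \<alpha>"
  have ah: "ah \<bullet> ah = 1"
    using nz by (simp add: ah_def dot_square_norm power2_eq_square)
  have ax: "\<alpha> \<bullet> x = norm \<alpha> * (ah \<bullet> x)" for x
    using nz by (simp add: ah_def)
  obtain i0 where i0: "\<And>f x. smooth_on ?U f \<Longrightarrow> x \<in> ?U \<Longrightarrow> op_apply ?U (L i0) f x = hamiltonian Ap k f x"
    using q unfolding quantum_integrals_def Let_def by blast
  have L: "diff_op ?U (L i)" and com: "op_commute ?U (L i) (L i0)"
    using q unfolding quantum_integrals_def Let_def by blast+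
  have ham: "hamiltonian Ap k f x = laplacian f x - potential Ap k x * f x" for f x
    by (simp add: hamiltonian_def potential_def)
  interpret mirror_point ah x0 \<rho>
    by unfold_locales (use ah x0 \<rho> nz in \<open>auto simp: ah_def\<close>)
  have Om_U: "Om \<subseteq> ?U"
  proof
    fix x assume x: "x \<in> Om"
    then have "x \<in> regular_set B" "\<alpha> \<bullet> x \<noteq> 0" using \<rho>(2) nz by (auto simp: Om_def ax)
    then show "x \<in> ?U" by (auto simp: regular_set_altdef B_def)
  qed
  interpret commuting_operator ah x0 \<rho> ?U "L i" "potential Ap k" "potential B k"
    "k \<alpha> * (k \<alpha> + 1)" "op_order ?U (L i)" p
  proof
    show "open ?U" by (rule U)
    show "Om \<subseteq> ?U" by (rule Om_U)
    show "smooth_on ?U (potential Ap k)"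
      by (rule smooth_potential[OF U]) (auto simp: regular_set_altdef)
    show "diff_op ?U (L i)" by (rule L)
    show "smooth_on (ball x0 \<rho>) (potential B k)"
      by (rule smooth_potential) (use \<rho> in \<open>auto simp: regular_set_altdef\<close>)
    show "potential Ap k x = k \<alpha> * (k \<alpha> + 1) * T (- 2) x + potential B k x" if x: "x \<in> Om" for x
    proof -
      have t: "0 < ah \<bullet> x" using x by (simp add: Om_def)
      \<comment> \<open>The factor (\<alpha>, \<alpha>) cancels the length of \<alpha>, leaving the
        inverse square of the distance.\<close>
      have "k \<alpha> * (k \<alpha> + 1) * (\<alpha> \<bullet> \<alpha>) / (\<alpha> \<bullet> x)\<^sup>2 = k \<alpha> * (k \<alpha> + 1) * T (- 2) x"
        using t nz by (simp add: ax[of x] T_def powr_minus_divide dot_square_norm power_mult_distrib)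
      then show ?thesis
        unfolding potential_def B_def by (subst sum.remove[OF fin \<alpha>]) simp
    qed
    show "multi_degree \<nu> \<le> op_order ?U (L i)" if "\<nu> \<in> op_support ?U (L i)" for \<nu>
      unfolding op_order_def using L that by (intro Max_ge) (auto simp: diff_op_def)
    show "(\<Sum>\<nu> | \<nu> \<in> op_support ?U (L i) \<and> multi_degree \<nu> = op_order ?U (L i).
        L i \<nu> x * monomial_at \<xi> \<nu>) = p \<xi>" if "x \<in> ?U" for x \<xi>
      using sym that unfolding has_constant_symbol_def principal_symbol_def by blast
    fix f x assume f: "smooth_on ?U f" and x: "x \<in> ?U"
    \<comment> \<open>Commutation is given for \<open>L i0\<close>, which is known to act as the
      Hamiltonian on functions smooth on the regular set; \<open>L i\<close> preserves
      these.\<close>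
    have "op_apply ?U (L i) (\<lambda>y. laplacian f y - potential Ap k y * f y) x
       = op_apply ?U (L i) (op_apply ?U (L i0) f) x"
      by (rule op_apply_cong[OF U x]) (simp add: i0[OF f] ham)
    also have "\<dots> = op_apply ?U (L i0) (op_apply ?U (L i) f) x"
      using com f x unfolding op_commute_def by blast
    also have "\<dots> = laplacian (op_apply ?U (L i) f) x - potential Ap k x * op_apply ?U (L i) f x"
      using i0[OF smooth_on_op_apply[OF U L f] x] ham by simp
    finally show "op_apply ?U (L i) (\<lambda>y. laplacian f y - potential Ap k y * f y) x
       = laplacian (op_apply ?U (L i) f) x - potential Ap k x * op_apply ?U (L i) f x" .
  qed
  define \<eta> where "\<eta> = \<xi> - (ah \<bullet> \<xi>) *\<^sub>R ah"
  have "p ((- (ah \<bullet> \<xi>)) *\<^sub>R ah + \<eta>) = p ((ah \<bullet> \<xi>) *\<^sub>R ah + \<eta>)"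
  proof (rule symbol_even)
    show "ah \<bullet> x \<noteq> 0" if "x \<in> ?U" for x
      using that \<alpha> by (auto simp: regular_set_altdef ax)
    show "ah \<bullet> \<eta> = 0" by (simp add: \<eta>_def inner_diff_right ah)
    show "k \<alpha> * (k \<alpha> + 1) = k \<alpha> * (k \<alpha> + 1)" ..
    show "k \<alpha> \<notin> \<int>" by (rule k)
  qed
  moreover have "(ah \<bullet> \<xi>) *\<^sub>R ah + \<eta> = \<xi>" by (simp add: \<eta>_def)
  moreover have "reflection \<alpha> \<xi> = (- (ah \<bullet> \<xi>)) *\<^sub>R ah + \<eta>"
    using nz by (simp add: reflection_def \<eta>_def ah_def dot_square_norm power2_eq_square scaleR_left_distrib[symmetric] algebra_simps)
  ultimately show ?thesis by simp
qed

section \<open>The reflection group and its root system\<close>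

lemma linear_reflection: "linear (reflection \<alpha>)"
  unfolding reflection_def[abs_def]
  by (rule linearI) (simp_all add: inner_add_right add_divide_distrib distrib_left scaleR_left_distrib scaleR_right_diff_distrib)

lemma reflection_reflection: "reflection \<alpha> (reflection \<alpha> x) = x"
  by (cases "\<alpha> = 0") (simp_all add: reflection_def inner_diff_right)

lemma bij_reflection: "bij (reflection \<alpha>)"
  by (rule involuntory_imp_bij) (rule reflection_reflection)

lemma BijGroup_UNIV:
  "carrier (BijGroup UNIV) = {f. bij f}" "\<one>\<^bsub>BijGroup UNIV\<^esub> = (\<lambda>x. x)"
  "bij g \<Longrightarrow> bij f \<Longrightarrow> g \<otimes>\<^bsub>BijGroup UNIV\<^esub> f = (\<lambda>x. g (f x))"
  by (auto simp: BijGroup_def Bij_def compose_def)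

text \<open>Reflections are involutions, so the clause for inverses of generators yields generators
  again.\<close>

lemma generate_reflections_induct:
  assumes w: "w \<in> generate (BijGroup UNIV) (reflection ` S)"
    and one: "P (\<lambda>x. x)" and refl: "\<And>\<alpha>. \<alpha> \<in> S \<Longrightarrow> P (reflection \<alpha>)"
    and comp: "\<And>v w. P v \<Longrightarrow> P w \<Longrightarrow> P (\<lambda>x. v (w x))"
  shows "P w"
proof -
  let ?G = "BijGroup (UNIV :: (real^'a) set)"
  interpret G: group ?G by (rule group_BijGroup)
  have sub: "reflection ` S \<subseteq> carrier ?G" by (auto simp: BijGroup_UNIV bij_reflection)
  have inv: "inv\<^bsub>?G\<^esub> (reflection \<alpha>) = reflection \<alpha>" for \<alpha>
    by (rule G.inv_equality) (simp_all add: BijGroup_UNIV bij_reflection reflection_reflection)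
  from w show ?thesis
  proof (induction rule: generate.induct)
    case (eng h1 h2)
    have "bij h1" "bij h2"
      using G.generate_in_carrier[OF sub] eng.hyps by (auto simp: BijGroup_UNIV)
    then show ?case using comp[OF eng.IH] by (simp add: BijGroup_UNIV)
  qed (auto simp: BijGroup_UNIV one refl inv)
qed

lemma mirror_eq_imp_parallel:
  fixes \<alpha> \<beta> :: "real^'n::finite"
  assumes "\<alpha> \<noteq> 0" "mirror \<alpha> = mirror \<beta>"
  shows "collinear {0, \<alpha>, \<beta>}"
proof -
  have "\<beta> \<bullet> (\<beta> - ((\<alpha> \<bullet> \<beta>) / (\<alpha> \<bullet> \<alpha>)) *\<^sub>R \<alpha>) = 0"
    using inner_rejection(1)[OF assms(1), of \<beta>] assms(2) by (auto simp: mirror_def)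
  then show ?thesis by (rule inner_rejection(2)[OF assms(1)])
qed

text \<open>One normal is chosen for each mirror, and the given vectors are taken for their own
  mirrors. The choice is consistent since nonparallel vectors have different mirrors.\<close>

lemma root_system_containing:
  fixes Ap :: "(real^'n::finite) set"
  assumes Ap: "0 \<notin> Ap" "pairwise (\<lambda>\<alpha> \<beta>. \<not> collinear {0, \<alpha>, \<beta>}) Ap" and W: "reflection ` Ap \<subseteq> W"
  shows "\<exists>R. root_system_of W R \<and> all_vectors Ap \<subseteq> R"
proof -
  have inj: "inj_on mirror Ap"
    using Ap mirror_eq_imp_parallel unfolding inj_on_def pairwise_def by metis
  define normal where "normal M = (if M \<in> mirror ` Ap then inv_into Ap mirror M
    else SOME \<beta>. \<beta> \<noteq> 0 \<and> mirror \<beta> = M)" for M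
  have normal: "normal M \<noteq> 0 \<and> mirror (normal M) = M" if "M \<in> mirrors W" for M
  proof (cases "M \<in> mirror ` Ap")
    case True
    then show ?thesis
      using Ap(1) inv_into_into[of M mirror Ap] f_inv_into_f[of M mirror Ap] by (auto simp: normal_def)
  next
    case False
    have "\<exists>\<beta>. \<beta> \<noteq> 0 \<and> mirror \<beta> = M" using that by (auto simp: mirrors_def)
    from someI_ex[OF this] show ?thesis using False by (simp add: normal_def)
  qed
  have nA: "\<alpha> \<in> normal ` mirrors W" if "\<alpha> \<in> Ap" for \<alpha>
  proof (rule image_eqI)
    show "\<alpha> = normal (mirror \<alpha>)" using that by (simp add: normal_def inv_into_f_f[OF inj])
    show "mirror \<alpha> \<in> mirrors W" using that Ap(1) W unfolding mirrors_def by blast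
  qed
  let ?Rp = "normal ` mirrors W"
  have "bij_betw mirror ?Rp (mirrors W)"
    by (rule bij_betw_byWitness[where f' = normal]) (use normal in auto)
  moreover have "0 \<notin> ?Rp" using normal by force
  ultimately have "root_system_of W (?Rp \<union> uminus ` ?Rp)"
    unfolding root_system_of_def by blast
  moreover have "all_vectors Ap \<subseteq> ?Rp \<union> uminus ` ?Rp"
    using nA unfolding all_vectors_def by blast
  ultimately show ?thesis by blast
qed

theorem theorem1p1:
  fixes Ap :: "(real^'n::finite) set" and k :: "real^'n \<Rightarrow> real"
    and L :: "'n \<Rightarrow> 'n coeffs" and p :: "'n \<Rightarrow> real^'n \<Rightarrow> real"
  assumes "configuration Ap k"
    and "quantum_integrals Ap k L"
    and "\<And>i. has_constant_symbol (regular_set Ap) (L i) (p i)"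
    and "alg_independent p"
    and "\<And>\<alpha>. \<alpha> \<in> all_vectors Ap \<Longrightarrow> k \<alpha> \<notin> \<int>"
  shows "\<exists>W R. finite_coxeter_group W \<and> root_system_of W R \<and>
           (\<forall>i. \<forall>w\<in>W. \<forall>\<xi>. p i (w \<xi>) = p i \<xi>) \<and> all_vectors Ap \<subseteq> R"
proof -
  let ?U = "regular_set Ap"
  have fin: "finite Ap" and A0: "0 \<notin> Ap" and par: "pairwise (\<lambda>\<alpha> \<beta>. \<not> collinear {0, \<alpha>, \<beta>}) Ap"
    using assms(1) by (auto simp: configuration_def)
  define W where "W = generate (BijGroup UNIV) (reflection ` Ap)"
  have refl: "p i (reflection \<alpha> \<xi>) = p i \<xi>" if "\<alpha> \<in> Ap" for \<alpha> i \<xi>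
    by (rule symbol_reflection_invariant[OF assms(1,2,3) that])
      (use assms(5) that in \<open>auto simp: all_vectors_def\<close>)
  have W: "linear w \<and> (\<forall>i \<xi>. p i (w \<xi>) = p i \<xi>)" if "w \<in> W" for w
    using that unfolding W_def
  proof (rule generate_reflections_induct)
    show "linear (\<lambda>x::real^'n. x) \<and> (\<forall>i \<xi>. p i \<xi> = p i \<xi>)" by (simp add: linear_ident)
    show "linear (reflection \<alpha>) \<and> (\<forall>i \<xi>. p i (reflection \<alpha> \<xi>) = p i \<xi>)" if "\<alpha> \<in> Ap" for \<alpha>
      using linear_reflection refl[OF that] by blast
    show "linear (\<lambda>x. v (w x)) \<and> (\<forall>i \<xi>. p i (v (w \<xi>)) = p i \<xi>)"
      if "linear v \<and> (\<forall>i \<xi>. p i (v \<xi>) = p i \<xi>)" "linear w \<and> (\<forall>i \<xi>. p i (w \<xi>) = p i \<xi>)" for v w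
      using that linear_compose[of w v] by (auto simp: comp_def)
  qed
  \<comment> \<open>The symbols are evaluated at one regular point, where the coefficients become
    numbers that exhibit each \<open>p i\<close> as a polynomial.\<close>
  obtain x1 where x1: "x1 \<in> ?U"
    using subspace_avoids_hyperplanes[OF subspace_UNIV fin] A0
    by (auto simp: regular_set_altdef) (metis inner_eq_zero_iff)
  define D where "D = (\<Sum>i\<in>UNIV. op_order ?U (L i))"
  have "bpoly D (p i)" for i
  proof -
    have fs: "finite (op_support ?U (L i))"
      using assms(2) by (auto simp: quantum_integrals_def Let_def diff_op_def)
    have eq: "p i = (\<lambda>\<xi>. \<Sum>\<nu> | \<nu> \<in> op_support ?U (L i) \<and> multi_degree \<nu> = op_order ?U (L i).
        L i \<nu> x1 * monomial_at \<xi> \<nu>)"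
      using assms(3)[of i] x1 unfolding has_constant_symbol_def principal_symbol_def by auto
    have "\<nu> \<in> degree_box D" if "multi_degree \<nu> = op_order ?U (L i)" for \<nu>
    proof -
      have "Poly_Mapping.lookup \<nu> j \<le> multi_degree \<nu>" for j
        unfolding multi_degree_def by (rule member_le_sum) auto
      moreover have "op_order ?U (L i) \<le> D" unfolding D_def by (rule member_le_sum) auto
      ultimately show ?thesis using that order_trans unfolding degree_box_def by fastforce
    qed
    then show ?thesis unfolding eq by (intro bpoly_sum bpoly_monomial) auto
  qed
  then have "finite W"
    by (rule finite_linear_symmetries[OF _ assms(4)]) (use W in auto)
  then have "finite_coxeter_group W"
    using A0 unfolding finite_coxeter_group_def W_def by blast
  moreover have "reflection ` Ap \<subseteq> W" unfolding W_def by (auto intro: generate.incl)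
  then obtain R where "root_system_of W R" "all_vectors Ap \<subseteq> R"
    using root_system_containing[OF A0 par] by blast
  ultimately show ?thesis using W by blast
qed

end
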